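(* In the setting of the context, there is a constant $\widetilde C(T)$, depending on $T$ (and not on $\Psi$), such that if $\Psi\in\mathcal N^2(0,T;L_2^0)$ and $W^\Psi(t):=\int_0^tS(t-\tau)\Psi(\tau)\,dW(\tau)$, $t\in[0,T]$, then $$\sup_{t\le T}\mathbb E\big(|W^\Psi(t)|_H\big)\le\widetilde C(T)\,|\Psi|_{\mathcal N^2(0,T;L_2^0)}.$$
   Context: $H$ and $U$ are separable (real) Hilbert spaces and $T>0$ is fixed. $(\Omega,\mathcal F,(\mathcal F_t)_{t\ge0},P)$ is a filtered probability space whose filtration is normal ($\mathcal F_0$ contains all $P$-null sets of $\mathcal F$, and $\mathcal F_t=\bigcap_{s>t}\mathcal F_s$). $W$ is a cylindrical Wiener process with respect to $(\mathcal F_t)$ with nonnegative covariance operator $Q\in L(U)$ ($\mathrm{Tr}\,Q<\infty$ is not assumed). There is a complete orthonormal set $\{e_k\}\subset U$ of eigenvectors of $Q$ with eigenvalues $\lambda_k$, and $W(t)=\sum_k e_k\beta_k(t)$ with independent real Wiener processes $\beta_k$, $\mathbb E\beta_k^2(t)=\lambda_k t$. $U_0:=Q^{1/2}(U)$ with inner product $\langle u,v\rangle_{U_0}=\langle Q^{-1/2}u,Q^{-1/2}v\rangle_U$. $L_2^0:=L_2(U_0,H)$ is the space of Hilbert-Schmidt operators from $U_0$ to $H$ with the Hilbert-Schmidt norm. $\mathcal N^2(0,T;L_2^0)$ is the Hilbert space of $L_2^0$-valued predictable processes $\Phi$ on $[0,T]$ with finite norm $|\Phi|_{\mathcal N^2(0,T;L_2^0)}=\big(\mathbb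 E\int_0^T|\Phi(\tau)|_{L_2^0}^2d\tau\big)^{1/2}$. Stochastic integrals are the usual Hilbert-space stochastic integrals with respect to the cylindrical Wiener process $W$. Volterra assumptions: $A:D(A)\subset H\to H$ is a closed, densely defined unbounded linear operator; $a\in L^1_{\mathrm{loc}}(\mathbb R_+)$; and the deterministic Volterra equation $X(t)=X_0+\int_0^t a(t-\tau)AX(\tau)\,d\tau+f(t)$ is well-posed, i.e. it admits a resolvent $(S(t))_{t\ge0}$: a family of bounded linear operators on $H$ such that (1) $S$ is strongly continuous on $\mathbb R_+$ and $S(0)=I$; (2) $S(t)D(A)\subset D(A)$ and $AS(t)x=S(t)Ax$ for $x\in D(A)$, $t\ge0$; (3) $S(t)x=x+\int_0^t a(t-\tau)AS(\tau)x\,d\tau$ for all $x\in D(A)$, $t\ge0$. The operators $A$, the kernel $a$ and hence $S$ are fixed. *)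

theory Defs
  imports "HOL-Probability.Probability"
begin

definition nonneg_selfadjoint :: "('u::real_inner \<Rightarrow>\<^sub>L 'u) \<Rightarrow> bool" where
  "nonneg_selfadjoint Q \<longleftrightarrow>
     (\<forall>x y. blinfun_apply Q x \<bullet> y = x \<bullet> blinfun_apply Q y) \<and> (\<forall>x. 0 \<le> blinfun_apply Q x \<bullet> x)"

text \<open>
  The index set \<open>K\<close> is an arbitrary set of natural numbers, so that \<open>U\<close> may be
  infinite-dimensional or finite-dimensional. The values \<open>e k\<close>, \<open>lam k\<close> for \<open>k\<close> outside
  \<open>K\<close> are irrelevant.
\<close>

definition orthonormal_eigenbasis ::
    "('u::real_inner \<Rightarrow>\<^sub>L 'u) \<Rightarrow> nat set \<Rightarrow> (nat \<Rightarrow> 'u) \<Rightarrow> (nat \<Rightarrow> real) \<Rightarrow> bool" where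
  "orthonormal_eigenbasis Q K e lam \<longleftrightarrow>
     (\<forall>j\<in>K. \<forall>k\<in>K. e j \<bullet> e k = (if j = k then 1 else 0)) \<and>
     closure (span (e ` K)) = UNIV \<and>
     (\<forall>k\<in>K. blinfun_apply Q (e k) = lam k *\<^sub>R e k)"

definition op_sqrt :: "('u::real_inner \<Rightarrow>\<^sub>L 'u) \<Rightarrow> ('u \<Rightarrow>\<^sub>L 'u)" where
  "op_sqrt Q = (THE R. nonneg_selfadjoint R \<and> R o\<^sub>L R = Q)"

definition pseudo_inverse :: "('u::real_inner \<Rightarrow>\<^sub>L 'u) \<Rightarrow> 'u \<Rightarrow> 'u" where
  "pseudo_inverse R u =
     (THE v. blinfun_apply R v = u \<and> (\<forall>w. blinfun_apply R w = 0 \<longrightarrow> v \<bullet> w = 0))"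

definition U0 :: "('u::real_inner \<Rightarrow>\<^sub>L 'u) \<Rightarrow> 'u set" where
  "U0 Q = range (blinfun_apply (op_sqrt Q))"

definition U0_inner :: "('u::real_inner \<Rightarrow>\<^sub>L 'u) \<Rightarrow> 'u \<Rightarrow> 'u \<Rightarrow> real" where
  "U0_inner Q u v = pseudo_inverse (op_sqrt Q) u \<bullet> pseudo_inverse (op_sqrt Q) v"

definition U0_norm :: "('u::real_inner \<Rightarrow>\<^sub>L 'u) \<Rightarrow> 'u \<Rightarrow> real" where
  "U0_norm Q u = sqrt (U0_inner Q u u)"

text \<open>
  The vectors \<open>U0_basis e lam k = Q\<^sup>1\<^sup>/\<^sup>2 (e k)\<close>, \<open>k \<in> supp_idx K lam\<close>, form a complete
  orthonormal set of the Hilbert space \<open>U0 Q\<close>: its inner product pulls them back to the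
  vectors \<open>e k\<close> with \<open>lam k > 0\<close>, which are complete in the orthogonal complement of the
  kernel of \<open>Q\<close>.
\<close>

definition supp_idx :: "nat set \<Rightarrow> (nat \<Rightarrow> real) \<Rightarrow> nat set" where
  "supp_idx K lam = {k \<in> K. 0 < lam k}"

definition U0_basis :: "(nat \<Rightarrow> 'u::real_vector) \<Rightarrow> (nat \<Rightarrow> real) \<Rightarrow> nat \<Rightarrow> 'u" where
  "U0_basis e lam k = sqrt (lam k) *\<^sub>R e k"

text \<open>
  The Hilbert-Schmidt norm with respect to the orthonormal basis \<open>g k\<close>, \<open>k \<in> I\<close>, of the
  domain; it does not depend on the choice of the basis. Below, \<open>I\<close> and \<open>g\<close> always stand
  for \<open>supp_idx K lam\<close> and \<open>U0_basis e lam\<close>.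
\<close>

definition hs_norm :: "nat set \<Rightarrow> (nat \<Rightarrow> 'u) \<Rightarrow> ('u \<Rightarrow> 'h::real_normed_vector) \<Rightarrow> real" where
  "hs_norm I g \<Phi> = sqrt (\<Sum>\<^sub>\<infinity>k\<in>I. (norm (\<Phi> (g k)))\<^sup>2)"

text \<open>
  An operator defined on \<open>U0 Q\<close> only is represented by a function on all of \<open>U\<close> that
  is \<open>0\<close> outside \<open>U0 Q\<close>, so that the representation is unique and is preserved by
  differences and by composition with operators on \<open>H\<close>.
\<close>

definition L20 ::
    "('u::real_inner \<Rightarrow>\<^sub>L 'u) \<Rightarrow> nat set \<Rightarrow> (nat \<Rightarrow> 'u) \<Rightarrow> ('u \<Rightarrow> 'h::real_normed_vector) set" where
  "L20 Q I g = {\<Phi>.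
     (\<forall>u\<in>U0 Q. \<forall>v\<in>U0 Q. \<Phi> (u + v) = \<Phi> u + \<Phi> v) \<and>
     (\<forall>c. \<forall>u\<in>U0 Q. \<Phi> (c *\<^sub>R u) = c *\<^sub>R \<Phi> u) \<and>
     (\<forall>u. u \<notin> U0 Q \<longrightarrow> \<Phi> u = 0) \<and>
     (\<exists>C. \<forall>u\<in>U0 Q. norm (\<Phi> u) \<le> C * U0_norm Q u) \<and>
     (\<lambda>k. (norm (\<Phi> (g k)))\<^sup>2) summable_on I}"

text \<open>The Borel sets of the normed space of Hilbert-Schmidt operators.\<close>

definition L20_borel ::
    "('u::real_inner \<Rightarrow>\<^sub>L 'u) \<Rightarrow> nat set \<Rightarrow> (nat \<Rightarrow> 'u) \<Rightarrow> ('u \<Rightarrow> 'h::real_normed_vector) measure" where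
  "L20_borel Q I g = sigma (L20 Q I g)
     {V. V \<subseteq> L20 Q I g \<and>
         (\<forall>\<Phi>\<in>V. \<exists>\<epsilon>>0. \<forall>\<Theta>\<in>L20 Q I g. hs_norm I g (\<lambda>u. \<Theta> u - \<Phi> u) < \<epsilon> \<longrightarrow> \<Theta> \<in> V)}"

definition normal_filtration :: "'w measure \<Rightarrow> (real \<Rightarrow> 'w measure) \<Rightarrow> bool" where
  "normal_filtration M F \<longleftrightarrow>
     (\<forall>t\<ge>0. subalgebra M (F t)) \<and>
     (\<forall>s\<ge>0. \<forall>t\<ge>s. sets (F s) \<subseteq> sets (F t)) \<and>
     null_sets M \<subseteq> sets (F 0) \<and>
     (\<forall>t\<ge>0. sets (F t) = (\<Inter>s\<in>{t<..}. sets (F s)))"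

definition predictable :: "'w measure \<Rightarrow> (real \<Rightarrow> 'w measure) \<Rightarrow> real \<Rightarrow> (real \<times> 'w) measure" where
  "predictable M F T = sigma ({0..T} \<times> space M)
     ({{s<..u} \<times> B | s u B. 0 \<le> s \<and> s < u \<and> u \<le> T \<and> B \<in> sets (F s)} \<union>
      {{0} \<times> B | B. B \<in> sets (F 0)})"

definition N2 ::
    "'w measure \<Rightarrow> (real \<Rightarrow> 'w measure) \<Rightarrow> ('u::real_inner \<Rightarrow>\<^sub>L 'u) \<Rightarrow> nat set \<Rightarrow> (nat \<Rightarrow> 'u) \<Rightarrow> real \<Rightarrow>
     (real \<Rightarrow> 'w \<Rightarrow> 'u \<Rightarrow> 'h::real_normed_vector) set" where
  "N2 M F Q I g T = {\<Phi>.
     (\<lambda>(\<tau>, \<omega>). \<Phi> \<tau> \<omega>) \<in> measurable (predictable M F T) (L20_borel Q I g) \<and>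
     (\<integral>\<^sup>+\<omega>. (\<integral>\<^sup>+\<tau>\<in>{0..T}. ennreal ((hs_norm I g (\<Phi> \<tau> \<omega>))\<^sup>2) \<partial>lborel) \<partial>M) < \<infinity>}"

definition N2_norm ::
    "'w measure \<Rightarrow> nat set \<Rightarrow> (nat \<Rightarrow> 'u) \<Rightarrow> real \<Rightarrow>
     (real \<Rightarrow> 'w \<Rightarrow> 'u \<Rightarrow> 'h::real_normed_vector) \<Rightarrow> real" where
  "N2_norm M I g T \<Phi> = sqrt (enn2real
     (\<integral>\<^sup>+\<omega>. (\<integral>\<^sup>+\<tau>\<in>{0..T}. ennreal ((hs_norm I g (\<Phi> \<tau> \<omega>))\<^sup>2) \<partial>lborel) \<partial>M))"

text \<open>
  A real Wiener process relative to \<open>F\<close> with \<open>E (b t)\<^sup>2 = lam * t\<close>. The case \<open>lam = 0\<close> is the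
  null process; it is separated because \<open>normal_density \<mu> 0\<close> is not a density.
\<close>

definition real_wiener ::
    "'w measure \<Rightarrow> (real \<Rightarrow> 'w measure) \<Rightarrow> real \<Rightarrow> (real \<Rightarrow> 'w \<Rightarrow> real) \<Rightarrow> bool" where
  "real_wiener M F lam b \<longleftrightarrow>
     (\<forall>t\<ge>0. b t \<in> borel_measurable (F t)) \<and>
     (AE \<omega> in M. b 0 \<omega> = 0) \<and>
     (AE \<omega> in M. continuous_on {0..} (\<lambda>t. b t \<omega>)) \<and>
     (\<forall>s\<ge>0. \<forall>t>s.
        if 0 < lam
        then distributed M lborel (\<lambda>\<omega>. b t \<omega> - b s \<omega>) (normal_density 0 (sqrt (lam * (t - s))))
        else (AE \<omega> in M. b t \<omega> - b s \<omega> = 0)) \<and>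
     (\<forall>s\<ge>0. \<forall>t>s. prob_space.indep_set M (sets (F s))
        {(\<lambda>\<omega>. b t \<omega> - b s \<omega>) -` B \<inter> space M | B. B \<in> sets borel})"

text \<open>
  The cylindrical Wiener process \<open>W t = (\<Sum>k\<in>K. \<beta> k t *\<^sub>R e k)\<close> is given by its coordinate
  processes; for covariance operators of infinite trace the series does not converge in
  \<open>U\<close>. That \<open>W\<close> is a Wiener process relative to \<open>F\<close> means that the whole increment
  \<open>W t - W s\<close>, i.e. the family of all its coordinates, is independent of \<open>F s\<close>.
\<close>

definition cylindrical_wiener ::
    "'w measure \<Rightarrow> (real \<Rightarrow> 'w measure) \<Rightarrow> nat set \<Rightarrow> (nat \<Rightarrow> real) \<Rightarrow>
     (nat \<Rightarrow> real \<Rightarrow> 'w \<Rightarrow> real) \<Rightarrow> bool" where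
  "cylindrical_wiener M F K lam \<beta> \<longleftrightarrow>
     (\<forall>k\<in>K. real_wiener M F (lam k) (\<beta> k)) \<and>
     prob_space.indep_vars M (\<lambda>_. PiM {0..} (\<lambda>_. borel)) (\<lambda>k \<omega>. \<lambda>t\<in>{0..}. \<beta> k t \<omega>) K \<and>
     (\<forall>s\<ge>0. \<forall>t>s. prob_space.indep_set M (sets (F s))
        {(\<lambda>\<omega>. \<lambda>k\<in>K. \<beta> k t \<omega> - \<beta> k s \<omega>) -` B \<inter> space M | B. B \<in> sets (PiM K (\<lambda>_. borel))})"

definition elementary ::
    "(real \<Rightarrow> 'w measure) \<Rightarrow> real \<Rightarrow> nat \<Rightarrow> (nat \<Rightarrow> real) \<Rightarrow> (nat \<Rightarrow> 'w \<Rightarrow> 'h) \<Rightarrow> bool" where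
  "elementary F t n p \<xi> \<longleftrightarrow>
     p 0 = 0 \<and> p n = t \<and> (\<forall>j<n. p j < p (Suc j)) \<and> (\<forall>j<n. simple_function (F (p j)) (\<xi> j))"

definition elem_process ::
    "nat \<Rightarrow> (nat \<Rightarrow> real) \<Rightarrow> (nat \<Rightarrow> 'w \<Rightarrow> 'h::real_vector) \<Rightarrow> real \<Rightarrow> 'w \<Rightarrow> 'h" where
  "elem_process n p \<xi> \<tau> \<omega> = (\<Sum>j<n. indicat_real {p j<..p (Suc j)} \<tau> *\<^sub>R \<xi> j \<omega>)"

definition elem_integral ::
    "(real \<Rightarrow> 'w \<Rightarrow> real) \<Rightarrow> nat \<Rightarrow> (nat \<Rightarrow> real) \<Rightarrow> (nat \<Rightarrow> 'w \<Rightarrow> 'h::real_vector) \<Rightarrow> 'w \<Rightarrow> 'h" where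
  "elem_integral b n p \<xi> \<omega> = (\<Sum>j<n. (b (p (Suc j)) \<omega> - b (p j) \<omega>) *\<^sub>R \<xi> j \<omega>)"

text \<open>
  \<open>Y\<close> is a version of the Ito integral over \<open>[0, t]\<close> of the \<open>H\<close>-valued, predictable, square
  integrable process \<open>\<phi>\<close> against the real process \<open>b\<close>: the mean square limit of the
  integrals of elementary processes which converge to \<open>\<phi>\<close>.
\<close>

definition is_ito_integral ::
    "'w measure \<Rightarrow> (real \<Rightarrow> 'w measure) \<Rightarrow> (real \<Rightarrow> 'w \<Rightarrow> real) \<Rightarrow> real \<Rightarrow>
     (real \<Rightarrow> 'w \<Rightarrow> 'h::real_normed_vector) \<Rightarrow> ('w \<Rightarrow> 'h) \<Rightarrow> bool" where
  "is_ito_integral M F b t \<phi> Y \<longleftrightarrow>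
     (\<lambda>(\<tau>, \<omega>). \<phi> \<tau> \<omega>) \<in> borel_measurable (predictable M F t) \<and>
     (\<integral>\<^sup>+\<omega>. (\<integral>\<^sup>+\<tau>\<in>{0..t}. ennreal ((norm (\<phi> \<tau> \<omega>))\<^sup>2) \<partial>lborel) \<partial>M) < \<infinity> \<and>
     Y \<in> borel_measurable M \<and>
     (\<exists>n p \<xi>.
        (\<forall>i::nat. elementary F t (n i) (p i) (\<xi> i)) \<and>
        (\<lambda>i. \<integral>\<^sup>+\<omega>. (\<integral>\<^sup>+\<tau>\<in>{0..t}.
             ennreal ((norm (elem_process (n i) (p i) (\<xi> i) \<tau> \<omega> - \<phi> \<tau> \<omega>))\<^sup>2) \<partial>lborel) \<partial>M)
          \<longlonglongrightarrow> 0 \<and>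
        (\<lambda>i. \<integral>\<^sup>+\<omega>. ennreal ((norm (elem_integral b (n i) (p i) (\<xi> i) \<omega> - Y \<omega>))\<^sup>2) \<partial>M)
          \<longlonglongrightarrow> 0)"

definition ito_integral ::
    "'w measure \<Rightarrow> (real \<Rightarrow> 'w measure) \<Rightarrow> (real \<Rightarrow> 'w \<Rightarrow> real) \<Rightarrow> real \<Rightarrow>
     (real \<Rightarrow> 'w \<Rightarrow> 'h::real_normed_vector) \<Rightarrow> 'w \<Rightarrow> 'h" where
  "ito_integral M F b t \<phi> = (SOME Y. is_ito_integral M F b t \<phi> Y)"

text \<open>
  The integral over \<open>[0, t]\<close> against the cylindrical Wiener process with coordinates \<open>\<beta>\<close>: the
  mean square limit, as \<open>m\<close> tends to infinity, of the integrals
  \<open>\<Sum>k<m. \<integral> \<Phi>(\<tau>)(e k) d\<beta> k(\<tau>)\<close> against the finite-dimensional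
  Wiener processes \<open>\<Sum>k<m. \<beta> k *\<^sub>R e k\<close>. Coordinates with \<open>lam k = 0\<close> are left out: there
  \<open>\<beta> k\<close> vanishes and \<open>e k\<close> is not in the domain \<open>U0 Q\<close> of \<open>\<Phi> \<tau> \<omega>\<close>.
\<close>

definition is_stoch_integral ::
    "'w measure \<Rightarrow> (real \<Rightarrow> 'w measure) \<Rightarrow> nat set \<Rightarrow> (nat \<Rightarrow> 'u) \<Rightarrow>
     (nat \<Rightarrow> real \<Rightarrow> 'w \<Rightarrow> real) \<Rightarrow> real \<Rightarrow> (real \<Rightarrow> 'w \<Rightarrow> 'u \<Rightarrow> 'h::real_normed_vector) \<Rightarrow>
     ('w \<Rightarrow> 'h) \<Rightarrow> bool" where
  "is_stoch_integral M F I e \<beta> t \<Phi> X \<longleftrightarrow>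
     X \<in> borel_measurable M \<and>
     (\<lambda>m. \<integral>\<^sup>+\<omega>. ennreal ((norm
          ((\<Sum>k\<in>I \<inter> {..<m}. ito_integral M F (\<beta> k) t (\<lambda>\<tau> \<omega>. \<Phi> \<tau> \<omega> (e k)) \<omega>) - X \<omega>))\<^sup>2) \<partial>M)
       \<longlonglongrightarrow> 0"

definition stoch_integral ::
    "'w measure \<Rightarrow> (real \<Rightarrow> 'w measure) \<Rightarrow> nat set \<Rightarrow> (nat \<Rightarrow> 'u) \<Rightarrow>
     (nat \<Rightarrow> real \<Rightarrow> 'w \<Rightarrow> real) \<Rightarrow> real \<Rightarrow> (real \<Rightarrow> 'w \<Rightarrow> 'u \<Rightarrow> 'h::real_normed_vector) \<Rightarrow> 'w \<Rightarrow> 'h" where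
  "stoch_integral M F I e \<beta> t \<Phi> = (SOME X. is_stoch_integral M F I e \<beta> t \<Phi> X)"

definition closed_densely_defined ::
    "'h::real_normed_vector set \<Rightarrow> ('h \<Rightarrow> 'h) \<Rightarrow> bool" where
  "closed_densely_defined D A \<longleftrightarrow>
     subspace D \<and>
     (\<forall>x\<in>D. \<forall>y\<in>D. A (x + y) = A x + A y) \<and>
     (\<forall>c. \<forall>x\<in>D. A (c *\<^sub>R x) = c *\<^sub>R A x) \<and>
     closed {(x, A x) | x. x \<in> D} \<and>
     closure D = UNIV"

definition volterra_resolvent ::
    "'h::{banach, second_countable_topology} set \<Rightarrow> ('h \<Rightarrow> 'h) \<Rightarrow> (real \<Rightarrow> real) \<Rightarrow>
     (real \<Rightarrow> 'h \<Rightarrow>\<^sub>L 'h) \<Rightarrow> bool" where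
  "volterra_resolvent D A a S \<longleftrightarrow>
     (\<forall>x. continuous_on {0..} (\<lambda>t. blinfun_apply (S t) x)) \<and>
     S 0 = id_blinfun \<and>
     (\<forall>t\<ge>0. \<forall>x\<in>D. blinfun_apply (S t) x \<in> D \<and> A (blinfun_apply (S t) x) = blinfun_apply (S t) (A x)) \<and>
     (\<forall>x\<in>D. \<forall>t\<ge>0. blinfun_apply (S t) x =
        x + (LINT \<tau>:{0..t}|lebesgue. a (t - \<tau>) *\<^sub>R A (blinfun_apply (S \<tau>) x)))"

definition stoch_convolution ::
    "'w measure \<Rightarrow> (real \<Rightarrow> 'w measure) \<Rightarrow> nat set \<Rightarrow> (nat \<Rightarrow> 'u) \<Rightarrow>
     (nat \<Rightarrow> real \<Rightarrow> 'w \<Rightarrow> real) \<Rightarrow> (real \<Rightarrow> 'h::real_normed_vector \<Rightarrow>\<^sub>L 'h) \<Rightarrow>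
     (real \<Rightarrow> 'w \<Rightarrow> 'u \<Rightarrow> 'h) \<Rightarrow> real \<Rightarrow> 'w \<Rightarrow> 'h" where
  "stoch_convolution M F I e \<beta> S \<Psi> t =
     stoch_integral M F I e \<beta> t (\<lambda>\<tau> \<omega> u. blinfun_apply (S (t - \<tau>)) (\<Psi> \<tau> \<omega> u))"

end

(*
  The constant is a multiple of the bound C of the norms of S on [0, T], which exists by the
  uniform boundedness principle. The Ito isometry turns E |W^Psi(t)|^2 into the sum over k of
  lam k * E (integral over [0, t] of |S(t - tau) Psi(tau) (e k)|^2), which is at most C^2 times the
  squared norm of Psi, and E |W^Psi(t)| is bounded by the Cauchy-Schwarz inequality.

  The stochastic integrals are choices of limits, so their existence is needed as well: elementary
  processes are dense in the square integrable predictable ones, and the integrals of elementary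
  processes satisfy a bilinear form of the isometry,
  E <int X d beta_k, int Y d beta_l> = delta_kl * lam k * E (int <X, Y> d tau).
  It holds for two arbitrary partitions of [0, t], which makes common refinements unnecessary.
*)
theory Submission
  imports Defs
begin

section \<open>Uniform boundedness and square integrable functions\<close>

text \<open>Both stochastic integrals are selected by \<open>SOME\<close>, so every estimate has to
  hold for an arbitrary limit in the sense of the definitions; approximating sequences are read off
  from the limit itself, not from the construction that proves existence. Passing to limits uses |x
  + y|^2 \<le> 2 |x|^2 + 2 |y|^2 instead of an exact isometry: twice between elementary processes
  and Ito integrals (factor 4), once more for the series over the coordinates (factor 8). Since 8
  \<le> 3^2, the final constant is \<open>3 * C\<close>. The weights \<open>lam k\<close> are
  absorbed by the basis \<open>g k = sqrt (lam k) *\<^sub>R e k\<close> of \<open>U0 Q\<close>: the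
  isometry produces lam k |Phi (e k)|^2 = |Phi (g k)|^2, and finite sums of these are compared with
  the Hilbert-Schmidt norm pointwise under the integral. Measurability is an obstacle of its own:
  Psi is measurable for the Borel sets of the Hilbert-Schmidt space, whereas the Ito integrals see
  the processes S(t - tau) Psi(tau) (e k).\<close>

theorem uniform_boundedness:
  fixes L :: "'i \<Rightarrow> 'a::banach \<Rightarrow>\<^sub>L 'b::real_normed_vector"
  assumes bounded: "\<And>x. \<exists>B. \<forall>i\<in>J. norm (blinfun_apply (L i) x) \<le> B"
  shows "\<exists>C\<ge>0. \<forall>i\<in>J. norm (L i) \<le> C"
proof -
  \<comment> \<open>Baire category: these sets are closed and cover the space, so one of them
    contains a ball.\<close>
  define V where "V n = {x. \<forall>i\<in>J. norm (blinfun_apply (L i) x) \<le> real n}" for n :: nat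
  have closed: "closed (V n)" for n
  proof -
    have "V n = (\<Inter>i\<in>J. {x. norm (blinfun_apply (L i) x) \<le> real n})"
      by (auto simp: V_def)
    moreover have "closed {x. norm (blinfun_apply (L i) x) \<le> real n}" for i
      by (intro closed_Collect_le continuous_intros)
    ultimately show ?thesis
      by auto
  qed
  have cover: "(\<Union>n. V n) = UNIV"
  proof -
    have "\<exists>n. x \<in> V n" for x
    proof -
      obtain B where "\<forall>i\<in>J. norm (blinfun_apply (L i) x) \<le> B"
        using bounded by blast
      moreover obtain n :: nat where "B \<le> real n"
        using real_arch_simple by blast
      ultimately have "x \<in> V n"
        by (auto simp: V_def intro: order_trans)
      then show ?thesis ..
    qed
    then show ?thesis by auto
  qed
  have "\<exists>n. interior (V n) \<noteq> {}"
  proof (rule ccontr)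
    assume "\<not> ?thesis"
    then have "euclidean interior_of \<Union>(range V) = {}"
      using closed
      by (intro Baire_category_alt) (auto simp: completely_metrizable_space_euclidean)
    then show False
      using cover by simp
  qed
  then obtain n c where "c \<in> interior (V n)"
    by auto
  then obtain r where r: "0 < r" "cball c r \<subseteq> V n"
    by (auto simp: mem_interior_cball)
  have "norm (L i) \<le> 2 * real n / r" if i: "i \<in> J" for i
  proof (rule norm_blinfun_bound)
    fix x
    show "norm (blinfun_apply (L i) x) \<le> 2 * real n / r * norm x"
    proof (cases "x = 0")
      case False
      define y where "y = (r / norm x) *\<^sub>R x"
      have "norm y = r"
        using False r by (simp add: y_def)
      \<comment> \<open>A vector of norm \<open>r\<close> is the difference of two points of the
        ball around \<open>c\<close>, whence the bound \<open>2 * real n / r\<close>.\<close>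
      then have "c + y \<in> V n" "c \<in> V n"
        using r by (auto simp: subset_iff dist_norm)
      then have "norm (blinfun_apply (L i) (c + y)) \<le> real n" "norm (blinfun_apply (L i) c) \<le> real n"
        using i by (auto simp: V_def)
      moreover have "blinfun_apply (L i) y = blinfun_apply (L i) (c + y) - blinfun_apply (L i) c"
        by (simp add: blinfun.add_right)
      ultimately have "norm (blinfun_apply (L i) y) \<le> 2 * real n"
        using norm_triangle_ineq4[of "blinfun_apply (L i) (c + y)" "blinfun_apply (L i) c"] by simp
      moreover have "norm (blinfun_apply (L i) y) = r / norm x * norm (blinfun_apply (L i) x)"
        using r by (simp add: y_def blinfun.scaleR_right)
      ultimately show ?thesis
        using False r by (simp add: field_simps)
    qed simp
  qed (use r in simp)
  then show ?thesis
    using r by (intro exI[of _ "2 * real n / r"]) auto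
qed

section \<open>Squared L2 norms in the extended nonnegative reals\<close>

lemma power2_norm_add_le:
  fixes x y :: "'a::real_normed_vector"
  shows "(norm (x + y))\<^sup>2 \<le> 2 * (norm x)\<^sup>2 + 2 * (norm y)\<^sup>2"
proof -
  have "(norm (x + y))\<^sup>2 \<le> (norm x + norm y)\<^sup>2"
    by (intro power_mono norm_triangle_ineq) simp
  also have "\<dots> \<le> 2 * (norm x)\<^sup>2 + 2 * (norm y)\<^sup>2"
    using sum_squares_bound[of "norm x" "norm y"] by (simp add: power2_sum)
  finally show ?thesis .
qed

text \<open>Kept squared and \<open>ennreal\<close>-valued, so that the estimates carry no
  integrability hypotheses; the price is a factor 2 in the triangle inequality.\<close>

definition L2sq :: "'a measure \<Rightarrow> ('a \<Rightarrow> 'b::real_normed_vector) \<Rightarrow> ennreal" where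
  "L2sq N f = (\<integral>\<^sup>+x. ennreal ((norm (f x))\<^sup>2) \<partial>N)"

lemma L2sq_cong: "(\<And>x. x \<in> space N \<Longrightarrow> f x = h x) \<Longrightarrow> L2sq N f = L2sq N h"
  unfolding L2sq_def by (intro nn_integral_cong) simp

lemma L2sq_minus_commute: "L2sq N (\<lambda>x. f x - h x) = L2sq N (\<lambda>x. h x - f x)"
  by (simp add: L2sq_def norm_minus_commute)

lemma L2sq_add_le:
  fixes f h :: "'a \<Rightarrow> 'b::{real_normed_vector, second_countable_topology}"
  assumes [measurable]: "f \<in> borel_measurable N" "h \<in> borel_measurable N"
  shows "L2sq N (\<lambda>x. f x + h x) \<le> 2 * L2sq N f + 2 * L2sq N h"
proof -
  have "L2sq N (\<lambda>x. f x + h x) \<le>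
      (\<integral>\<^sup>+x. 2 * ennreal ((norm (f x))\<^sup>2) + 2 * ennreal ((norm (h x))\<^sup>2) \<partial>N)"
    unfolding L2sq_def
  proof (rule nn_integral_mono)
    fix x
    have "2 * ennreal ((norm (f x))\<^sup>2) + 2 * ennreal ((norm (h x))\<^sup>2) =
        ennreal (2 * (norm (f x))\<^sup>2 + 2 * (norm (h x))\<^sup>2)"
      by (simp add: ennreal_mult)
    from ord_le_eq_trans[OF ennreal_leI[OF power2_norm_add_le] this[symmetric]]
    show "ennreal ((norm (f x + h x))\<^sup>2) \<le>
        2 * ennreal ((norm (f x))\<^sup>2) + 2 * ennreal ((norm (h x))\<^sup>2)" .
  qed
  also have "\<dots> = 2 * L2sq N f + 2 * L2sq N h"
    by (simp add: L2sq_def nn_integral_add nn_integral_cmult)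
  finally show ?thesis .
qed

lemma L2sq_triangle:
  fixes f h u :: "'a \<Rightarrow> 'b::{real_normed_vector, second_countable_topology}"
  assumes [measurable]: "f \<in> borel_measurable N" "h \<in> borel_measurable N" "u \<in> borel_measurable N"
  shows "L2sq N (\<lambda>x. f x - u x) \<le> 2 * L2sq N (\<lambda>x. f x - h x) + 2 * L2sq N (\<lambda>x. h x - u x)"
  using L2sq_add_le[of "\<lambda>x. f x - h x" N "\<lambda>x. h x - u x"] by simp

lemma L2sq_le:
  fixes f h :: "'a \<Rightarrow> 'b::{real_normed_vector, second_countable_topology}"
  assumes [measurable]: "f \<in> borel_measurable N" "h \<in> borel_measurable N"
  shows "L2sq N f \<le> 2 * L2sq N (\<lambda>x. f x - h x) + 2 * L2sq N h"
  using L2sq_triangle[of f N h "\<lambda>_. 0"] by simp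

lemma L2sq_scaleR:
  fixes f :: "'a \<Rightarrow> 'b::{real_normed_vector, second_countable_topology}"
  assumes [measurable]: "f \<in> borel_measurable N"
  shows "L2sq N (\<lambda>x. c *\<^sub>R f x) = ennreal (c\<^sup>2) * L2sq N f"
  by (simp add: L2sq_def power_mult_distrib ennreal_mult nn_integral_cmult)

text \<open>The bridge between two calculi: the isometry is computed with Bochner integrals of inner
  products, limits are taken in \<open>ennreal\<close>.\<close>

lemma L2sq_eq_integral:
  fixes f :: "'a \<Rightarrow> 'b::real_inner"
  assumes "integrable N (\<lambda>x. f x \<bullet> f x)"
  shows "L2sq N f = ennreal (\<integral>x. f x \<bullet> f x \<partial>N)"
  unfolding L2sq_def power2_norm_eq_inner by (rule nn_integral_eq_integral) (use assms in auto)

text \<open>Induction with the factor-2 inequality: the accumulated constant depends on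
  \<open>J\<close>, but is harmless since the limit is 0.\<close>

lemma L2sq_tendsto_sum:
  fixes f :: "'k \<Rightarrow> nat \<Rightarrow> 'a \<Rightarrow> 'b::{real_normed_vector, second_countable_topology}"
  assumes "finite J"
    and "\<And>k i. k \<in> J \<Longrightarrow> f k i \<in> borel_measurable N"
    and "\<And>k. k \<in> J \<Longrightarrow> (\<lambda>i. L2sq N (f k i)) \<longlonglongrightarrow> 0"
  shows "(\<lambda>i. L2sq N (\<lambda>x. \<Sum>k\<in>J. f k i x)) \<longlonglongrightarrow> 0"
  using assms
proof (induction J rule: finite_induct)
  case empty
  then show ?case by (simp add: L2sq_def)
next
  case (insert k J)
  have le: "L2sq N (\<lambda>x. \<Sum>l\<in>insert k J. f l i x) \<le>
      2 * L2sq N (f k i) + 2 * L2sq N (\<lambda>x. \<Sum>l\<in>J. f l i x)" for i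
    unfolding sum.insert[OF insert.hyps(1,2)]
    by (intro L2sq_add_le borel_measurable_sum insert.prems) auto
  have IH: "(\<lambda>i. L2sq N (\<lambda>x. \<Sum>l\<in>J. f l i x)) \<longlonglongrightarrow> 0"
    by (intro insert.IH insert.prems) auto
  have k: "(\<lambda>i. L2sq N (f k i)) \<longlonglongrightarrow> 0"
    by (intro insert.prems) auto
  have "(\<lambda>i. 2 * L2sq N (f k i) + 2 * L2sq N (\<lambda>x. \<Sum>l\<in>J. f l i x)) \<longlonglongrightarrow> 2 * 0 + 2 * 0"
    by (intro tendsto_add ennreal_tendsto_cmult IH k) auto
  then have lim: "(\<lambda>i. 2 * L2sq N (f k i) + 2 * L2sq N (\<lambda>x. \<Sum>l\<in>J. f l i x)) \<longlonglongrightarrow> 0"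
    by simp
  show ?case
    by (rule tendsto_sandwich[OF _ _ tendsto_const lim]) (intro always_eventually allI le zero_le)+
qed

text \<open>Two errors of size \<open>\<epsilon> / 4\<close>, combined by \<open>L2sq_add_le\<close>
  or \<open>L2sq_triangle\<close>, amount to \<open>\<epsilon>\<close>.\<close>

lemma ennreal_quarters:
  assumes "0 \<le> \<epsilon>"
  shows "2 * ennreal (\<epsilon> / 4) + 2 * ennreal (\<epsilon> / 4) = ennreal \<epsilon>"
proof -
  have "2 * ennreal (\<epsilon> / 4) = ennreal (\<epsilon> / 2)"
    using ennreal_mult[of 2 "\<epsilon> / 4"] assms by simp
  then show ?thesis
    using ennreal_plus[of "\<epsilon> / 2" "\<epsilon> / 2"] assms by simp
qed

lemma dominated_L2sq_tendsto:
  fixes f :: "nat \<Rightarrow> 'a \<Rightarrow> 'b::{real_normed_vector, second_countable_topology}"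
  assumes [measurable]: "\<And>i. f i \<in> borel_measurable N" "h \<in> borel_measurable N"
      "w \<in> borel_measurable N"
    and bound: "\<And>i x. x \<in> space N \<Longrightarrow> norm (f i x - h x) \<le> w x"
    and w: "(\<integral>\<^sup>+x. ennreal ((w x)\<^sup>2) \<partial>N) < \<infinity>"
    and lim: "\<And>x. x \<in> space N \<Longrightarrow> (\<lambda>i. f i x) \<longlonglongrightarrow> h x"
  shows "(\<lambda>i. L2sq N (\<lambda>x. f i x - h x)) \<longlonglongrightarrow> 0"
proof -
  have "(\<lambda>i. \<integral>\<^sup>+x. ennreal ((norm (f i x - h x))\<^sup>2) \<partial>N) \<longlonglongrightarrow> (\<integral>\<^sup>+x. 0 \<partial>N)"
  proof (rule nn_integral_dominated_convergence)
    show "AE x in N. ennreal ((norm (f i x - h x))\<^sup>2) \<le> ennreal ((w x)\<^sup>2)" for i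
      using bound by (intro AE_I2 ennreal_leI power_mono) auto
    show "AE x in N. (\<lambda>i. ennreal ((norm (f i x - h x))\<^sup>2)) \<longlonglongrightarrow> 0"
    proof (rule AE_I2)
      fix x assume "x \<in> space N"
      then have "(\<lambda>i. ennreal ((norm (f i x - h x))\<^sup>2)) \<longlonglongrightarrow> ennreal ((norm (h x - h x))\<^sup>2)"
        using lim by (intro tendsto_intros) auto
      then show "(\<lambda>i. ennreal ((norm (f i x - h x))\<^sup>2)) \<longlonglongrightarrow> 0"
        by simp
    qed
  qed (use w in measurable)
  then show ?thesis
    by (simp add: L2sq_def)
qed

section \<open>Completeness of L2 over a probability space\<close>

lemma ennreal_power2_le_imp_le:
  fixes x y :: ennreal
  assumes "x\<^sup>2 \<le> y\<^sup>2"
  shows "x \<le> y"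
proof (cases x y rule: ennreal2_cases)
  case (real_real a b)
  then show ?thesis
    using assms by (simp add: ennreal_power abs_le_square_iff[symmetric])
qed (use assms in \<open>auto simp: ennreal_power top_unique power2_eq_square ennreal_mult_eq_top_iff\<close>)

text \<open>The Riesz-Fischer argument: a subsequence with summable gaps converges almost
  everywhere, and Fatou's lemma turns this into mean square convergence of the whole
  sequence.\<close>

lemma (in prob_space) L2_complete:
  fixes f :: "nat \<Rightarrow> 'a \<Rightarrow> 'b::{banach, second_countable_topology}"
  assumes [measurable]: "\<And>i. f i \<in> borel_measurable M"
    and Cauchy: "\<And>\<epsilon>. 0 < \<epsilon> \<Longrightarrow> \<exists>n0. \<forall>i\<ge>n0. \<forall>j\<ge>n0. L2sq M (\<lambda>x. f i x - f j x) \<le> ennreal \<epsilon>"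
  shows "\<exists>Y\<in>borel_measurable M. (\<lambda>i. L2sq M (\<lambda>x. f i x - Y x)) \<longlonglongrightarrow> 0"
proof -
  have "\<forall>n. \<exists>n0. \<forall>i\<ge>n0. \<forall>j\<ge>n0. L2sq M (\<lambda>x. f i x - f j x) \<le> ennreal ((1/4)^n)"
    using Cauchy by simp
  then obtain n0 where n0: "\<And>n i j. i \<ge> n0 n \<Longrightarrow> j \<ge> n0 n \<Longrightarrow>
      L2sq M (\<lambda>x. f i x - f j x) \<le> ennreal ((1/4)^n)"
    by metis
  \<comment> \<open>The maximum puts both \<open>r n\<close> and \<open>r (Suc n)\<close> beyond
    \<open>n0 n\<close>; the summand \<open>n\<close> drives the indices to infinity.\<close>
  define r where "r n = Max (n0 ` {..Suc n}) + n" for n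
  have r_ge: "n0 n \<le> r n" "n0 n \<le> r (Suc n)" "n \<le> r n" for n
    by (auto simp: r_def intro!: trans_le_add1 Max_ge le_SucI)
  have step: "(\<integral>\<^sup>+x. ennreal (norm (f (r (Suc n)) x - f (r n) x)) \<partial>M) \<le> ennreal ((1/2)^n)" for n
  proof -
    \<comment> \<open>Cauchy-Schwarz against the constant 1, of integral 1, turns the squared gap
      \<open>(1/4)^n\<close> into the L1 gap \<open>(1/2)^n\<close>, which is summable.\<close>
    let ?g = "\<lambda>x. f (r (Suc n)) x - f (r n) x"
    have "(\<integral>\<^sup>+x. ennreal (norm (?g x)) * 1 \<partial>M)\<^sup>2 \<le>
        (\<integral>\<^sup>+x. (ennreal (norm (?g x)))\<^sup>2 \<partial>M) * (\<integral>\<^sup>+x. 1\<^sup>2 \<partial>M)"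
      by (rule Cauchy_Schwarz_nn_integral) measurable
    also have "\<dots> = L2sq M ?g"
      by (simp add: L2sq_def ennreal_power emeasure_space_1)
    also have "\<dots> \<le> ennreal ((1/4)^n)"
      by (intro n0 r_ge)
    also have "(1/4::real)^n = ((1/2)^n)\<^sup>2"
      by (simp add: power2_eq_square flip: power_mult_distrib)
    also have "ennreal (((1/2)^n)\<^sup>2) = (ennreal ((1/2)^n))\<^sup>2"
      by (simp add: ennreal_power)
    finally show ?thesis
      by (rule ennreal_power2_le_imp_le[OF ord_eq_le_trans[rotated]]) simp
  qed
  have "(\<integral>\<^sup>+x. (\<Sum>n. ennreal (norm (f (r (Suc n)) x - f (r n) x))) \<partial>M) =
      (\<Sum>n. \<integral>\<^sup>+x. ennreal (norm (f (r (Suc n)) x - f (r n) x)) \<partial>M)"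
    by (intro nn_integral_suminf) measurable
  also have "\<dots> \<le> (\<Sum>n. ennreal ((1/2)^n))"
    by (intro suminf_le step) auto
  also have "\<dots> = ennreal (\<Sum>n. (1/2)^n)"
    by (intro suminf_ennreal2) (auto intro: summable_geometric)
  finally have "(\<integral>\<^sup>+x. (\<Sum>n. ennreal (norm (f (r (Suc n)) x - f (r n) x))) \<partial>M) \<noteq> \<infinity>"
    by (auto simp: top_unique)
  then have "AE x in M. (\<Sum>n. ennreal (norm (f (r (Suc n)) x - f (r n) x))) \<noteq> \<infinity>"
    by (intro nn_integral_PInf_AE) measurable
  then have conv: "AE x in M. convergent (\<lambda>n. f (r n) x)"
  proof eventually_elim
    case (elim x)
    then have "summable (\<lambda>n. norm (f (r (Suc n)) x - f (r n) x))"
      by (intro summable_suminf_not_top) auto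
    then have "summable (\<lambda>n. f (r (Suc n)) x - f (r n) x)"
      by (rule summable_norm_cancel)
    then show ?case
      by (simp add: summable_iff_convergent sum_lessThan_telescope[of "\<lambda>i. f (r i) x"] convergent_diff_const_right_iff)
  qed
  \<comment> \<open>Where the subsequence diverges, \<open>lim\<close> has a value of no
    significance; this happens only on a null set.\<close>
  define Y where "Y x = lim (\<lambda>n. f (r n) x)" for x
  have [measurable]: "Y \<in> borel_measurable M"
    unfolding Y_def by (intro borel_measurable_lim_metric) measurable
  have bound: "L2sq M (\<lambda>x. f i x - Y x) \<le> ennreal ((1/4)^n)" if "i \<ge> n0 n" for i n
  proof -
    \<comment> \<open>Fatou with \<open>i\<close> fixed and \<open>m\<close> tending to infinity:
      the Cauchy bound for \<open>f i - f (r m)\<close> passes to \<open>f i - Y\<close>.\<close>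
    have "L2sq M (\<lambda>x. f i x - Y x) \<le> (\<integral>\<^sup>+x. liminf (\<lambda>m. ennreal ((norm (f i x - f (r m) x))\<^sup>2)) \<partial>M)"
      unfolding L2sq_def
    proof (rule nn_integral_mono_AE, use conv in eventually_elim)
      case (elim x)
      then have "(\<lambda>m. f (r m) x) \<longlonglongrightarrow> Y x"
        by (simp add: Y_def convergent_LIMSEQ_iff)
      then have "(\<lambda>m. ennreal ((norm (f i x - f (r m) x))\<^sup>2)) \<longlonglongrightarrow> ennreal ((norm (f i x - Y x))\<^sup>2)"
        by (intro tendsto_intros)
      then show ?case
        using lim_imp_Liminf[OF sequentially_bot, symmetric] by (metis order_refl)
    qed
    also have "\<dots> \<le> liminf (\<lambda>m. L2sq M (\<lambda>x. f i x - f (r m) x))"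
      unfolding L2sq_def by (intro nn_integral_liminf) measurable
    also have "\<dots> \<le> ennreal ((1/4)^n)"
    proof (rule Liminf_le)
      show "\<forall>\<^sub>F m in sequentially. L2sq M (\<lambda>x. f i x - f (r m) x) \<le> ennreal ((1/4)^n)"
        using eventually_ge_at_top[of "n0 n"]
      proof eventually_elim
        case (elim m)
        then show ?case
          using that r_ge(3)[of m] by (intro n0) auto
      qed
    qed simp
    finally show ?thesis .
  qed
  have "(\<lambda>i. L2sq M (\<lambda>x. f i x - Y x)) \<longlonglongrightarrow> 0"
  proof (rule order_tendstoI)
    fix a :: ennreal assume "0 < a"
    have "(\<lambda>n. ennreal ((1/4)^n)) \<longlonglongrightarrow> ennreal 0"
      by (intro tendsto_ennrealI LIMSEQ_realpow_zero) auto
    then have "\<forall>\<^sub>F n in sequentially. ennreal ((1/4)^n) < a"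
      using \<open>0 < a\<close> by (auto dest: order_tendstoD)
    then obtain n where "ennreal ((1/4)^n) < a"
      by (auto simp: eventually_sequentially)
    then show "\<forall>\<^sub>F i in sequentially. L2sq M (\<lambda>x. f i x - Y x) < a"
      using bound[of n] by (auto simp: eventually_sequentially intro: le_less_trans)
  qed simp
  then show ?thesis
    by (intro bexI[of _ Y]) auto
qed

section \<open>Bounds and integrability of products\<close>

lemma simple_function_bounded:
  fixes f :: "'a \<Rightarrow> 'b::real_normed_vector"
  assumes "simple_function N f"
  obtains B where "0 \<le> B" "\<And>x. x \<in> space N \<Longrightarrow> norm (f x) \<le> B"
proof
  \<comment> \<open>The extra \<open>0\<close> keeps the set nonempty over an empty space and makes
    the maximum nonnegative.\<close>
  let ?S = "insert 0 ((\<lambda>x. norm (f x)) ` space N)"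
  have "finite ((\<lambda>x. norm (f x)) ` space N)"
    using simple_functionD(1)[OF assms] by (auto simp flip: image_image)
  then have fin: "finite ?S"
    by simp
  then show "0 \<le> Max ?S" "\<And>x. x \<in> space N \<Longrightarrow> norm (f x) \<le> Max ?S"
    by (auto intro!: Max_ge)
qed

lemma integrable_mult_square:
  fixes f h :: "'a \<Rightarrow> real"
  assumes "f \<in> borel_measurable M" "h \<in> borel_measurable M"
    and "integrable M (\<lambda>\<omega>. (f \<omega>)\<^sup>2)" "integrable M (\<lambda>\<omega>. (h \<omega>)\<^sup>2)"
  shows "integrable M (\<lambda>\<omega>. f \<omega> * h \<omega>)"
proof (rule Bochner_Integration.integrable_bound)
  show "integrable M (\<lambda>\<omega>. (f \<omega>)\<^sup>2 + (h \<omega>)\<^sup>2)"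
    using assms by simp
  have "\<bar>x * y\<bar> \<le> x\<^sup>2 + y\<^sup>2" for x y :: real
    using sum_squares_bound[of "\<bar>x\<bar>" "\<bar>y\<bar>"] abs_ge_zero[of "x * y"]
    unfolding power2_abs mult.assoc abs_mult by linarith
  then show "AE \<omega> in M. norm (f \<omega> * h \<omega>) \<le> norm ((f \<omega>)\<^sup>2 + (h \<omega>)\<^sup>2)"
    by simp
qed (use assms in measurable)

lemma integrable_bounded_mult:
  fixes Z f :: "'a \<Rightarrow> real"
  assumes Z: "Z \<in> borel_measurable M" "\<And>\<omega>. \<omega> \<in> space M \<Longrightarrow> \<bar>Z \<omega>\<bar> \<le> B" and f: "integrable M f"
  shows "integrable M (\<lambda>\<omega>. Z \<omega> * f \<omega>)"
proof (rule Bochner_Integration.integrable_bound)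
  show "integrable M (\<lambda>\<omega>. B * f \<omega>)"
    using f by simp
  show "AE \<omega> in M. norm (Z \<omega> * f \<omega>) \<le> norm (B * f \<omega>)"
  proof (rule AE_I2)
    fix \<omega> assume "\<omega> \<in> space M"
    then show "norm (Z \<omega> * f \<omega>) \<le> norm (B * f \<omega>)"
      using Z(2)[of \<omega>] by (auto simp: abs_mult intro!: mult_right_mono)
  qed
qed (use Z f in measurable)

lemma finite_measure_time: "finite_measure (restrict_space lborel {0..t::real})"
  by (rule finite_measureI) (simp add: emeasure_restrict_space space_restrict_space emeasure_lborel_Icc_eq)

section \<open>Hilbert-Schmidt operators\<close>

lemma U0_scaleR_iff:
  fixes Q :: "'u::real_inner \<Rightarrow>\<^sub>L 'u"
  assumes "c \<noteq> 0"
  shows "c *\<^sub>R u \<in> U0 Q \<longleftrightarrow> u \<in> U0 Q"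
proof -
  have scale: "c *\<^sub>R u \<in> U0 Q" if "u \<in> U0 Q" for c u
    using that by (auto simp: U0_def simp flip: blinfun.scaleR_right)
  show ?thesis
    using scale[of u c] scale[of "c *\<^sub>R u" "1 / c"] assms by auto
qed

text \<open>Both sides vanish for \<open>u\<close> outside the subspace \<open>U0 Q\<close>; nothing about \<open>op_sqrt Q\<close> is used.\<close>

lemma L20_scaleR:
  assumes "\<Phi> \<in> L20 Q I g" "c \<noteq> 0"
  shows "\<Phi> (c *\<^sub>R u) = c *\<^sub>R \<Phi> u"
  using assms U0_scaleR_iff[of c u Q] by (cases "u \<in> U0 Q") (auto simp: L20_def)

lemma L20_summable: "\<Phi> \<in> L20 Q I g \<Longrightarrow> (\<lambda>k. (norm (\<Phi> (g k)))\<^sup>2) summable_on I"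
  by (simp add: L20_def)

text \<open>Summability has to be assumed: \<open>infsum\<close> of a non-summable family is
  \<open>0\<close>, and the inequality can fail then.\<close>

lemma hs_norm_sum_le:
  assumes "(\<lambda>k. (norm (\<Phi> (g k)))\<^sup>2) summable_on I" "finite J" "J \<subseteq> I"
  shows "(\<Sum>k\<in>J. (norm (\<Phi> (g k)))\<^sup>2) \<le> (hs_norm I g \<Phi>)\<^sup>2"
proof -
  have "0 \<le> (\<Sum>\<^sub>\<infinity>k\<in>I. (norm (\<Phi> (g k)))\<^sup>2)"
    by (intro infsum_nonneg) simp
  then have "(hs_norm I g \<Phi>)\<^sup>2 = (\<Sum>\<^sub>\<infinity>k\<in>I. (norm (\<Phi> (g k)))\<^sup>2)"
    by (simp add: hs_norm_def)
  then show ?thesis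
    using finite_sum_le_infsum[OF assms] by simp
qed

text \<open>Evaluation at a basis vector is 1-Lipschitz for the Hilbert-Schmidt norm. The squares of
  the difference are summable by |x - y|^2 \<le> 2 |x|^2 + 2 |y|^2.\<close>

lemma L20_eval_diff_le:
  assumes \<Theta>: "\<Theta> \<in> L20 Q I g" and \<Phi>: "\<Phi> \<in> L20 Q I g" and k: "k \<in> I"
  shows "norm (\<Theta> (g k) - \<Phi> (g k)) \<le> hs_norm I g (\<lambda>u. \<Theta> u - \<Phi> u)"
proof -
  have "(\<lambda>k. (norm (\<Theta> (g k) - \<Phi> (g k)))\<^sup>2) summable_on I"
  proof (rule summable_on_comparison_test)
    show "(\<lambda>k. 2 * (norm (\<Theta> (g k)))\<^sup>2 + 2 * (norm (\<Phi> (g k)))\<^sup>2) summable_on I"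
      by (intro summable_on_add summable_on_cmult_right L20_summable[OF \<Theta>] L20_summable[OF \<Phi>])
    show "(norm (\<Theta> (g k) - \<Phi> (g k)))\<^sup>2 \<le> 2 * (norm (\<Theta> (g k)))\<^sup>2 + 2 * (norm (\<Phi> (g k)))\<^sup>2" for k
      using power2_norm_add_le[of "\<Theta> (g k)" "- \<Phi> (g k)"] by simp
  qed simp
  from hs_norm_sum_le[of "\<lambda>u. \<Theta> u - \<Phi> u" g I "{k}", OF this] k
  have "(norm (\<Theta> (g k) - \<Phi> (g k)))\<^sup>2 \<le> (hs_norm I g (\<lambda>u. \<Theta> u - \<Phi> u))\<^sup>2"
    by simp
  moreover have "0 \<le> hs_norm I g (\<lambda>u. \<Theta> u - \<Phi> u)"
    by (simp add: hs_norm_def infsum_nonneg)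
  ultimately show ?thesis
    by (rule power2_le_imp_le)
qed

lemma space_L20_borel: "space (L20_borel Q I g) = L20 Q I g"
  unfolding L20_borel_def by (rule space_measure_of) auto

text \<open>By the Lipschitz bound, preimages of open sets are open for the Hilbert-Schmidt norm,
  hence generators of \<open>L20_borel\<close>. This is how measurability of \<open>\<Psi>\<close>
  reaches its single coordinates.\<close>

lemma measurable_L20_eval:
  assumes k: "k \<in> I"
  shows "(\<lambda>\<Phi>. \<Phi> (g k)) \<in> borel_measurable (L20_borel Q I g)"
proof (rule borel_measurableI)
  fix V :: "'b set" assume V: "open V"
  let ?W = "(\<lambda>\<Phi>. \<Phi> (g k)) -` V \<inter> L20 Q I g"
  have "\<exists>\<epsilon>>0. \<forall>\<Theta>\<in>L20 Q I g. hs_norm I g (\<lambda>u. \<Theta> u - \<Phi> u) < \<epsilon> \<longrightarrow> \<Theta> \<in> ?W" if "\<Phi> \<in> ?W" for \<Phi>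
  proof -
    have \<Phi>: "\<Phi> \<in> L20 Q I g" "\<Phi> (g k) \<in> V"
      using that by auto
    then obtain \<epsilon> where \<epsilon>: "0 < \<epsilon>" "\<And>y. dist y (\<Phi> (g k)) < \<epsilon> \<Longrightarrow> y \<in> V"
      using V unfolding open_dist by blast
    have "\<Theta> \<in> ?W" if "\<Theta> \<in> L20 Q I g" "hs_norm I g (\<lambda>u. \<Theta> u - \<Phi> u) < \<epsilon>" for \<Theta>
      using L20_eval_diff_le[OF that(1) \<Phi>(1) k] that by (auto simp: dist_norm intro!: \<epsilon>(2))
    then show ?thesis
      using \<epsilon>(1) by blast
  qed
  then show "(\<lambda>\<Phi>. \<Phi> (g k)) -` V \<inter> space (L20_borel Q I g) \<in> sets (L20_borel Q I g)"
    unfolding space_L20_borel unfolding L20_borel_def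
    by (intro in_measure_of) auto
qed

section \<open>Increments of the Wiener process\<close>

locale wiener_family = prob_space M for M :: "'w measure" +
  fixes F :: "real \<Rightarrow> 'w measure" and K :: "nat set" and lam :: "nat \<Rightarrow> real"
    and \<beta> :: "nat \<Rightarrow> real \<Rightarrow> 'w \<Rightarrow> real"
  assumes filtration: "normal_filtration M F"
    and wiener: "cylindrical_wiener M F K lam \<beta>"
begin

definition incr :: "nat \<Rightarrow> real \<Rightarrow> real \<Rightarrow> 'w \<Rightarrow> real" where
  "incr k s t \<omega> = \<beta> k t \<omega> - \<beta> k s \<omega>"

lemma incr_same [simp]: "incr k s s = (\<lambda>_. 0)"
  by (auto simp: incr_def)

section \<open>Measurability along the filtration\<close>

lemma subalgebra_F: "0 \<le> t \<Longrightarrow> subalgebra M (F t)"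
  using conjunct1[OF filtration[unfolded normal_filtration_def]] by simp

lemma space_F: "0 \<le> t \<Longrightarrow> space (F t) = space M"
  using subalgebra_F by (simp add: subalgebra_def)

lemma sets_F_mono: "0 \<le> s \<Longrightarrow> s \<le> t \<Longrightarrow> sets (F s) \<subseteq> sets (F t)"
  using conjunct1[OF conjunct2[OF filtration[unfolded normal_filtration_def]]] by simp

lemma sets_F_M: "0 \<le> s \<Longrightarrow> sets (F s) \<subseteq> sets M"
  using subalgebra_F by (simp add: subalgebra_def)

lemma F_measurable_M: "f \<in> measurable (F t) N \<Longrightarrow> 0 \<le> t \<Longrightarrow> f \<in> measurable M N"
  using subalgebra_F by (rule measurable_from_subalg)

lemma F_measurable_mono:
  assumes "f \<in> measurable (F s) N" "0 \<le> s" "s \<le> t"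
  shows "f \<in> measurable (F t) N"
proof (rule measurable_from_subalg)
  show "subalgebra (F t) (F s)"
    using assms sets_F_mono[of s t] space_F[of s] space_F[of t] by (simp add: subalgebra_def)
qed fact

lemma beta_measurable_F: "k \<in> K \<Longrightarrow> 0 \<le> t \<Longrightarrow> \<beta> k t \<in> borel_measurable (F t)"
  using wiener by (simp add: cylindrical_wiener_def real_wiener_def)

lemma incr_measurable_F:
  assumes "k \<in> K" "0 \<le> s" "s \<le> t"
  shows "incr k s t \<in> borel_measurable (F t)"
proof -
  have [measurable]: "\<beta> k t \<in> borel_measurable (F t)" "\<beta> k s \<in> borel_measurable (F t)"
    using assms by (auto intro: beta_measurable_F F_measurable_mono[of _ s])
  show ?thesis
    unfolding incr_def by measurable
qed

lemma incr_measurable_M: "k \<in> K \<Longrightarrow> 0 \<le> s \<Longrightarrow> s \<le> t \<Longrightarrow> incr k s t \<in> borel_measurable M"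
  by (rule F_measurable_M[OF incr_measurable_F]) auto

section \<open>Independence and second moments of the increments\<close>

lemma supp_idx_K: "k \<in> supp_idx K lam \<Longrightarrow> k \<in> K"
  and supp_idx_pos: "k \<in> supp_idx K lam \<Longrightarrow> 0 < lam k"
  by (auto simp: supp_idx_def)

text \<open>The function \<open>h\<close> sees all coordinates at once: a product of increments of
  two different coordinates has to be independent of \<open>F s\<close>, which independence of each
  single coordinate would not give.\<close>

lemma indep_future_incr:
  assumes "0 \<le> s" "s < t"
    and Z: "Z \<in> borel_measurable (F s)"
    and h[measurable]: "h \<in> borel_measurable (PiM K (\<lambda>_. borel :: real measure))"
  shows "indep_var (borel :: real measure) Z (borel :: real measure) (\<lambda>\<omega>. h (\<lambda>k\<in>K. incr k s t \<omega>))"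
    (is "indep_var _ _ _ (\<lambda>\<omega>. h (?V \<omega>))")
proof -
  have indep: "indep_set (sets (F s)) {?V -` B \<inter> space M | B. B \<in> sets (PiM K (\<lambda>_. borel))}"
    using wiener assms by (simp add: cylindrical_wiener_def incr_def)
  have V[measurable]: "?V \<in> measurable M (PiM K (\<lambda>_. borel))"
    using assms by (intro measurable_restrict incr_measurable_M) auto
  have ZM: "Z \<in> borel_measurable M"
    using F_measurable_M[OF Z] assms by simp
  \<comment> \<open>Independence of random variables concerns the generated sigma-algebras; for
    intersection-stable systems it suffices to check the preimages themselves.\<close>
  have stable: "Int_stable {X -` A \<inter> space M |A. A \<in> sets (borel :: real measure)}" for X :: "'w \<Rightarrow> real"
  proof (rule Int_stableI)
    fix a b assume "a \<in> {X -` A \<inter> space M |A. A \<in> sets borel}" "b \<in> {X -` A \<inter> space M |A. A \<in> sets borel}"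
    then obtain A B where "a = X -` A \<inter> space M" "b = X -` B \<inter> space M" "A \<in> sets borel" "B \<in> sets borel"
      by auto
    then have "a \<inter> b = X -` (A \<inter> B) \<inter> space M" "A \<inter> B \<in> sets borel"
      by auto
    then show "a \<inter> b \<in> {X -` A \<inter> space M |A. A \<in> sets borel}"
      by blast
  qed
  show ?thesis
    unfolding indep_var_eq
  proof (intro conjI indep_set_sigma_sets stable ZM)
    show "(\<lambda>\<omega>. h (?V \<omega>)) \<in> borel_measurable M"
      by measurable
    show "indep_set {Z -` A \<inter> space M |A. A \<in> sets borel} {(\<lambda>\<omega>. h (?V \<omega>)) -` A \<inter> space M |A. A \<in> sets borel}"
      (is "indep_set ?A ?B")
    proof (rule indep_setI)
      have A: "?A \<subseteq> sets (F s)"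
        using measurable_sets[OF Z] space_F assms by auto
      \<comment> \<open>A preimage under \<open>h\<close> composed with the increment vector is a
        preimage under that vector, so the independence contained in
        \<open>cylindrical_wiener\<close> applies.\<close>
      have B: "?B \<subseteq> {?V -` B \<inter> space M | B. B \<in> sets (PiM K (\<lambda>_. borel))}"
      proof safe
        fix A :: "real set" assume "A \<in> sets borel"
        then have "h -` A \<inter> space (PiM K (\<lambda>_. borel)) \<in> sets (PiM K (\<lambda>_. borel))"
          by (rule measurable_sets[OF h])
        moreover have "(\<lambda>\<omega>. h (?V \<omega>)) -` A \<inter> space M = ?V -` (h -` A \<inter> space (PiM K (\<lambda>_. borel))) \<inter> space M"
          using measurable_space[OF V] by auto
        ultimately show "\<exists>B. (\<lambda>\<omega>. h (?V \<omega>)) -` A \<inter> space M = ?V -` B \<inter> space M \<and> B \<in> sets (PiM K (\<lambda>_. borel))"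
          by blast
      qed
      show "?A \<subseteq> events"
        using A sets_F_M[OF \<open>0 \<le> s\<close>] by (rule order_trans)
      show "?B \<subseteq> events"
        by (rule order_trans[OF B]) (auto intro: measurable_sets[OF V])
      fix a b assume "a \<in> ?A" "b \<in> ?B"
      then show "prob (a \<inter> b) = prob a * prob b"
        by (intro indep_setD[OF indep] subsetD[OF A] subsetD[OF B])
    qed
  qed
qed

text \<open>The normal law is available for \<open>s < t\<close> and \<open>0 < lam k\<close> only.
  Membership of \<open>k\<close> in \<open>supp_idx K lam\<close> gives the second condition; for
  \<open>s = t\<close> the increment is zero.\<close>

lemma incr_moments:
  assumes k: "k \<in> supp_idx K lam" and "0 \<le> s" "s \<le> t"
  shows "integrable M (incr k s t)" "integrable M (\<lambda>\<omega>. (incr k s t \<omega>)\<^sup>2)"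
    and "expectation (incr k s t) = 0" "expectation (\<lambda>\<omega>. (incr k s t \<omega>)\<^sup>2) = lam k * (t - s)"
proof -
  let ?\<sigma> = "sqrt (lam k * (t - s))"
  have "integrable M (incr k s t) \<and> integrable M (\<lambda>\<omega>. (incr k s t \<omega>)\<^sup>2) \<and>
      expectation (incr k s t) = 0 \<and> expectation (\<lambda>\<omega>. (incr k s t \<omega>)\<^sup>2) = lam k * (t - s)"
  proof (cases "s = t")
    case False
    then have "s < t"
      using assms by simp
    have \<sigma>: "0 < ?\<sigma>"
      using supp_idx_pos[OF k] \<open>s < t\<close> by simp
    have "real_wiener M F (lam k) (\<beta> k)"
      using wiener supp_idx_K[OF k] by (simp add: cylindrical_wiener_def)
    then have "distributed M lborel (\<lambda>\<omega>. \<beta> k t \<omega> - \<beta> k s \<omega>) (normal_density 0 ?\<sigma>)"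
      using supp_idx_pos[OF k] \<open>s < t\<close> assms by (simp add: real_wiener_def)
    then have D: "distributed M lborel (incr k s t) (normal_density 0 ?\<sigma>)"
      by (simp add: incr_def[abs_def])
    have "integrable M (incr k s t)"
      using distributed_integrable[OF D, of "\<lambda>x. x"] integrable_normal_moment_nz_1[OF \<sigma>, of 0] by simp
    moreover have "integrable M (\<lambda>\<omega>. (incr k s t \<omega>)\<^sup>2)"
      using distributed_integrable[OF D, of "\<lambda>x. x\<^sup>2"] integrable_normal_moment[OF \<sigma>, of 0 2] by simp
    moreover have "expectation (incr k s t) = 0"
      using normal_distributed_expectation[OF \<sigma> D] .
    ultimately show ?thesis
      using normal_distributed_variance[OF \<sigma> D] supp_idx_pos[OF k] \<open>s < t\<close> by simp
  qed auto
  then show "integrable M (incr k s t)" "integrable M (\<lambda>\<omega>. (incr k s t \<omega>)\<^sup>2)"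
    "expectation (incr k s t) = 0" "expectation (\<lambda>\<omega>. (incr k s t \<omega>)\<^sup>2) = lam k * (t - s)"
    by auto
qed

text \<open>For \<open>k \<noteq> l\<close> the two whole paths are independent and the increments
  are functions of them, so the expectation factors into two vanishing means.\<close>

lemma incr_mult_moment:
  assumes k: "k \<in> supp_idx K lam" and l: "l \<in> supp_idx K lam" and "0 \<le> s" "s \<le> t"
  shows "expectation (\<lambda>\<omega>. incr k s t \<omega> * incr l s t \<omega>) = (if k = l then lam k * (t - s) else 0)"
proof (cases "k = l")
  case True
  then show ?thesis
    using incr_moments(4)[OF k] assms by (simp add: power2_eq_square)
next
  case False
  have "indep_vars (\<lambda>_. PiM {0..} (\<lambda>_. borel)) (\<lambda>k \<omega>. \<lambda>t\<in>{0..}. \<beta> k t \<omega>) K"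
    using wiener by (simp add: cylindrical_wiener_def)
  then have "indep_vars (\<lambda>_. PiM {0..} (\<lambda>_. borel)) (\<lambda>k \<omega>. \<lambda>t\<in>{0..}. \<beta> k t \<omega>) {k, l}"
    by (rule indep_vars_subset) (use k l supp_idx_K in auto)
  then have "indep_vars (\<lambda>_. borel) (\<lambda>k \<omega>. (\<lambda>f. f t - f s) (\<lambda>t\<in>{0..}. \<beta> k t \<omega>)) {k, l}"
    by (rule indep_vars_compose2)
      (use assms in \<open>auto intro!: borel_measurable_diff measurable_component_singleton\<close>)
  then have indep: "indep_vars (\<lambda>_. borel) (\<lambda>k. incr k s t) {k, l}"
    using assms by (simp add: incr_def[abs_def])
  have "expectation (\<lambda>\<omega>. \<Prod>i\<in>{k, l}. incr i s t \<omega>) = (\<Prod>i\<in>{k, l}. expectation (incr i s t))"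
    by (rule indep_vars_lebesgue_integral[OF _ indep]) (use incr_moments(1) assms in auto)
  then show ?thesis
    using False incr_moments(3)[OF k] assms by simp
qed

lemma integrable_bounded_incr_incr:
  assumes "k \<in> supp_idx K lam" "l \<in> supp_idx K lam" "0 \<le> s" "s \<le> t" "0 \<le> s'" "s' \<le> t'"
    and "Z \<in> borel_measurable M" "\<And>\<omega>. \<omega> \<in> space M \<Longrightarrow> \<bar>Z \<omega>\<bar> \<le> B"
  shows "integrable M (\<lambda>\<omega>. Z \<omega> * (incr k s t \<omega> * incr l s' t' \<omega>))"
  using assms by (intro integrable_bounded_mult[where B = B] integrable_mult_square)
    (auto intro: incr_measurable_M incr_moments supp_idx_K)

text \<open>The martingale property of \<open>\<beta> k\<close>, tested against the past variable
  \<open>Z\<close>.\<close>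

lemma expectation_past_incr:
  assumes k: "k \<in> supp_idx K lam" and "0 \<le> s" "s \<le> t"
    and Z: "Z \<in> borel_measurable (F s)" "integrable M Z"
  shows "expectation (\<lambda>\<omega>. Z \<omega> * incr k s t \<omega>) = 0"
proof (cases "s = t")
  case False
  then have "s < t"
    using assms by simp
  have "(\<lambda>f. f k) \<in> borel_measurable (PiM K (\<lambda>_. borel :: real measure))"
    using supp_idx_K[OF k] by simp
  from indep_future_incr[OF \<open>0 \<le> s\<close> \<open>s < t\<close> Z(1) this]
  have "indep_var borel Z borel (incr k s t)"
    using supp_idx_K[OF k] by simp
  then have "expectation (\<lambda>\<omega>. Z \<omega> * incr k s t \<omega>) = expectation Z * expectation (incr k s t)"
    using assms by (intro indep_var_lebesgue_integral Z incr_moments) auto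
  then show ?thesis
    using incr_moments(3)[OF k] assms by simp
qed simp

text \<open>The joint increment is independent of \<open>F s\<close>, so the conditional covariance
  of two coordinates given the past is deterministic.\<close>

lemma expectation_past_incr_incr:
  assumes k: "k \<in> supp_idx K lam" and l: "l \<in> supp_idx K lam" and "0 \<le> s" "s \<le> t"
    and Z: "Z \<in> borel_measurable (F s)" "integrable M Z"
  shows "expectation (\<lambda>\<omega>. Z \<omega> * (incr k s t \<omega> * incr l s t \<omega>)) =
    (if k = l then lam k * (t - s) else 0) * expectation Z"
proof (cases "s = t")
  case False
  then have "s < t"
    using assms by simp
  have "(\<lambda>f. f k * f l) \<in> borel_measurable (PiM K (\<lambda>_. borel :: real measure))"
    using supp_idx_K k l by (intro borel_measurable_times) auto
  from indep_future_incr[OF \<open>0 \<le> s\<close> \<open>s < t\<close> Z(1) this]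
  have "indep_var borel Z borel (\<lambda>\<omega>. incr k s t \<omega> * incr l s t \<omega>)"
    using supp_idx_K k l by simp
  moreover have "integrable M (\<lambda>\<omega>. incr k s t \<omega> * incr l s t \<omega>)"
    using assms by (intro integrable_mult_square) (auto intro: incr_measurable_M incr_moments supp_idx_K)
  ultimately have "expectation (\<lambda>\<omega>. Z \<omega> * (incr k s t \<omega> * incr l s t \<omega>)) =
      expectation Z * expectation (\<lambda>\<omega>. incr k s t \<omega> * incr l s t \<omega>)"
    by (intro indep_var_lebesgue_integral Z)
  then show ?thesis
    using incr_mult_moment[OF k l] assms by simp
qed simp

text \<open>Only the overlap of the two intervals contributes. After cutting at the later start
  \<open>s'\<close> and at the earlier end, every other product has a factor of mean zero for which
  \<open>Z\<close> and the partner increment lie in the past. \<open>Z\<close> may depend on the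
  past of \<open>s'\<close>, not just of \<open>s\<close>, because it will be a product of
  coefficients from two different partitions.\<close>

lemma expectation_incr_incr_ordered:
  assumes k: "k \<in> supp_idx K lam" and l: "l \<in> supp_idx K lam"
    and s: "0 \<le> s" "s \<le> s'" and u: "s \<le> u" "s' \<le> u'"
    and Z: "Z \<in> borel_measurable (F s')" "\<And>\<omega>. \<omega> \<in> space M \<Longrightarrow> \<bar>Z \<omega>\<bar> \<le> B"
  shows "expectation (\<lambda>\<omega>. Z \<omega> * (incr k s u \<omega> * incr l s' u' \<omega>)) =
    (if k = l then lam k * max 0 (min u u' - s') else 0) * expectation Z"
proof -
  have s': "0 \<le> s'"
    using s by simp
  have ZM[measurable]: "Z \<in> borel_measurable M"
    using F_measurable_M[OF Z(1) s'] .
  have intZ: "integrable M Z"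
    using integrable_bounded_mult[OF ZM Z(2), of "\<lambda>_. 1"] by simp
  note meas = incr_measurable_F[OF supp_idx_K]
  note int2 = integrable_bounded_incr_incr[OF _ _ _ _ _ _ ZM Z(2)]
  \<comment> \<open>The first increment ends where the second begins; together with \<open>Z\<close>
    it is known at time \<open>b\<close>.\<close>
  have past: "expectation (\<lambda>\<omega>. Z \<omega> * (incr i a b \<omega> * incr j b c \<omega>)) = 0"
    if "i \<in> supp_idx K lam" "j \<in> supp_idx K lam" "0 \<le> a" "a \<le> b" "s' \<le> b" "b \<le> c" for i j a b c
  proof -
    have "Z \<in> borel_measurable (F b)"
      using F_measurable_mono[OF Z(1)] s' that by simp
    moreover have "incr i a b \<in> borel_measurable (F b)"
      using that by (intro meas) auto
    ultimately have "(\<lambda>\<omega>. Z \<omega> * incr i a b \<omega>) \<in> borel_measurable (F b)"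
      by measurable
    moreover have "integrable M (\<lambda>\<omega>. Z \<omega> * incr i a b \<omega>)"
      using that by (intro integrable_bounded_mult[OF ZM Z(2)] incr_moments) auto
    ultimately have "expectation (\<lambda>\<omega>. Z \<omega> * incr i a b \<omega> * incr j b c \<omega>) = 0"
      using that s' by (intro expectation_past_incr) auto
    then show ?thesis
      by (simp add: mult.assoc)
  qed
  show ?thesis
  proof (cases "u \<le> s'")
    \<comment> \<open>The first interval ends before the second begins and cannot be cut at
      \<open>s'\<close>; here \<open>Z\<close> times the first increment is already known at
      \<open>s'\<close>.\<close>
    case True
    have *: "incr l s' u' \<omega> = incr l u u' \<omega> - incr l u s' \<omega>" for \<omega>
      by (simp add: incr_def)
    have "(\<lambda>\<omega>. Z \<omega> * incr k s u \<omega>) \<in> borel_measurable (F s')"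
      using Z(1) F_measurable_mono[OF meas[OF k], of s u s'] True s u by simp
    moreover have "integrable M (\<lambda>\<omega>. Z \<omega> * incr k s u \<omega>)"
      using k s u by (intro integrable_bounded_mult[OF ZM Z(2)] incr_moments) auto
    ultimately have "expectation (\<lambda>\<omega>. Z \<omega> * incr k s u \<omega> * incr l s' u' \<omega>) = 0"
      using l s' u by (intro expectation_past_incr) auto
    then show ?thesis
      using True by (simp add: mult.assoc max_def)
  next
    case False
    define v where "v = min u u'"
    have v: "s' \<le> v" "v \<le> u" "v \<le> u'" "v = u \<or> v = u'"
      using False u by (auto simp: v_def min_def)
    \<comment> \<open>The product of the increments over \<open>(v, u]\<close> and
      \<open>(v, u']\<close> is absent, since \<open>v\<close> is one of the two ends and that
      increment vanishes.\<close>
    have eq: "Z \<omega> * (incr k s u \<omega> * incr l s' u' \<omega>) =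
        Z \<omega> * (incr k s s' \<omega> * incr l s' u' \<omega>) + Z \<omega> * (incr k s' v \<omega> * incr l s' v \<omega>) +
        Z \<omega> * (incr k s' v \<omega> * incr l v u' \<omega>) + Z \<omega> * (incr l s' v \<omega> * incr k v u \<omega>)" for \<omega>
      using v(4) by (auto simp: incr_def algebra_simps)
    have "expectation (\<lambda>\<omega>. Z \<omega> * (incr k s u \<omega> * incr l s' u' \<omega>)) =
        expectation (\<lambda>\<omega>. Z \<omega> * (incr k s s' \<omega> * incr l s' u' \<omega>)) +
        expectation (\<lambda>\<omega>. Z \<omega> * (incr k s' v \<omega> * incr l s' v \<omega>)) +
        expectation (\<lambda>\<omega>. Z \<omega> * (incr k s' v \<omega> * incr l v u' \<omega>)) +
        expectation (\<lambda>\<omega>. Z \<omega> * (incr l s' v \<omega> * incr k v u \<omega>))"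
      unfolding eq using k l s u v s' by (subst Bochner_Integration.integral_add; (intro Bochner_Integration.integrable_add int2; simp)?)+ simp
    also have "\<dots> = expectation (\<lambda>\<omega>. Z \<omega> * (incr k s' v \<omega> * incr l s' v \<omega>))"
      using past[OF k l, of s s' u'] past[OF k l, of s' v u'] past[OF l k, of s' v u] s u v s' by simp
    also have "\<dots> = (if k = l then lam k * (v - s') else 0) * expectation Z"
      using v s' by (intro expectation_past_incr_incr k l Z(1) intZ)
    finally show ?thesis
      using v by (simp add: v_def max_def)
  qed
qed

text \<open>The later of the two starting times acts as the present; if it is \<open>s\<close>, the
  two increments exchange roles.\<close>

lemma expectation_incr_incr:
  assumes k: "k \<in> supp_idx K lam" and l: "l \<in> supp_idx K lam"
    and s: "0 \<le> s" "s \<le> u" and s': "0 \<le> s'" "s' \<le> u'"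
    and Z: "Z \<in> borel_measurable (F (max s s'))" "\<And>\<omega>. \<omega> \<in> space M \<Longrightarrow> \<bar>Z \<omega>\<bar> \<le> B"
  shows "expectation (\<lambda>\<omega>. Z \<omega> * (incr k s u \<omega> * incr l s' u' \<omega>)) =
    (if k = l then lam k * max 0 (min u u' - max s s') else 0) * expectation Z"
proof (cases "s \<le> s'")
  case True
  then show ?thesis
    using expectation_incr_incr_ordered[OF k l _ True s(2) s'(2) _ Z(2)] Z(1) s by (simp add: max_def)
next
  case False
  then have "s' \<le> s"
    by simp
  then show ?thesis
    using expectation_incr_incr_ordered[OF l k _ _ s'(2) s(2) _ Z(2)] Z(1) s' False
    by (simp add: max_def min.commute mult.commute[of "incr k s u _"] split: if_splits)
qed

section \<open>The isometry for elementary processes\<close>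

text \<open>A finite measure with the same underlying set as \<open>predictable M F t\<close> for
  \<open>0 \<le> t\<close>, so that the predictable sigma-algebra becomes a subalgebra.\<close>

definition time_prod :: "real \<Rightarrow> (real \<times> 'w) measure" where
  "time_prod t = restrict_space lborel {0..t} \<Otimes>\<^sub>M M"

lemma space_time_prod: "space (time_prod t) = {0..t} \<times> space M"
  by (simp add: time_prod_def space_pair_measure space_restrict_space)

lemma finite_measure_time_prod: "finite_measure (time_prod t)"
  unfolding time_prod_def
  using finite_measure_pair_measure[OF finite_measure_axioms finite_measure_time] .

lemma measurable_snd_time_prod: "f \<in> measurable M N \<Longrightarrow> (\<lambda>z. f (snd z)) \<in> measurable (time_prod t) N"
  unfolding time_prod_def by (rule measurable_compose[OF measurable_snd])

lemma measurable_fst_time_prod: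
  assumes "f \<in> measurable borel N"
  shows "(\<lambda>z. f (fst z)) \<in> measurable (time_prod t) N"
proof -
  have "f \<in> measurable (restrict_space lborel {0..t}) N"
    using assms by (intro measurable_restrict_space1) simp
  then show ?thesis
    unfolding time_prod_def by measurable
qed

lemma pair_sigma_finite_time: "pair_sigma_finite (restrict_space lborel {0..t::real}) M"
proof -
  interpret T: finite_measure "restrict_space lborel {0..t}"
    by (rule finite_measure_time)
  show ?thesis ..
qed

text \<open>Tonelli. The left side is the iterated form in which \<open>N2\<close> and
  \<open>is_ito_integral\<close> are written.\<close>

lemma nn_integral_time_prod:
  assumes "(\<lambda>z. f (fst z) (snd z)) \<in> borel_measurable (time_prod t)"
  shows "(\<integral>\<^sup>+\<omega>. (\<integral>\<^sup>+\<tau>\<in>{0..t}. f \<tau> \<omega> \<partial>lborel) \<partial>M) = (\<integral>\<^sup>+z. f (fst z) (snd z) \<partial>time_prod t)"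
proof -
  interpret pair_sigma_finite "restrict_space lborel {0..t}" M
    by (rule pair_sigma_finite_time)
  show ?thesis
    using nn_integral_snd[OF assms[unfolded time_prod_def]]
    by (simp add: time_prod_def nn_integral_restrict_space)
qed

lemma L2sq_time_prod:
  fixes f :: "real \<Rightarrow> 'w \<Rightarrow> 'b::{real_normed_vector, second_countable_topology}"
  assumes [measurable]: "(\<lambda>z. f (fst z) (snd z)) \<in> borel_measurable (time_prod t)"
  shows "(\<integral>\<^sup>+\<omega>. (\<integral>\<^sup>+\<tau>\<in>{0..t}. ennreal ((norm (f \<tau> \<omega>))\<^sup>2) \<partial>lborel) \<partial>M) =
    L2sq (time_prod t) (\<lambda>z. f (fst z) (snd z))"
  unfolding L2sq_def by (rule nn_integral_time_prod) measurable

lemma integral_time_prod_mult: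
  fixes f :: "real \<Rightarrow> real" and Z :: "'w \<Rightarrow> real"
  assumes f: "f \<in> borel_measurable borel" "\<And>\<tau>. \<bar>f \<tau>\<bar> \<le> C"
    and Z: "Z \<in> borel_measurable M" "\<And>\<omega>. \<omega> \<in> space M \<Longrightarrow> \<bar>Z \<omega>\<bar> \<le> B"
  shows "integrable (time_prod t) (\<lambda>z. f (fst z) * Z (snd z))"
    and "(LINT z|time_prod t. f (fst z) * Z (snd z)) =
      (LINT \<tau>|lborel. indicat_real {0..t} \<tau> * f \<tau>) * expectation Z"
proof -
  interpret pair_sigma_finite "restrict_space lborel {0..t}" M
    by (rule pair_sigma_finite_time)
  interpret P: finite_measure "time_prod t"
    by (rule finite_measure_time_prod)
  have [measurable]: "(\<lambda>z. f (fst z)) \<in> borel_measurable (time_prod t)"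
      "(\<lambda>z. Z (snd z)) \<in> borel_measurable (time_prod t)"
    using f(1) Z(1) by (auto intro: measurable_fst_time_prod measurable_snd_time_prod)
  show int: "integrable (time_prod t) (\<lambda>z. f (fst z) * Z (snd z))"
  proof (rule P.integrable_const_bound[of _ "C * B"])
    have "0 \<le> C"
      using f(2)[of 0] by linarith
    then show "AE z in time_prod t. norm (f (fst z) * Z (snd z)) \<le> C * B"
      using f(2) Z(2)
      by (intro AE_I2) (auto simp: abs_mult space_time_prod intro!: mult_mono)
  qed measurable
  show "(LINT z|time_prod t. f (fst z) * Z (snd z)) =
      (LINT \<tau>|lborel. indicat_real {0..t} \<tau> * f \<tau>) * expectation Z"
    using integral_fst'[OF int[unfolded time_prod_def]]
    by (simp add: time_prod_def integral_restrict_space)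
qed

text \<open>The counterpart of \<open>expectation_incr_incr\<close>: the same overlap length
  appears, which is why the isometry holds term by term.\<close>

lemma integral_time_prod_indicator:
  assumes "0 \<le> a" "b \<le> t" "0 \<le> a'" "b' \<le> t"
    and Z: "Z \<in> borel_measurable M" "\<And>\<omega>. \<omega> \<in> space M \<Longrightarrow> \<bar>Z \<omega>\<bar> \<le> B"
  shows "integrable (time_prod t)
      (\<lambda>z. indicat_real {a<..b} (fst z) * indicat_real {a'<..b'} (fst z) * Z (snd z))"
    and "(LINT z|time_prod t. indicat_real {a<..b} (fst z) * indicat_real {a'<..b'} (fst z) * Z (snd z)) =
      max 0 (min b b' - max a a') * expectation Z"
proof -
  let ?f = "\<lambda>\<tau>. indicat_real {a<..b} \<tau> * indicat_real {a'<..b'} \<tau>"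
  have f: "?f \<in> borel_measurable borel" "\<bar>?f \<tau>\<bar> \<le> 1" for \<tau>
    by (auto simp: indicator_def)
  show "integrable (time_prod t)
      (\<lambda>z. indicat_real {a<..b} (fst z) * indicat_real {a'<..b'} (fst z) * Z (snd z))"
    by (rule integral_time_prod_mult(1)[OF f Z])
  have "(LINT \<tau>|lborel. indicat_real {0..t} \<tau> * ?f \<tau>) =
      (LINT \<tau>|lborel. indicat_real {max a a'<..min b b'} \<tau>)"
    using assms by (intro Bochner_Integration.integral_cong) (auto simp: indicator_def)
  also have "\<dots> = measure lborel {max a a'<..min b b'}"
    by simp
  also have "measure lborel {c<..d} = max 0 (d - c)" for c d :: real
    by (cases "c \<le> d") auto
  finally show "(LINT z|time_prod t. indicat_real {a<..b} (fst z) * indicat_real {a'<..b'} (fst z) * Z (snd z)) =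
      max 0 (min b b' - max a a') * expectation Z"
    using integral_time_prod_mult(2)[OF f Z] by simp
qed

section \<open>Elementary processes and their integrals\<close>

lemma elementary_mono:
  assumes "elementary F t n p \<xi>" "i \<le> j" "j \<le> n"
  shows "p i \<le> p j"
  using assms(2,3)
proof (induction rule: dec_induct)
  case (step j)
  then have "p j < p (Suc j)"
    using assms(1) by (auto simp: elementary_def)
  then show ?case
    using step by simp
qed simp

lemma elementary_bounds:
  assumes "elementary F t n p \<xi>" "j < n"
  shows "0 \<le> p j" "p j \<le> p (Suc j)" "p (Suc j) \<le> t" "simple_function (F (p j)) (\<xi> j)"
  using elementary_mono[OF assms(1), of 0 j] elementary_mono[OF assms(1), of "Suc j" n]
    elementary_mono[OF assms(1), of j "Suc j"] assms
  by (auto simp: elementary_def)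

definition proc :: "nat \<Rightarrow> (nat \<Rightarrow> real) \<Rightarrow> (nat \<Rightarrow> 'w \<Rightarrow> 'b) \<Rightarrow> real \<times> 'w \<Rightarrow> 'b::real_vector" where
  "proc n p \<xi> z = elem_process n p \<xi> (fst z) (snd z)"

lemma elementary_measurable_M:
  fixes \<xi> :: "nat \<Rightarrow> 'w \<Rightarrow> 'b::{real_normed_vector, second_countable_topology}"
  assumes "elementary F t n p \<xi>" "j < n"
  shows "\<xi> j \<in> borel_measurable M"
  using F_measurable_M[OF borel_measurable_simple_function] elementary_bounds[OF assms] by blast

lemma proc_measurable:
  fixes \<xi> :: "nat \<Rightarrow> 'w \<Rightarrow> 'b::{real_normed_vector, second_countable_topology}"
  assumes "elementary F t n p \<xi>"
  shows "proc n p \<xi> \<in> borel_measurable (time_prod t)"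
  unfolding proc_def elem_process_def
  using elementary_measurable_M[OF assms]
  by (intro borel_measurable_sum borel_measurable_scaleR measurable_fst_time_prod measurable_snd_time_prod)
    auto

lemma elem_integral_incr:
  "elem_integral (\<beta> k) n p \<xi> \<omega> = (\<Sum>j<n. incr k (p j) (p (Suc j)) \<omega> *\<^sub>R \<xi> j \<omega>)"
  by (simp add: elem_integral_def incr_def)

lemma elem_integral_measurable:
  fixes \<xi> :: "nat \<Rightarrow> 'w \<Rightarrow> 'b::{real_normed_vector, second_countable_topology}"
  assumes "elementary F t n p \<xi>" "k \<in> K"
  shows "elem_integral (\<beta> k) n p \<xi> \<in> borel_measurable M"
  unfolding elem_integral_incr[abs_def]
  using assms elementary_bounds[OF assms(1)]
  by (intro borel_measurable_sum borel_measurable_scaleR incr_measurable_M elementary_measurable_M) auto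

text \<open>Both sides are double sums over pairs of cells, one from each partition, and agree
  summand by summand: up to the factor \<open>lam k\<close> or \<open>0\<close>, each summand is the
  overlap of the cells times the mean of the inner product of the coefficients.\<close>

lemma elem_integral_inner:
  fixes \<xi> \<xi>' :: "nat \<Rightarrow> 'w \<Rightarrow> 'b::{real_inner, second_countable_topology}"
  assumes k: "k \<in> supp_idx K lam" and l: "l \<in> supp_idx K lam"
    and E: "elementary F t n p \<xi>" and E': "elementary F t n' p' \<xi>'"
  shows "integrable M (\<lambda>\<omega>. elem_integral (\<beta> k) n p \<xi> \<omega> \<bullet> elem_integral (\<beta> l) n' p' \<xi>' \<omega>)"
    and "integrable (time_prod t) (\<lambda>z. proc n p \<xi> z \<bullet> proc n' p' \<xi>' z)"
    and "expectation (\<lambda>\<omega>. elem_integral (\<beta> k) n p \<xi> \<omega> \<bullet> elem_integral (\<beta> l) n' p' \<xi>' \<omega>) =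
      (if k = l then lam k else 0) * (LINT z|time_prod t. proc n p \<xi> z \<bullet> proc n' p' \<xi>' z)"
proof -
  let ?Z = "\<lambda>i j \<omega>. \<xi> i \<omega> \<bullet> \<xi>' j \<omega>"
  let ?I = "\<lambda>i j \<omega>. ?Z i j \<omega> * (incr k (p i) (p (Suc i)) \<omega> * incr l (p' j) (p' (Suc j)) \<omega>)"
  let ?P = "\<lambda>i j z. indicat_real {p i<..p (Suc i)} (fst z) * indicat_real {p' j<..p' (Suc j)} (fst z) *
    ?Z i j (snd z)"
  note b = elementary_bounds[OF E] and b' = elementary_bounds[OF E']
  have sumI: "elem_integral (\<beta> k) n p \<xi> \<omega> \<bullet> elem_integral (\<beta> l) n' p' \<xi>' \<omega> =
      (\<Sum>i<n. \<Sum>j<n'. ?I i j \<omega>)" for \<omega>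
    unfolding elem_integral_incr inner_sum_left unfolding inner_sum_right
    by (intro sum.cong) (simp_all add: mult_ac)
  have sumP: "proc n p \<xi> z \<bullet> proc n' p' \<xi>' z = (\<Sum>i<n. \<Sum>j<n'. ?P i j z)" for z
    unfolding proc_def elem_process_def inner_sum_left unfolding inner_sum_right
    by (intro sum.cong) (simp_all add: mult_ac)
  \<comment> \<open>The coefficients take finitely many values; boundedness keeps their products
    with the Gaussian increments integrable.\<close>
  have Z_bound: "\<exists>B. \<forall>\<omega>\<in>space M. \<bar>?Z i j \<omega>\<bar> \<le> B" if ij: "i < n" "j < n'" for i j
  proof -
    obtain C where C: "0 \<le> C" "\<And>\<omega>. \<omega> \<in> space (F (p i)) \<Longrightarrow> norm (\<xi> i \<omega>) \<le> C"
      using simple_function_bounded[OF b(4)[OF ij(1)]] by blast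
    obtain C' where C': "0 \<le> C'" "\<And>\<omega>. \<omega> \<in> space (F (p' j)) \<Longrightarrow> norm (\<xi>' j \<omega>) \<le> C'"
      using simple_function_bounded[OF b'(4)[OF ij(2)]] by blast
    have "\<bar>?Z i j \<omega>\<bar> \<le> C * C'" if "\<omega> \<in> space M" for \<omega>
      using Cauchy_Schwarz_ineq2[of "\<xi> i \<omega>" "\<xi>' j \<omega>"] mult_mono[OF C(2) C'(2) C(1) norm_ge_zero, of \<omega> \<omega>]
        that space_F b(1)[OF ij(1)] b'(1)[OF ij(2)] by auto
    then show ?thesis
      by blast
  qed
  then obtain B where B: "\<And>i j \<omega>. i < n \<Longrightarrow> j < n' \<Longrightarrow> \<omega> \<in> space M \<Longrightarrow> \<bar>?Z i j \<omega>\<bar> \<le> B i j"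
    by metis
  \<comment> \<open>The product of two coefficients is known only at the later of their left end
    points, the present of \<open>expectation_incr_incr\<close>.\<close>
  have Z_F: "?Z i j \<in> borel_measurable (F (max (p i) (p' j)))" if ij: "i < n" "j < n'" for i j
  proof -
    have "\<xi> i \<in> borel_measurable (F (max (p i) (p' j)))" "\<xi>' j \<in> borel_measurable (F (max (p i) (p' j)))"
      using b(1,4)[OF ij(1)] b'(1,4)[OF ij(2)]
      by (auto intro: F_measurable_mono[OF borel_measurable_simple_function])
    then show ?thesis
      by (rule borel_measurable_inner)
  qed
  have Z_M: "?Z i j \<in> borel_measurable M" if ij: "i < n" "j < n'" for i j
    using elementary_measurable_M[OF E ij(1)] elementary_measurable_M[OF E' ij(2)]
    by (rule borel_measurable_inner)
  have int_I: "integrable M (?I i j)" if ij: "i < n" "j < n'" for i j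
    using integrable_bounded_incr_incr[OF k l b(1,2)[OF ij(1)] b'(1,2)[OF ij(2)] Z_M[OF ij] B[OF ij]] .
  have int_P: "integrable (time_prod t) (?P i j)" if ij: "i < n" "j < n'" for i j
    using integral_time_prod_indicator(1)[OF b(1,3)[OF ij(1)] b'(1,3)[OF ij(2)] Z_M[OF ij] B[OF ij]] .
  show "integrable M (\<lambda>\<omega>. elem_integral (\<beta> k) n p \<xi> \<omega> \<bullet> elem_integral (\<beta> l) n' p' \<xi>' \<omega>)"
    unfolding sumI by (intro Bochner_Integration.integrable_sum int_I) auto
  show "integrable (time_prod t) (\<lambda>z. proc n p \<xi> z \<bullet> proc n' p' \<xi>' z)"
    unfolding sumP by (intro Bochner_Integration.integrable_sum int_P) auto
  have "expectation (\<lambda>\<omega>. elem_integral (\<beta> k) n p \<xi> \<omega> \<bullet> elem_integral (\<beta> l) n' p' \<xi>' \<omega>) =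
      (\<Sum>i<n. \<Sum>j<n'. expectation (?I i j))"
    unfolding sumI
    by (subst Bochner_Integration.integral_sum)
      (auto intro!: sum.cong Bochner_Integration.integral_sum Bochner_Integration.integrable_sum int_I)
  also have "\<dots> = (\<Sum>i<n. \<Sum>j<n'. (if k = l then lam k else 0) * (LINT z|time_prod t. ?P i j z))"
  proof (intro sum.cong refl)
    fix i j assume "i \<in> {..<n}" "j \<in> {..<n'}"
    then have ij: "i < n" "j < n'"
      by auto
    have "expectation (?I i j) = (if k = l then
        lam k * max 0 (min (p (Suc i)) (p' (Suc j)) - max (p i) (p' j)) else 0) * expectation (?Z i j)"
      using B[OF ij]
      by (intro expectation_incr_incr[OF k l b(1,2)[OF ij(1)] b'(1,2)[OF ij(2)] Z_F[OF ij]])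
    moreover have "(LINT z|time_prod t. ?P i j z) =
        max 0 (min (p (Suc i)) (p' (Suc j)) - max (p i) (p' j)) * expectation (?Z i j)"
      using B[OF ij]
      by (intro integral_time_prod_indicator(2)[OF b(1,3)[OF ij(1)] b'(1,3)[OF ij(2)] Z_M[OF ij]])
    ultimately show "expectation (?I i j) = (if k = l then lam k else 0) * (LINT z|time_prod t. ?P i j z)"
      by simp
  qed
  also have "\<dots> = (if k = l then lam k else 0) * (\<Sum>i<n. \<Sum>j<n'. LINT z|time_prod t. ?P i j z)"
    by (simp only: sum_distrib_left)
  also have "(\<Sum>i<n. \<Sum>j<n'. LINT z|time_prod t. ?P i j z) =
      (LINT z|time_prod t. proc n p \<xi> z \<bullet> proc n' p' \<xi>' z)"
    unfolding sumP
    by (subst Bochner_Integration.integral_sum)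
      (auto intro!: sum.cong Bochner_Integration.integral_sum[symmetric] Bochner_Integration.integrable_sum int_P)
  finally show "expectation (\<lambda>\<omega>. elem_integral (\<beta> k) n p \<xi> \<omega> \<bullet> elem_integral (\<beta> l) n' p' \<xi>' \<omega>) =
      (if k = l then lam k else 0) * (LINT z|time_prod t. proc n p \<xi> z \<bullet> proc n' p' \<xi>' z)" .
qed

text \<open>Expanding the square leaves three inner products, each an instance of
  \<open>elem_integral_inner\<close> with its own pair of partitions. The result carries the Cauchy
  property from processes to integrals.\<close>

lemma elem_integral_isometry_diff:
  fixes \<xi> \<xi>' :: "nat \<Rightarrow> 'w \<Rightarrow> 'b::{real_inner, second_countable_topology}"
  assumes k: "k \<in> supp_idx K lam" and E: "elementary F t n p \<xi>" and E': "elementary F t n' p' \<xi>'"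
  shows "L2sq M (\<lambda>\<omega>. elem_integral (\<beta> k) n p \<xi> \<omega> - elem_integral (\<beta> k) n' p' \<xi>' \<omega>) =
    ennreal (lam k) * L2sq (time_prod t) (\<lambda>z. proc n p \<xi> z - proc n' p' \<xi>' z)"
proof -
  have expand: "(x - y) \<bullet> (x - y) = x \<bullet> x - 2 * (x \<bullet> y) + y \<bullet> y" for x y :: 'b
    by (simp add: inner_diff inner_commute)
  note ints = elem_integral_inner(1,2)[OF k k E E] elem_integral_inner(1,2)[OF k k E E']
    elem_integral_inner(1,2)[OF k k E' E']
  note eqs = elem_integral_inner(3)[OF k k E E] elem_integral_inner(3)[OF k k E E']
    elem_integral_inner(3)[OF k k E' E']
  have "expectation (\<lambda>\<omega>. (elem_integral (\<beta> k) n p \<xi> \<omega> - elem_integral (\<beta> k) n' p' \<xi>' \<omega>) \<bullet>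
        (elem_integral (\<beta> k) n p \<xi> \<omega> - elem_integral (\<beta> k) n' p' \<xi>' \<omega>)) =
      lam k * (LINT z|time_prod t. (proc n p \<xi> z - proc n' p' \<xi>' z) \<bullet> (proc n p \<xi> z - proc n' p' \<xi>' z))"
    unfolding expand using ints eqs by (simp add: algebra_simps)
  moreover have "integrable M (\<lambda>\<omega>. (elem_integral (\<beta> k) n p \<xi> \<omega> - elem_integral (\<beta> k) n' p' \<xi>' \<omega>) \<bullet>
        (elem_integral (\<beta> k) n p \<xi> \<omega> - elem_integral (\<beta> k) n' p' \<xi>' \<omega>))"
    and "integrable (time_prod t)
      (\<lambda>z. (proc n p \<xi> z - proc n' p' \<xi>' z) \<bullet> (proc n p \<xi> z - proc n' p' \<xi>' z))"
    unfolding expand using ints by auto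
  ultimately show ?thesis
    using supp_idx_pos[OF k] by (simp add: L2sq_eq_integral ennreal_mult')
qed

text \<open>Different coordinates are orthogonal even if their partitions differ, so only the
  diagonal of the double sum survives.\<close>

lemma elem_integral_isometry_sum:
  fixes \<xi> :: "nat \<Rightarrow> nat \<Rightarrow> 'w \<Rightarrow> 'b::{real_inner, second_countable_topology}"
  assumes J: "finite J" "J \<subseteq> supp_idx K lam"
    and E: "\<And>k. k \<in> J \<Longrightarrow> elementary F t (n k) (p k) (\<xi> k)"
  shows "L2sq M (\<lambda>\<omega>. \<Sum>k\<in>J. elem_integral (\<beta> k) (n k) (p k) (\<xi> k) \<omega>) =
    (\<Sum>k\<in>J. ennreal (lam k) * L2sq (time_prod t) (proc (n k) (p k) (\<xi> k)))"
proof -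
  let ?I = "\<lambda>k. elem_integral (\<beta> k) (n k) (p k) (\<xi> k)"
  let ?P = "\<lambda>k. proc (n k) (p k) (\<xi> k)"
  have kJ: "k \<in> supp_idx K lam" if "k \<in> J" for k
    using J that by auto
  have intI: "integrable M (\<lambda>\<omega>. ?I k \<omega> \<bullet> ?I l \<omega>)" if "k \<in> J" "l \<in> J" for k l
    using that by (intro elem_integral_inner(1)[where t = t] kJ E)
  have intP: "integrable (time_prod t) (\<lambda>z. ?P k z \<bullet> ?P k z)" if "k \<in> J" for k
    using that by (intro elem_integral_inner(2)[where k = k and l = k] kJ E)
  have expand: "(\<Sum>k\<in>J. ?I k \<omega>) \<bullet> (\<Sum>k\<in>J. ?I k \<omega>) = (\<Sum>k\<in>J. \<Sum>l\<in>J. ?I k \<omega> \<bullet> ?I l \<omega>)" for \<omega>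
    unfolding inner_sum_left unfolding inner_sum_right ..
  have "expectation (\<lambda>\<omega>. (\<Sum>k\<in>J. ?I k \<omega>) \<bullet> (\<Sum>k\<in>J. ?I k \<omega>)) =
      (\<Sum>k\<in>J. \<Sum>l\<in>J. expectation (\<lambda>\<omega>. ?I k \<omega> \<bullet> ?I l \<omega>))"
    unfolding expand
    by (subst Bochner_Integration.integral_sum)
      (auto intro!: sum.cong Bochner_Integration.integral_sum Bochner_Integration.integrable_sum intI)
  also have "\<dots> = (\<Sum>k\<in>J. \<Sum>l\<in>J. if k = l then lam k * (LINT z|time_prod t. ?P k z \<bullet> ?P k z) else 0)"
    by (intro sum.cong refl, subst elem_integral_inner(3)[OF kJ kJ E E]) auto
  also have "\<dots> = (\<Sum>k\<in>J. lam k * (LINT z|time_prod t. ?P k z \<bullet> ?P k z))"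
    using J by simp
  finally have "L2sq M (\<lambda>\<omega>. \<Sum>k\<in>J. ?I k \<omega>) = ennreal (\<Sum>k\<in>J. lam k * (LINT z|time_prod t. ?P k z \<bullet> ?P k z))"
    using intI by (subst L2sq_eq_integral) (auto simp: expand intro!: Bochner_Integration.integrable_sum)
  also have "\<dots> = (\<Sum>k\<in>J. ennreal (lam k * (LINT z|time_prod t. ?P k z \<bullet> ?P k z)))"
    using supp_idx_pos kJ by (intro sum_ennreal[symmetric]) (auto intro!: mult_nonneg_nonneg Bochner_Integration.integral_nonneg intro: less_imp_le)
  also have "\<dots> = (\<Sum>k\<in>J. ennreal (lam k) * L2sq (time_prod t) (?P k))"
    using supp_idx_pos kJ intP by (intro sum.cong refl) (simp add: L2sq_eq_integral ennreal_mult' less_imp_le)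
  finally show ?thesis .
qed

section \<open>Density of elementary processes\<close>

definition rects :: "real \<Rightarrow> (real \<times> 'w) set set" where
  "rects t = {{s<..u} \<times> B | s u B. 0 \<le> s \<and> s < u \<and> u \<le> t \<and> B \<in> sets (F s)} \<union>
      {{0} \<times> B | B. B \<in> sets (F 0)}"

lemma predictable_eq: "predictable M F t = sigma ({0..t} \<times> space M) (rects t)"
  by (simp add: predictable_def rects_def)

lemma rectsI: "0 \<le> s \<Longrightarrow> s < u \<Longrightarrow> u \<le> t \<Longrightarrow> B \<in> sets (F s) \<Longrightarrow> {s<..u} \<times> B \<in> rects t"
  unfolding rects_def by blast

lemma rects_zeroI: "B \<in> sets (F 0) \<Longrightarrow> {0} \<times> B \<in> rects t"
  unfolding rects_def by blast

lemma rects_cases: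
  assumes "A \<in> rects t"
  obtains s u B where "A = {s<..u} \<times> B" "0 \<le> s" "s < u" "u \<le> t" "B \<in> sets (F s)"
    | B where "A = {0} \<times> B" "B \<in> sets (F 0)"
  using assms by (auto simp: rects_def)

lemma rects_Pow:
  assumes "0 \<le> t"
  shows "rects t \<subseteq> Pow ({0..t} \<times> space M)"
proof
  fix A assume "A \<in> rects t"
  then show "A \<in> Pow ({0..t} \<times> space M)"
  proof (cases rule: rects_cases)
    case (1 s u B)
    then have "B \<subseteq> space M"
      using sets.sets_into_space[of B "F s"] space_F[of s] by simp
    then show ?thesis
      using 1 by auto
  next
    case (2 B)
    then have "B \<subseteq> space M"
      using sets.sets_into_space[of B "F 0"] space_F[of 0] by simp
    then show ?thesis
      using 2 assms by auto
  qed
qed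

lemma space_predictable: "0 \<le> t \<Longrightarrow> space (predictable M F t) = {0..t} \<times> space M"
  unfolding predictable_eq by (rule space_measure_of[OF rects_Pow])

lemma sets_predictable: "0 \<le> t \<Longrightarrow> sets (predictable M F t) = sigma_sets ({0..t} \<times> space M) (rects t)"
  unfolding predictable_eq by (rule sets_measure_of[OF rects_Pow])

lemma rects_time_prod:
  assumes "0 \<le> t" "A \<in> rects t"
  shows "A \<in> sets (time_prod t)"
  using assms(2)
proof (cases rule: rects_cases)
  case (1 s u B)
  then have "{s<..u} \<in> sets (restrict_space lborel {0..t})"
    by (subst sets_restrict_space_iff) auto
  moreover have "B \<in> sets M"
    using 1 sets_F_M[of s] by auto
  ultimately show ?thesis
    unfolding 1(1) time_prod_def by (rule pair_measureI)
next
  case (2 B)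
  then have "{0} \<in> sets (restrict_space lborel {0..t})"
    using assms by (subst sets_restrict_space_iff) auto
  moreover have "B \<in> sets M"
    using 2 sets_F_M[of 0] by auto
  ultimately show ?thesis
    unfolding 2(1) time_prod_def by (rule pair_measureI)
qed

lemma subalgebra_predictable: "0 \<le> t \<Longrightarrow> subalgebra (time_prod t) (predictable M F t)"
  unfolding subalgebra_def space_predictable sets_predictable space_time_prod
  using sets.sigma_sets_subset[of "rects t" "time_prod t"] rects_time_prod
  by (auto simp: space_time_prod)

lemma predictable_time_prod:
  "f \<in> measurable (predictable M F t) N \<Longrightarrow> 0 \<le> t \<Longrightarrow> f \<in> measurable (time_prod t) N"
  by (rule measurable_from_subalg[OF subalgebra_predictable])

text \<open>The starting point of the Dynkin argument in \<open>grid_approx_indicator\<close>. Two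
  rectangles meet in one that begins at \<open>max s s'\<close>, where both bases are measurable
  because the filtration increases.\<close>

lemma rects_Int_stable: "Int_stable (rects t)"
proof (rule Int_stableI)
  fix A A' assume A: "A \<in> rects t" and A': "A' \<in> rects t"
  \<comment> \<open>The empty set is the rectangle \<open>{0} \<times> {}\<close>; it serves all
    pairs with disjoint time parts.\<close>
  have empty: "{} \<in> rects t"
    using rects_zeroI[of "{}" t] by simp
  from A show "A \<inter> A' \<in> rects t"
  proof (cases rule: rects_cases)
    case (1 s u B)
    note A1 = 1
    from A' show ?thesis
    proof (cases rule: rects_cases)
      case (1 s' u' B')
      have Int: "A \<inter> A' = {max s s'<..min u u'} \<times> (B \<inter> B')"
        unfolding A1(1) 1(1) by auto
      show ?thesis
      proof (cases "max s s' < min u u'")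
        case True
        have "B \<inter> B' \<in> sets (F (max s s'))"
          using A1 1 sets_F_mono[of s "max s s'"] sets_F_mono[of s' "max s s'"] by (intro sets.Int) auto
        then show ?thesis
          using A1(2,4) 1(2) True unfolding Int by (intro rectsI) auto
      next
        case False
        then have "A \<inter> A' = {}"
          unfolding Int by simp
        then show ?thesis
          using empty by simp
      qed
    next
      case (2 B')
      have "A \<inter> A' = {}"
        unfolding A1(1) 2(1) using A1(2) by auto
      then show ?thesis
        using empty by simp
    qed
  next
    case (2 B)
    note A2 = 2
    from A' show ?thesis
    proof (cases rule: rects_cases)
      case (1 s' u' B')
      have "A \<inter> A' = {}"
        unfolding A2(1) 1(1) using 1(2) by auto
      then show ?thesis
        using empty by simp
    next
      case (2 B')
      have "A \<inter> A' = {0} \<times> (B \<inter> B')" "B \<inter> B' \<in> sets (F 0)"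
        unfolding A2(1) 2(1) using A2(2) 2(2) by auto
      then show ?thesis
        using rects_zeroI by simp
    qed
  qed
qed

section \<open>Approximation on uniform grids\<close>

definition grid :: "real \<Rightarrow> nat \<Rightarrow> nat \<Rightarrow> real" where
  "grid t N j = t * real j / real N"

lemma grid_elementary:
  assumes "0 < t" "0 < N" "\<And>j. j < N \<Longrightarrow> simple_function (F (grid t N j)) (\<xi> j)"
  shows "elementary F t N (grid t N) \<xi>"
  using assms by (auto simp: elementary_def grid_def field_simps)

text \<open>The cells are open on the left and start at nonnegative times, so none of them contains
  time 0.\<close>

lemma proc_zero:
  assumes "elementary F t n p \<xi>"
  shows "proc n p \<xi> (0, \<omega>) = 0"
proof -
  have "0 \<notin> {p j<..p (Suc j)}" if "j < n" for j
    using elementary_bounds(1)[OF assms that] by auto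
  then show ?thesis
    by (auto simp: proc_def elem_process_def intro!: sum.neutral)
qed

lemma proc_value:
  assumes E: "elementary F t n p \<xi>" and j: "j < n" "p j < \<tau>" "\<tau> \<le> p (Suc j)"
  shows "proc n p \<xi> (\<tau>, \<omega>) = \<xi> j \<omega>"
proof -
  have "\<tau> \<notin> {p i<..p (Suc i)}" if "i < n" "i \<noteq> j" for i
    using elementary_mono[OF E, of "Suc i" j] elementary_mono[OF E, of "Suc j" i] j that
    by (cases "i < j") auto
  then have "proc n p \<xi> (\<tau>, \<omega>) = (\<Sum>i<n. if i = j then \<xi> j \<omega> else 0)"
    unfolding proc_def elem_process_def using j by (intro sum.cong refl) (auto simp: indicator_def)
  then show ?thesis
    using j by simp
qed

lemma grid_interval:
  assumes "0 < \<tau>" "\<tau> \<le> t" "0 < N"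
  obtains j where "j < N" "grid t N j < \<tau>" "\<tau> \<le> grid t N (Suc j)" "\<tau> - t / N \<le> grid t N j"
proof -
  have pos: "0 < t" "0 < real N"
    using assms by auto
  \<comment> \<open>Cell \<open>j\<close> covers \<open>(grid t N j, grid t N (Suc j)]\<close>, so
    its index is one less than this ceiling.\<close>
  define c where "c = \<lceil>\<tau> * N / t\<rceil>"
  have "0 < \<tau> * N / t" "\<tau> * N / t \<le> N"
    using assms pos by (auto simp: field_simps)
  then have c: "0 < c" "c \<le> int N" "of_int c - 1 < \<tau> * N / t" "\<tau> * N / t \<le> of_int c"
    unfolding c_def by linarith+
  define j where "j = nat (c - 1)"
  have j: "real j = of_int c - 1"
    using c by (simp add: j_def)
  have "grid t N j < \<tau>" "\<tau> \<le> grid t N (Suc j)" "\<tau> - t / N \<le> grid t N j"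
    using c(3,4) pos by (simp_all add: grid_def j field_simps)
  moreover have "j < N"
    using c by (simp add: j_def)
  ultimately show ?thesis
    by (rule that[rotated])
qed

text \<open>
  The approximations are required on all sufficiently fine uniform grids, so that those of two
  processes can be added grid by grid.
\<close>

definition grid_approx :: "real \<Rightarrow> (real \<times> 'w \<Rightarrow> 'b::real_normed_vector) \<Rightarrow> bool" where
  "grid_approx t \<phi> \<longleftrightarrow> \<phi> \<in> borel_measurable (time_prod t) \<and>
     (\<forall>\<epsilon>>0. \<forall>\<^sub>F N in sequentially. \<exists>\<xi>. elementary F t N (grid t N) \<xi> \<and>
        L2sq (time_prod t) (\<lambda>z. proc N (grid t N) \<xi> z - \<phi> z) \<le> ennreal \<epsilon>)"

lemma grid_approx_add:
  fixes \<phi> \<psi> :: "real \<times> 'w \<Rightarrow> 'b::{real_normed_vector, second_countable_topology}"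
  assumes \<phi>: "grid_approx t \<phi>" and \<psi>: "grid_approx t \<psi>"
  shows "grid_approx t (\<lambda>z. \<phi> z + \<psi> z)"
  unfolding grid_approx_def
proof (intro conjI allI impI)
  have meas[measurable]: "\<phi> \<in> borel_measurable (time_prod t)" "\<psi> \<in> borel_measurable (time_prod t)"
    using assms by (auto simp: grid_approx_def)
  show "(\<lambda>z. \<phi> z + \<psi> z) \<in> borel_measurable (time_prod t)"
    by measurable
  fix \<epsilon> :: real assume "0 < \<epsilon>"
  then have "0 < \<epsilon> / 4"
    by simp
  then have "\<forall>\<^sub>F N in sequentially. \<exists>\<xi>. elementary F t N (grid t N) \<xi> \<and>
        L2sq (time_prod t) (\<lambda>z. proc N (grid t N) \<xi> z - \<phi> z) \<le> ennreal (\<epsilon> / 4)"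
    "\<forall>\<^sub>F N in sequentially. \<exists>\<xi>. elementary F t N (grid t N) \<xi> \<and>
        L2sq (time_prod t) (\<lambda>z. proc N (grid t N) \<xi> z - \<psi> z) \<le> ennreal (\<epsilon> / 4)"
    using \<phi> \<psi> unfolding grid_approx_def by blast+
  then show "\<forall>\<^sub>F N in sequentially. \<exists>\<xi>. elementary F t N (grid t N) \<xi> \<and>
        L2sq (time_prod t) (\<lambda>z. proc N (grid t N) \<xi> z - (\<phi> z + \<psi> z)) \<le> ennreal \<epsilon>"
  proof eventually_elim
    case (elim N)
    then obtain \<xi> \<eta> :: "nat \<Rightarrow> 'w \<Rightarrow> 'b"
      where \<xi>: "elementary F t N (grid t N) \<xi>"
          "L2sq (time_prod t) (\<lambda>z. proc N (grid t N) \<xi> z - \<phi> z) \<le> ennreal (\<epsilon> / 4)"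
        and \<eta>: "elementary F t N (grid t N) \<eta>"
          "L2sq (time_prod t) (\<lambda>z. proc N (grid t N) \<eta> z - \<psi> z) \<le> ennreal (\<epsilon> / 4)"
      by blast
    have E: "elementary F t N (grid t N) (\<lambda>j \<omega>. \<xi> j \<omega> + \<eta> j \<omega>)"
      using \<xi>(1) \<eta>(1) by (auto simp: elementary_def intro!: simple_function_add)
    have sum: "proc N (grid t N) (\<lambda>j \<omega>. \<xi> j \<omega> + \<eta> j \<omega>) z - (\<phi> z + \<psi> z) =
        (proc N (grid t N) \<xi> z - \<phi> z) + (proc N (grid t N) \<eta> z - \<psi> z)" for z
      by (simp add: proc_def elem_process_def scaleR_add_right sum.distrib)
    have "L2sq (time_prod t) (\<lambda>z. proc N (grid t N) (\<lambda>j \<omega>. \<xi> j \<omega> + \<eta> j \<omega>) z - (\<phi> z + \<psi> z)) \<le>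
        2 * L2sq (time_prod t) (\<lambda>z. proc N (grid t N) \<xi> z - \<phi> z) +
        2 * L2sq (time_prod t) (\<lambda>z. proc N (grid t N) \<eta> z - \<psi> z)"
      unfolding sum
      using proc_measurable[OF \<xi>(1)] proc_measurable[OF \<eta>(1)]
      by (intro L2sq_add_le borel_measurable_diff meas)
    also have "\<dots> \<le> 2 * ennreal (\<epsilon> / 4) + 2 * ennreal (\<epsilon> / 4)"
      using \<xi> \<eta> by (intro add_mono mult_left_mono) auto
    also have "\<dots> = ennreal \<epsilon>"
      using \<open>0 < \<epsilon>\<close> by (simp add: ennreal_quarters)
    finally show ?case
      using E by blast
  qed
qed

lemma grid_approx_limit:
  fixes \<phi> :: "real \<times> 'w \<Rightarrow> 'b::{real_normed_vector, second_countable_topology}"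
  assumes meas[measurable]: "\<phi> \<in> borel_measurable (time_prod t)"
    and lim: "\<And>\<epsilon>. 0 < \<epsilon> \<Longrightarrow> \<exists>\<psi>. grid_approx t \<psi> \<and> L2sq (time_prod t) (\<lambda>z. \<psi> z - \<phi> z) \<le> ennreal \<epsilon>"
  shows "grid_approx t \<phi>"
  unfolding grid_approx_def
proof (intro conjI allI impI meas)
  fix \<epsilon> :: real assume "0 < \<epsilon>"
  then have "0 < \<epsilon> / 4"
    by simp
  then obtain \<psi> where \<psi>: "grid_approx t \<psi>" "L2sq (time_prod t) (\<lambda>z. \<psi> z - \<phi> z) \<le> ennreal (\<epsilon> / 4)"
    using lim by blast
  have \<psi>_meas: "\<psi> \<in> borel_measurable (time_prod t)"
    using \<psi> by (simp add: grid_approx_def)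
  have "\<forall>\<^sub>F N in sequentially. \<exists>\<xi>. elementary F t N (grid t N) \<xi> \<and>
        L2sq (time_prod t) (\<lambda>z. proc N (grid t N) \<xi> z - \<psi> z) \<le> ennreal (\<epsilon> / 4)"
    using \<psi> \<open>0 < \<epsilon> / 4\<close> unfolding grid_approx_def by blast
  then show "\<forall>\<^sub>F N in sequentially. \<exists>\<xi>. elementary F t N (grid t N) \<xi> \<and>
        L2sq (time_prod t) (\<lambda>z. proc N (grid t N) \<xi> z - \<phi> z) \<le> ennreal \<epsilon>"
  proof eventually_elim
    case (elim N)
    then obtain \<xi> :: "nat \<Rightarrow> 'w \<Rightarrow> 'b" where \<xi>: "elementary F t N (grid t N) \<xi>"
          "L2sq (time_prod t) (\<lambda>z. proc N (grid t N) \<xi> z - \<psi> z) \<le> ennreal (\<epsilon> / 4)"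
      by blast
    have "L2sq (time_prod t) (\<lambda>z. proc N (grid t N) \<xi> z - \<phi> z) \<le>
        2 * L2sq (time_prod t) (\<lambda>z. proc N (grid t N) \<xi> z - \<psi> z) +
        2 * L2sq (time_prod t) (\<lambda>z. \<psi> z - \<phi> z)"
      using proc_measurable[OF \<xi>(1)] \<psi>_meas by (intro L2sq_triangle meas)
    also have "\<dots> \<le> 2 * ennreal (\<epsilon> / 4) + 2 * ennreal (\<epsilon> / 4)"
      using \<xi> \<psi> by (intro add_mono mult_left_mono) auto
    also have "\<dots> = ennreal \<epsilon>"
      using \<open>0 < \<epsilon>\<close> by (simp add: ennreal_quarters)
    finally show ?case
      using \<xi> by blast
  qed
qed

lemma grid_approx_tendsto:
  fixes \<phi> :: "real \<times> 'w \<Rightarrow> 'b::{real_normed_vector, second_countable_topology}"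
  assumes "\<phi> \<in> borel_measurable (time_prod t)"
    and "\<And>i. grid_approx t (\<psi> i)"
    and lim: "(\<lambda>i. L2sq (time_prod t) (\<lambda>z. \<psi> i z - \<phi> z)) \<longlonglongrightarrow> 0"
  shows "grid_approx t \<phi>"
proof (rule grid_approx_limit[OF assms(1)])
  fix \<epsilon> :: real assume "0 < \<epsilon>"
  then have "\<forall>\<^sub>F i in sequentially. L2sq (time_prod t) (\<lambda>z. \<psi> i z - \<phi> z) < ennreal \<epsilon>"
    by (intro order_tendstoD(2)[OF lim]) simp
  then obtain i where "L2sq (time_prod t) (\<lambda>z. \<psi> i z - \<phi> z) < ennreal \<epsilon>"
    by (auto simp: eventually_sequentially)
  then show "\<exists>\<psi>. grid_approx t \<psi> \<and> L2sq (time_prod t) (\<lambda>z. \<psi> z - \<phi> z) \<le> ennreal \<epsilon>"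
    using assms(2) by (auto intro: less_imp_le)
qed

lemma grid_approx_cong:
  fixes \<phi> \<psi> :: "real \<times> 'w \<Rightarrow> 'b::{real_normed_vector, second_countable_topology}"
  assumes "grid_approx t \<psi>" "\<And>z. z \<in> space (time_prod t) \<Longrightarrow> \<phi> z = \<psi> z"
  shows "grid_approx t \<phi>"
proof (rule grid_approx_limit)
  show "\<phi> \<in> borel_measurable (time_prod t)"
    using assms by (subst measurable_cong[of _ _ \<psi>]) (auto simp: grid_approx_def)
  have "L2sq (time_prod t) (\<lambda>z. \<psi> z - \<phi> z) = L2sq (time_prod t) (\<lambda>z. 0::'b)"
    using assms by (intro L2sq_cong) simp
  then show "\<exists>\<psi>. grid_approx t \<psi> \<and> L2sq (time_prod t) (\<lambda>z. \<psi> z - \<phi> z) \<le> ennreal \<epsilon>" for \<epsilon>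
    using assms(1) by (auto simp: L2sq_def)
qed

lemma grid_approx_zero:
  assumes "0 < t"
  shows "grid_approx t (\<lambda>_. 0 :: 'b::{real_normed_vector, second_countable_topology})"
  unfolding grid_approx_def
proof (intro conjI allI impI)
  fix \<epsilon> :: real
  have "\<exists>\<xi>. elementary F t N (grid t N) \<xi> \<and>
      L2sq (time_prod t) (\<lambda>z. proc N (grid t N) \<xi> z - (0::'b)) \<le> ennreal \<epsilon>" if "0 < N" for N
    using assms that
    by (intro exI[of _ "\<lambda>_ _. 0"] conjI grid_elementary)
      (auto simp: proc_def elem_process_def L2sq_def)
  then show "\<forall>\<^sub>F N in sequentially. \<exists>\<xi>. elementary F t N (grid t N) \<xi> \<and>
      L2sq (time_prod t) (\<lambda>z. proc N (grid t N) \<xi> z - (0::'b)) \<le> ennreal \<epsilon>"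
    by (rule eventually_mono[OF eventually_gt_at_top])
qed simp

lemma grid_approx_sum:
  fixes \<phi> :: "'i \<Rightarrow> real \<times> 'w \<Rightarrow> 'b::{real_normed_vector, second_countable_topology}"
  assumes "0 < t" "finite J" "\<And>i. i \<in> J \<Longrightarrow> grid_approx t (\<phi> i)"
  shows "grid_approx t (\<lambda>z. \<Sum>i\<in>J. \<phi> i z)"
  using assms(2,3)
proof (induction J rule: finite_induct)
  case empty
  then show ?case
    using grid_approx_zero[OF assms(1)] by simp
next
  case (insert i J)
  have "grid_approx t (\<lambda>z. \<phi> i z + (\<Sum>i\<in>J. \<phi> i z))"
    using insert by (intro grid_approx_add) auto
  then show ?case
    using insert.hyps by simp
qed

lemma nn_integral_time_prod_const: "(\<integral>\<^sup>+z. ennreal (c\<^sup>2) \<partial>time_prod t) < \<infinity>"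
proof -
  interpret P: finite_measure "time_prod t"
    by (rule finite_measure_time_prod)
  show ?thesis
    by (simp add: ennreal_mult_eq_top_iff P.emeasure_finite less_top[symmetric])
qed

text \<open>Freeze the time indicator at the left end of each cell. A coefficient is nonzero only if
  that point is at least \<open>s\<close>, where \<open>B\<close> is already measurable; refining
  the grid recovers the rectangle pointwise.\<close>

lemma grid_approx_rect:
  fixes c :: "'b::{real_normed_vector, second_countable_topology}"
  assumes t: "0 < t" and s: "0 \<le> s" "s < u" "u \<le> t" and B: "B \<in> sets (F s)"
  shows "grid_approx t (\<lambda>z. indicat_real ({s<..u} \<times> B) z *\<^sub>R c)"
proof -
  let ?\<phi> = "\<lambda>z. indicat_real ({s<..u} \<times> B) z *\<^sub>R c"
  define \<xi> where "\<xi> N j \<omega> = (if s \<le> grid t N j \<and> grid t N j < u then indicat_real B \<omega> *\<^sub>R c else 0)"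
    for N j \<omega>
  have rect: "{s<..u} \<times> B \<in> sets (time_prod t)"
    using assms by (intro rects_time_prod rectsI rects_zeroI) auto
  then have meas: "?\<phi> \<in> borel_measurable (time_prod t)"
    by (intro borel_measurable_scaleR borel_measurable_indicator) auto
  have E: "elementary F t N (grid t N) (\<xi> N)" if "0 < N" for N
  proof (rule grid_elementary[OF t that])
    fix j
    show "simple_function (F (grid t N j)) (\<xi> N j)"
    proof (cases "s \<le> grid t N j \<and> grid t N j < u")
      case True
      then have "B \<in> sets (F (grid t N j))"
        using B sets_F_mono[of s "grid t N j"] s by auto
      then have "simple_function (F (grid t N j)) (indicat_real B)"
        by (rule simple_function_indicator)
      then have "simple_function (F (grid t N j)) (\<lambda>\<omega>. indicat_real B \<omega> *\<^sub>R c)"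
        by (rule simple_function_compose1)
      then show ?thesis
        using True by (simp add: \<xi>_def[abs_def])
    qed (auto simp: \<xi>_def[abs_def])
  qed
  \<comment> \<open>\<open>a\<close> is the left end of the cell containing \<open>\<tau>\<close>,
    at distance at most \<open>t / N\<close> from it.\<close>
  have val: "\<exists>a. proc N (grid t N) (\<xi> N) (\<tau>, \<omega>) = (if s \<le> a \<and> a < u then indicat_real B \<omega> *\<^sub>R c else 0) \<and>
      a < \<tau> \<and> \<tau> - t / N \<le> a" if "0 < N" "0 < \<tau>" "\<tau> \<le> t" for N \<tau> \<omega>
  proof -
    note N = that
    obtain j where "j < N" "grid t N j < \<tau>" "\<tau> \<le> grid t N (Suc j)" "\<tau> - t / N \<le> grid t N j"
      by (rule grid_interval[OF N(2,3,1)])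
    then show ?thesis
      using proc_value[OF E[OF N(1)], of j \<tau> \<omega>] by (auto simp: \<xi>_def intro!: exI[of _ "grid t N j"])
  qed
  \<comment> \<open>The index \<open>Suc N\<close> avoids the degenerate grid without cells.\<close>
  have lim: "(\<lambda>N. proc (Suc N) (grid t (Suc N)) (\<xi> (Suc N)) z) \<longlonglongrightarrow> ?\<phi> z"
    if z_space: "z \<in> space (time_prod t)" for z
  proof (rule tendsto_eventually)
    obtain \<tau> \<omega> where z: "z = (\<tau>, \<omega>)" "0 \<le> \<tau>" "\<tau> \<le> t"
      using z_space by (auto simp: space_time_prod)
    show "\<forall>\<^sub>F N in sequentially. proc (Suc N) (grid t (Suc N)) (\<xi> (Suc N)) z = ?\<phi> z"
    proof (cases "\<tau> = 0")
      case True
      then show ?thesis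
        using proc_zero[OF E] s by (simp add: z)
    next
      case False
      have "(\<lambda>N. t / real (Suc N)) \<longlonglongrightarrow> 0"
        by (rule LIMSEQ_Suc[OF lim_const_over_n])
      then have lim_a: "(\<lambda>N. \<tau> - t / real (Suc N)) \<longlonglongrightarrow> \<tau> - 0"
        by (intro tendsto_intros)
      \<comment> \<open>Once the strict inequalities survive a shift by one cell width,
        \<open>s \<le> a \<and> a < u\<close> is equivalent to
        \<open>s < \<tau> \<and> \<tau> \<le> u\<close>, and the approximation is exact at this
        point.\<close>
      have ev: "\<forall>\<^sub>F N in sequentially. (s < \<tau> \<longrightarrow> s < \<tau> - t / real (Suc N)) \<and>
          (u < \<tau> \<longrightarrow> u < \<tau> - t / real (Suc N))"
        using order_tendstoD(1)[OF lim_a, of s] order_tendstoD(1)[OF lim_a, of u]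
        by (auto simp: eventually_conj_iff)
      then show ?thesis
      proof eventually_elim
        case (elim N)
        from val[of "Suc N" \<tau> \<omega>] False z obtain a where
          "proc (Suc N) (grid t (Suc N)) (\<xi> (Suc N)) (\<tau>, \<omega>) =
            (if s \<le> a \<and> a < u then indicat_real B \<omega> *\<^sub>R c else 0)"
          "a < \<tau>" "\<tau> - t / real (Suc N) \<le> a"
          by auto
        with elim show ?case
          by (auto simp: z indicator_def)
      qed
    qed
  qed
  have bound: "norm (proc (Suc N) (grid t (Suc N)) (\<xi> (Suc N)) z - ?\<phi> z) \<le> norm c + norm c"
    if z_space: "z \<in> space (time_prod t)" for z N
  proof -
    obtain \<tau> \<omega> where z: "z = (\<tau>, \<omega>)" "0 \<le> \<tau>" "\<tau> \<le> t"
      using z_space by (auto simp: space_time_prod)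
    have "norm (proc (Suc N) (grid t (Suc N)) (\<xi> (Suc N)) z) \<le> norm c"
    proof (cases "\<tau> = 0")
      case True
      then show ?thesis
        using proc_zero[OF E] by (simp add: z)
    next
      case False
      then show ?thesis
        using val[of "Suc N" \<tau> \<omega>] z by (auto simp: indicator_def)
    qed
    moreover have "norm (?\<phi> z) \<le> norm c"
      by (auto simp: indicator_def)
    ultimately show ?thesis
      using norm_triangle_ineq4 by (rule order_trans[OF _ add_mono, rotated])
  qed
  have "(\<lambda>N. L2sq (time_prod t) (\<lambda>z. proc (Suc N) (grid t (Suc N)) (\<xi> (Suc N)) z - ?\<phi> z)) \<longlonglongrightarrow> 0"
  proof (rule dominated_L2sq_tendsto[where w = "\<lambda>_. norm c + norm c"])
    show "(\<integral>\<^sup>+z. ennreal ((norm c + norm c)\<^sup>2) \<partial>time_prod t) < \<infinity>"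
      by (rule nn_integral_time_prod_const)
    show "proc (Suc N) (grid t (Suc N)) (\<xi> (Suc N)) \<in> borel_measurable (time_prod t)" for N
      by (rule proc_measurable[OF E]) simp
  qed (use bound lim meas in \<open>simp_all\<close>)
  then have lim0: "(\<lambda>N. L2sq (time_prod t) (\<lambda>z. proc N (grid t N) (\<xi> N) z - ?\<phi> z)) \<longlonglongrightarrow> 0"
    by (rule LIMSEQ_imp_Suc)
  show ?thesis
    unfolding grid_approx_def
  proof (intro conjI allI impI meas)
    fix \<epsilon> :: real assume "0 < \<epsilon>"
    then have "\<forall>\<^sub>F N in sequentially. L2sq (time_prod t) (\<lambda>z. proc N (grid t N) (\<xi> N) z - ?\<phi> z) < ennreal \<epsilon>"
      by (intro order_tendstoD(2)[OF lim0]) simp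
    then show "\<forall>\<^sub>F N in sequentially. \<exists>\<xi>. elementary F t N (grid t N) \<xi> \<and>
        L2sq (time_prod t) (\<lambda>z. proc N (grid t N) \<xi> z - ?\<phi> z) \<le> ennreal \<epsilon>"
      using eventually_gt_at_top[of 0]
    proof eventually_elim
      case (elim N)
      then show ?case
        using E by (blast intro: less_imp_le)
    qed
  qed
qed

text \<open>The slice at time 0 is a null set of the product measure, so the zero process
  approximates it with error 0.\<close>

lemma grid_approx_zero_rect:
  fixes c :: "'b::{real_normed_vector, second_countable_topology}"
  assumes t: "0 < t" and B: "B \<in> sets (F 0)"
  shows "grid_approx t (\<lambda>z. indicat_real ({0} \<times> B) z *\<^sub>R c)"
proof (rule grid_approx_limit)
  let ?\<phi> = "\<lambda>z. indicat_real ({0} \<times> B) z *\<^sub>R c"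
  have "{0} \<times> B \<in> sets (time_prod t)"
    using assms by (intro rects_time_prod rectsI rects_zeroI) auto
  then show meas: "?\<phi> \<in> borel_measurable (time_prod t)"
    by (intro borel_measurable_scaleR borel_measurable_indicator) auto
  have "(\<integral>\<^sup>+\<tau>\<in>{0..t}. ennreal ((norm (0 - ?\<phi> (\<tau>, \<omega>)))\<^sup>2) \<partial>lborel) = (\<integral>\<^sup>+\<tau>. 0 \<partial>(lborel :: real measure))" for \<omega>
  proof (rule nn_integral_cong_AE, use AE_lborel_singleton[of "0::real"] in eventually_elim)
    case (elim \<tau>)
    then show ?case by simp
  qed
  then have "L2sq (time_prod t) (\<lambda>z. 0 - ?\<phi> z) = 0"
    using L2sq_time_prod[of "\<lambda>\<tau> \<omega>. 0 - ?\<phi> (\<tau>, \<omega>)" t] meas by simp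
  then show "\<exists>\<psi>. grid_approx t \<psi> \<and> L2sq (time_prod t) (\<lambda>z. \<psi> z - ?\<phi> z) \<le> ennreal \<epsilon>" for \<epsilon>
    using grid_approx_zero[OF t] by (intro exI[of _ "\<lambda>_. 0"]) auto
qed

text \<open>A Dynkin argument from the rectangles. The vector \<open>c\<close> stays general in the
  induction because a complement is reached by adding the indicator with \<open>- c\<close>.\<close>

lemma grid_approx_indicator:
  fixes c :: "'b::{real_normed_vector, second_countable_topology}"
  assumes t: "0 < t" and A: "A \<in> sets (predictable M F t)"
  shows "grid_approx t (\<lambda>z. indicat_real A z *\<^sub>R c)"
proof -
  let ?\<Omega> = "{0..t} \<times> space M"
  have t0: "0 \<le> t"
    using t by simp
  have space: "space M \<in> sets (F 0)"
    using sets.top[of "F 0"] space_F[of 0] by simp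
  have meas: "A \<in> sigma_sets ?\<Omega> (rects t) \<Longrightarrow> (\<lambda>z. indicat_real A z *\<^sub>R c) \<in> borel_measurable (time_prod t)"
    for A and c :: 'b
    using subalgebra_predictable[OF t0] sets_predictable[OF t0]
    by (intro borel_measurable_scaleR borel_measurable_indicator) (auto simp: subalgebra_def)
  from A have "A \<in> sigma_sets ?\<Omega> (rects t)"
    by (simp add: sets_predictable t0)
  with rects_Int_stable rects_Pow[OF t0] show ?thesis
  proof (induction A arbitrary: c rule: sigma_sets_induct_disjoint)
    case (basic A)
    then show ?case
      using grid_approx_rect[OF t] grid_approx_zero_rect[OF t] by (auto elim!: rects_cases)
  next
    case empty
    then show ?case
      using grid_approx_zero[OF t] by simp
  next
    case (compl A)
    have "A \<subseteq> ?\<Omega>"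
      using sigma_sets_into_sp[OF rects_Pow[OF t0] compl(1)] .
    \<comment> \<open>The whole space is not itself in \<open>rects t\<close>; it is the slice at 0
      together with the rectangle over \<open>(0, t]\<close>.\<close>
    have "grid_approx t (\<lambda>z. indicat_real ({0<..t} \<times> space M) z *\<^sub>R c + indicat_real ({0} \<times> space M) z *\<^sub>R c
        + indicat_real A z *\<^sub>R (- c))"
      using t space by (intro grid_approx_add grid_approx_rect grid_approx_zero_rect compl.IH) auto
    then show ?case
      using \<open>A \<subseteq> ?\<Omega>\<close> t0 by (elim grid_approx_cong) (auto simp: space_time_prod indicator_def)
  next
    case (union A)
    \<comment> \<open>On finite disjoint unions the indicator is a sum; the countable union follows
      by dominated convergence with bound \<open>norm c\<close>.\<close>
    have partial: "grid_approx t (\<lambda>z. indicat_real (\<Union>i<n. A i) z *\<^sub>R c)" for n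
    proof -
      have "grid_approx t (\<lambda>z. \<Sum>i<n. indicat_real (A i) z *\<^sub>R c)"
        by (intro grid_approx_sum t union.IH) auto
      moreover have "(\<Sum>i<n. indicat_real (A i) z *\<^sub>R c) = indicat_real (\<Union>i<n. A i) z *\<^sub>R c" for z
        using union(1) by (subst indicator_UN_disjoint)
          (auto simp: scaleR_sum_left intro: disjoint_family_on_mono)
      ultimately show ?thesis
        by simp
    qed
    have meas_partial: "(\<lambda>z. indicat_real (\<Union>i<n. A i) z *\<^sub>R c) \<in> borel_measurable (time_prod t)" for n
      using partial by (simp add: grid_approx_def)
    have Un: "(\<Union>i. A i) \<in> sigma_sets ?\<Omega> (rects t)"
      using union(2) by (intro sigma_sets.Union) auto
    show ?case
    proof (rule grid_approx_tendsto[OF meas[OF Un] partial])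
      show "(\<lambda>n. L2sq (time_prod t) (\<lambda>z. indicat_real (\<Union>i<n. A i) z *\<^sub>R c - indicat_real (\<Union>i. A i) z *\<^sub>R c))
          \<longlonglongrightarrow> 0"
      proof (rule dominated_L2sq_tendsto[where w = "\<lambda>_. norm c"])
        show "(\<integral>\<^sup>+z. ennreal ((norm c)\<^sup>2) \<partial>time_prod t) < \<infinity>"
          by (rule nn_integral_time_prod_const)
        show "(\<lambda>n. indicat_real (\<Union>i<n. A i) z *\<^sub>R c) \<longlonglongrightarrow> indicat_real (\<Union>i. A i) z *\<^sub>R c" for z
          by (intro tendsto_scaleR tendsto_const LIMSEQ_indicator_UN)
        show "norm (indicat_real (\<Union>i<n. A i) z *\<^sub>R c - indicat_real (\<Union>i. A i) z *\<^sub>R c) \<le> norm c" for n z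
          by (auto simp: indicator_def)
      qed (use meas[OF Un] meas_partial in auto)
    qed
  qed
qed

text \<open>Linearity takes indicators to simple functions, and dominated convergence takes simple
  functions to \<open>\<phi>\<close>.\<close>

lemma grid_approx_predictable:
  fixes \<phi> :: "real \<times> 'w \<Rightarrow> 'b::{banach, second_countable_topology}"
  assumes t: "0 < t" and \<phi>: "\<phi> \<in> borel_measurable (predictable M F t)"
    and fin: "L2sq (time_prod t) \<phi> < \<infinity>"
  shows "grid_approx t \<phi>"
proof -
  have t0: "0 \<le> t"
    using t by simp
  have space: "space (predictable M F t) = space (time_prod t)"
    using t0 by (simp add: space_predictable space_time_prod)
  have "\<exists>f. (\<forall>i. simple_function (predictable M F t) (f i)) \<and>
      (\<forall>z\<in>space (time_prod t). (\<lambda>i. f i z) \<longlonglongrightarrow> \<phi> z) \<and>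
      (\<forall>i. \<forall>z\<in>space (time_prod t). norm (f i z) \<le> 2 * norm (\<phi> z))"
    using borel_measurable_implies_sequence_metric[OF \<phi>, of 0] unfolding space by simp
  then obtain f where f: "\<And>i. simple_function (predictable M F t) (f i)"
    "\<And>z. z \<in> space (time_prod t) \<Longrightarrow> (\<lambda>i. f i z) \<longlonglongrightarrow> \<phi> z"
    "\<And>i z. z \<in> space (time_prod t) \<Longrightarrow> norm (f i z) \<le> 2 * norm (\<phi> z)"
    by blast
  have approx: "grid_approx t (f i)" for i
  proof (rule grid_approx_cong)
    show "grid_approx t (\<lambda>z. \<Sum>y\<in>f i ` space (predictable M F t).
        indicat_real (f i -` {y} \<inter> space (predictable M F t)) z *\<^sub>R y)"
      using simple_functionD[OF f(1)] by (intro grid_approx_sum t grid_approx_indicator) auto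
    show "f i z = (\<Sum>y\<in>f i ` space (predictable M F t).
        indicat_real (f i -` {y} \<inter> space (predictable M F t)) z *\<^sub>R y)" if "z \<in> space (time_prod t)" for z
      using that by (intro simple_function_indicator_representation_banach f(1)) (simp add: space)
  qed
  have \<phi>_meas: "\<phi> \<in> borel_measurable (time_prod t)"
    using \<phi> t0 by (rule predictable_time_prod)
  have "(\<lambda>i. L2sq (time_prod t) (\<lambda>z. f i z - \<phi> z)) \<longlonglongrightarrow> 0"
  \<comment> \<open>The simple functions have at most twice the norm of \<open>\<phi>\<close>, so
    their distance to \<open>\<phi>\<close> is at most three times that norm.\<close>
  proof (rule dominated_L2sq_tendsto[where w = "\<lambda>z. 3 * norm (\<phi> z)"])
    have "(\<integral>\<^sup>+z. ennreal ((3 * norm (\<phi> z))\<^sup>2) \<partial>time_prod t) = 9 * L2sq (time_prod t) \<phi>"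
      using \<phi>_meas by (simp add: L2sq_def power_mult_distrib ennreal_mult nn_integral_cmult)
    then show "(\<integral>\<^sup>+z. ennreal ((3 * norm (\<phi> z))\<^sup>2) \<partial>time_prod t) < \<infinity>"
      using fin by (simp add: ennreal_mult_less_top)
    show "f i \<in> borel_measurable (time_prod t)" for i
      using f(1) t0 by (intro predictable_time_prod borel_measurable_simple_function)
    show "norm (f i z - \<phi> z) \<le> 3 * norm (\<phi> z)" if "z \<in> space (time_prod t)" for i z
      using f(3)[OF that, of i] norm_triangle_ineq4[of "f i z" "\<phi> z"] by simp
  qed (use \<phi>_meas f(2) in auto)
  then show ?thesis
    by (rule grid_approx_tendsto[OF \<phi>_meas approx])
qed

lemma elementary_dense:
  fixes \<phi> :: "real \<times> 'w \<Rightarrow> 'b::{banach, second_countable_topology}"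
  assumes t: "0 \<le> t" and \<phi>: "\<phi> \<in> borel_measurable (predictable M F t)"
    and fin: "L2sq (time_prod t) \<phi> < \<infinity>"
  obtains n p \<xi> where "\<And>i. elementary F t (n i) (p i) (\<xi> i)"
    and "(\<lambda>i. L2sq (time_prod t) (\<lambda>z. proc (n i) (p i) (\<xi> i) z - \<phi> z)) \<longlonglongrightarrow> 0"
proof (cases "t = 0")
  \<comment> \<open>Partition points increase strictly from 0 to \<open>t = 0\<close>, so only the
    partition without cells is elementary; all time integrals vanish.\<close>
  case True
  have meas: "(\<lambda>z. proc 0 (\<lambda>_. 0) (\<lambda>_ _. 0) z - \<phi> z) \<in> borel_measurable (time_prod t)"
    using predictable_time_prod[OF \<phi> t] by (simp add: proc_def elem_process_def)
  have "(\<integral>\<^sup>+\<tau>\<in>{0..t}. ennreal ((norm (proc 0 (\<lambda>_. 0) (\<lambda>_ _. 0) (\<tau>, \<omega>) - \<phi> (\<tau>, \<omega>)))\<^sup>2) \<partial>lborel) =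
      (\<integral>\<^sup>+\<tau>. 0 \<partial>(lborel :: real measure))" for \<omega>
  proof (rule nn_integral_cong_AE, use AE_lborel_singleton[of "0::real"] in eventually_elim)
    case (elim \<tau>)
    then show ?case by (simp add: True)
  qed
  then have "L2sq (time_prod t) (\<lambda>z. proc 0 (\<lambda>_. 0) (\<lambda>_ _. 0) z - \<phi> z) = 0"
    using L2sq_time_prod[of "\<lambda>\<tau> \<omega>. proc 0 (\<lambda>_. 0) (\<lambda>_ _. 0) (\<tau>, \<omega>) - \<phi> (\<tau>, \<omega>)" t] meas by simp
  then show ?thesis
    by (intro that[of "\<lambda>_. 0" "\<lambda>_ _. 0" "\<lambda>_ _ _. 0"]) (auto simp: elementary_def True)
next
  case False
  then have "grid_approx t \<phi>"
    using assms by (intro grid_approx_predictable) auto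
  then have "\<forall>\<^sub>F N in sequentially. \<exists>\<xi>. elementary F t N (grid t N) \<xi> \<and>
        L2sq (time_prod t) (\<lambda>z. proc N (grid t N) \<xi> z - \<phi> z) \<le> ennreal (1 / real (Suc i))" for i
    unfolding grid_approx_def by simp
  then have "\<exists>N \<xi>. elementary F t N (grid t N) \<xi> \<and>
        L2sq (time_prod t) (\<lambda>z. proc N (grid t N) \<xi> z - \<phi> z) \<le> ennreal (1 / real (Suc i))" for i
    using eventually_happens' sequentially_bot by blast
  then obtain n \<xi> where E: "\<And>i. elementary F t (n i) (grid t (n i)) (\<xi> i)"
    and le: "\<And>i. L2sq (time_prod t) (\<lambda>z. proc (n i) (grid t (n i)) (\<xi> i) z - \<phi> z) \<le> ennreal (1 / real (Suc i))"
    by metis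
  have "(\<lambda>i. ennreal (1 / real (Suc i))) \<longlonglongrightarrow> ennreal 0"
    by (intro tendsto_ennrealI LIMSEQ_Suc[OF lim_const_over_n])
  then have lim: "(\<lambda>i. ennreal (1 / real (Suc i))) \<longlonglongrightarrow> 0"
    by simp
  have "(\<lambda>i. L2sq (time_prod t) (\<lambda>z. proc (n i) (grid t (n i)) (\<xi> i) z - \<phi> z)) \<longlonglongrightarrow> 0"
    by (rule tendsto_sandwich[OF _ _ tendsto_const lim]) (intro always_eventually allI le zero_le)+
  then show ?thesis
    by (rule that[OF E])
qed

section \<open>Stochastic integrals\<close>

text \<open>Moves the approximating data of an arbitrary version \<open>Y\<close> from iterated
  integrals to \<open>time_prod t\<close>.\<close>

lemma is_ito_integralE:
  fixes \<phi> :: "real \<Rightarrow> 'w \<Rightarrow> 'b::{real_normed_vector, second_countable_topology}"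
  assumes ito: "is_ito_integral M F (\<beta> k) t \<phi> Y" and t: "0 \<le> t"
  obtains n p \<xi> where "\<And>i. elementary F t (n i) (p i) (\<xi> i)"
    and "(\<lambda>i. L2sq (time_prod t) (\<lambda>z. proc (n i) (p i) (\<xi> i) z - \<phi> (fst z) (snd z))) \<longlonglongrightarrow> 0"
    and "(\<lambda>i. L2sq M (\<lambda>\<omega>. elem_integral (\<beta> k) (n i) (p i) (\<xi> i) \<omega> - Y \<omega>)) \<longlonglongrightarrow> 0"
proof -
  have \<phi>: "(\<lambda>z. \<phi> (fst z) (snd z)) \<in> borel_measurable (time_prod t)"
    using ito t by (intro predictable_time_prod) (simp_all add: is_ito_integral_def case_prod_beta')
  from ito obtain n p \<xi> where E: "\<And>i. elementary F t (n i) (p i) (\<xi> i)"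
    and lim: "(\<lambda>i. \<integral>\<^sup>+\<omega>. (\<integral>\<^sup>+\<tau>\<in>{0..t}.
             ennreal ((norm (elem_process (n i) (p i) (\<xi> i) \<tau> \<omega> - \<phi> \<tau> \<omega>))\<^sup>2) \<partial>lborel) \<partial>M)
          \<longlonglongrightarrow> 0"
    and lim': "(\<lambda>i. \<integral>\<^sup>+\<omega>. ennreal ((norm (elem_integral (\<beta> k) (n i) (p i) (\<xi> i) \<omega> - Y \<omega>))\<^sup>2) \<partial>M)
          \<longlonglongrightarrow> 0"
    unfolding is_ito_integral_def by blast
  have "(\<integral>\<^sup>+\<omega>. (\<integral>\<^sup>+\<tau>\<in>{0..t}. ennreal ((norm (elem_process (n i) (p i) (\<xi> i) \<tau> \<omega> - \<phi> \<tau> \<omega>))\<^sup>2) \<partial>lborel) \<partial>M) =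
      L2sq (time_prod t) (\<lambda>z. proc (n i) (p i) (\<xi> i) z - \<phi> (fst z) (snd z))" for i
    unfolding proc_def using proc_measurable[OF E[of i]] \<phi>
    by (intro L2sq_time_prod borel_measurable_diff) (simp_all add: proc_def[abs_def])
  then show ?thesis
    using that[OF E] lim lim' by (simp add: L2sq_def)
qed

text \<open>By the isometry, the integrals of approximating elementary processes form a Cauchy
  sequence. Completeness yields a limit, so the choice in \<open>ito_integral\<close> is a genuine
  version.\<close>

lemma ito_integral_exists:
  fixes \<phi> :: "real \<Rightarrow> 'w \<Rightarrow> 'b::{real_inner, banach, second_countable_topology}"
  assumes k: "k \<in> supp_idx K lam" and t: "0 \<le> t"
    and \<phi>: "(\<lambda>z. \<phi> (fst z) (snd z)) \<in> borel_measurable (predictable M F t)"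
    and fin: "L2sq (time_prod t) (\<lambda>z. \<phi> (fst z) (snd z)) < \<infinity>"
  shows "is_ito_integral M F (\<beta> k) t \<phi> (ito_integral M F (\<beta> k) t \<phi>)"
proof -
  let ?\<phi> = "\<lambda>z. \<phi> (fst z) (snd z)"
  have \<phi>_meas: "?\<phi> \<in> borel_measurable (time_prod t)"
    using \<phi> t by (rule predictable_time_prod)
  obtain n p \<xi> where E: "\<And>i. elementary F t (n i) (p i) (\<xi> i)"
    and lim: "(\<lambda>i. L2sq (time_prod t) (\<lambda>z. proc (n i) (p i) (\<xi> i) z - ?\<phi> z)) \<longlonglongrightarrow> 0"
    by (rule elementary_dense[OF t \<phi> fin]) (rule that)
  let ?I = "\<lambda>i. elem_integral (\<beta> k) (n i) (p i) (\<xi> i)"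
  have I_meas: "?I i \<in> borel_measurable M" for i
    using elem_integral_measurable[OF E supp_idx_K[OF k]] .
  have "\<exists>Y\<in>borel_measurable M. (\<lambda>i. L2sq M (\<lambda>x. ?I i x - Y x)) \<longlonglongrightarrow> 0"
  proof (rule L2_complete[OF I_meas])
    fix \<epsilon> :: real assume \<epsilon>: "0 < \<epsilon>"
    \<comment> \<open>Two errors \<open>\<delta>\<close>, each doubled by
      \<open>L2sq_triangle\<close> and then weighted with \<open>lam k > 0\<close>, amount to
      \<open>\<epsilon>\<close>.\<close>
    define \<delta> where "\<delta> = \<epsilon> / (4 * lam k)"
    have \<delta>: "0 < \<delta>" "lam k * (2 * \<delta> + 2 * \<delta>) = \<epsilon>"
      using \<epsilon> supp_idx_pos[OF k] by (auto simp: \<delta>_def field_simps)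
    then have "\<forall>\<^sub>F i in sequentially. L2sq (time_prod t) (\<lambda>z. proc (n i) (p i) (\<xi> i) z - ?\<phi> z) < ennreal \<delta>"
      by (intro order_tendstoD(2)[OF lim]) simp
    then obtain n0 where n0: "\<And>i. i \<ge> n0 \<Longrightarrow>
        L2sq (time_prod t) (\<lambda>z. proc (n i) (p i) (\<xi> i) z - ?\<phi> z) \<le> ennreal \<delta>"
      by (auto simp: eventually_sequentially intro: less_imp_le)
    have "L2sq M (\<lambda>x. ?I i x - ?I j x) \<le> ennreal \<epsilon>" if "i \<ge> n0" "j \<ge> n0" for i j
    proof -
      have "L2sq (time_prod t) (\<lambda>z. proc (n i) (p i) (\<xi> i) z - proc (n j) (p j) (\<xi> j) z) \<le>
          2 * L2sq (time_prod t) (\<lambda>z. proc (n i) (p i) (\<xi> i) z - ?\<phi> z) +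
          2 * L2sq (time_prod t) (\<lambda>z. ?\<phi> z - proc (n j) (p j) (\<xi> j) z)"
        by (intro L2sq_triangle proc_measurable E \<phi>_meas)
      also have "\<dots> \<le> 2 * ennreal \<delta> + 2 * ennreal \<delta>"
        using n0[OF that(1)] n0[OF that(2)]
        by (intro add_mono mult_left_mono) (simp_all add: L2sq_minus_commute[of _ ?\<phi>])
      also have "\<dots> = ennreal (2 * \<delta> + 2 * \<delta>)"
        using \<delta>(1) ennreal_mult[of 2 \<delta>] ennreal_plus[of "2 * \<delta>" "2 * \<delta>"] by simp
      finally have "L2sq M (\<lambda>x. ?I i x - ?I j x) \<le> ennreal (lam k) * ennreal (2 * \<delta> + 2 * \<delta>)"
        unfolding elem_integral_isometry_diff[OF k E E] by (intro mult_left_mono) auto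
      also have "\<dots> = ennreal \<epsilon>"
        using \<delta> supp_idx_pos[OF k] by (subst ennreal_mult'[symmetric]) auto
      finally show ?thesis .
    qed
    then show "\<exists>n0. \<forall>i\<ge>n0. \<forall>j\<ge>n0. L2sq M (\<lambda>x. ?I i x - ?I j x) \<le> ennreal \<epsilon>"
      by blast
  qed
  then obtain Y where Y: "Y \<in> borel_measurable M" "(\<lambda>i. L2sq M (\<lambda>x. ?I i x - Y x)) \<longlonglongrightarrow> 0"
    by blast
  have eq: "(\<integral>\<^sup>+\<omega>. (\<integral>\<^sup>+\<tau>\<in>{0..t}. ennreal ((norm (elem_process (n i) (p i) (\<xi> i) \<tau> \<omega> - \<phi> \<tau> \<omega>))\<^sup>2) \<partial>lborel) \<partial>M) =
      L2sq (time_prod t) (\<lambda>z. proc (n i) (p i) (\<xi> i) z - ?\<phi> z)" for i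
    unfolding proc_def using proc_measurable[OF E[of i]] \<phi>_meas
    by (intro L2sq_time_prod borel_measurable_diff) (simp_all add: proc_def[abs_def])
  have "is_ito_integral M F (\<beta> k) t \<phi> Y"
    unfolding is_ito_integral_def
  proof (intro conjI exI allI)
    show "(\<lambda>(\<tau>, \<omega>). \<phi> \<tau> \<omega>) \<in> borel_measurable (predictable M F t)"
      using \<phi> by (simp add: case_prod_beta')
    show "(\<integral>\<^sup>+\<omega>. (\<integral>\<^sup>+\<tau>\<in>{0..t}. ennreal ((norm (\<phi> \<tau> \<omega>))\<^sup>2) \<partial>lborel) \<partial>M) < \<infinity>"
      using L2sq_time_prod[OF \<phi>_meas] fin by simp
    show "elementary F t (n i) (p i) (\<xi> i)" for i
      by (rule E)
  qed (use Y lim in \<open>simp_all add: eq flip: L2sq_def\<close>)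
  then show ?thesis
    unfolding ito_integral_def by (rule someI[of "is_ito_integral M F (\<beta> k) t \<phi>"])
qed

text \<open>Orthogonality is used for the elementary approximations only, so the bound holds for
  arbitrary versions \<open>Y k\<close>. The factor \<open>4\<close> stems from two uses of the
  factor-2 inequality: from \<open>Y\<close> to elementary integrals, and from elementary processes
  to \<open>\<phi>\<close>.\<close>

lemma ito_sum_bound:
  fixes \<phi> :: "nat \<Rightarrow> real \<Rightarrow> 'w \<Rightarrow> 'b::{real_inner, second_countable_topology}"
  assumes J: "finite J" "J \<subseteq> supp_idx K lam" and t: "0 \<le> t"
    and ito: "\<And>k. k \<in> J \<Longrightarrow> is_ito_integral M F (\<beta> k) t (\<phi> k) (Y k)"
  shows "L2sq M (\<lambda>\<omega>. \<Sum>k\<in>J. Y k \<omega>) \<le>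
    4 * (\<Sum>k\<in>J. ennreal (lam k) * L2sq (time_prod t) (\<lambda>z. \<phi> k (fst z) (snd z)))"
proof -
  let ?\<phi> = "\<lambda>k z. \<phi> k (fst z) (snd z)"
  define P where "P k n p \<xi> \<longleftrightarrow> (\<forall>i. elementary F t (n i) (p i) (\<xi> i)) \<and>
      (\<lambda>i. L2sq (time_prod t) (\<lambda>z. proc (n i) (p i) (\<xi> i) z - ?\<phi> k z)) \<longlonglongrightarrow> 0 \<and>
      (\<lambda>i. L2sq M (\<lambda>\<omega>. elem_integral (\<beta> k) (n i) (p i) (\<xi> i) \<omega> - Y k \<omega>)) \<longlonglongrightarrow> 0" for k n p \<xi>
  have "\<forall>k\<in>J. \<exists>n p \<xi>. P k n p \<xi>"
  proof
    fix k assume "k \<in> J"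
    then show "\<exists>n p \<xi>. P k n p \<xi>"
      unfolding P_def by (rule is_ito_integralE[OF ito t]) (rule exI conjI allI | assumption)+
  qed
  then obtain n p \<xi> where P: "\<And>k. k \<in> J \<Longrightarrow> P k (n k) (p k) (\<xi> k)"
    by metis
  then have E: "\<And>k i. k \<in> J \<Longrightarrow> elementary F t (n k i) (p k i) (\<xi> k i)"
    and lim: "\<And>k. k \<in> J \<Longrightarrow>
      (\<lambda>i. L2sq (time_prod t) (\<lambda>z. proc (n k i) (p k i) (\<xi> k i) z - ?\<phi> k z)) \<longlonglongrightarrow> 0"
    and lim': "\<And>k. k \<in> J \<Longrightarrow>
      (\<lambda>i. L2sq M (\<lambda>\<omega>. elem_integral (\<beta> k) (n k i) (p k i) (\<xi> k i) \<omega> - Y k \<omega>)) \<longlonglongrightarrow> 0"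
    by (simp_all add: P_def)
  let ?I = "\<lambda>k i. elem_integral (\<beta> k) (n k i) (p k i) (\<xi> k i)"
  let ?P = "\<lambda>k i. proc (n k i) (p k i) (\<xi> k i)"
  have Y_meas: "Y k \<in> borel_measurable M" and \<phi>_meas: "?\<phi> k \<in> borel_measurable (time_prod t)" if "k \<in> J" for k
    using ito[OF that] t by (auto simp: is_ito_integral_def case_prod_beta' intro: predictable_time_prod)
  have I_meas: "?I k i \<in> borel_measurable M" if "k \<in> J" for k i
    using elem_integral_measurable[OF E[OF that] supp_idx_K] J that by auto
  \<comment> \<open>Everything that vanishes in the limit; the second term is doubled by both
    estimates, hence its coefficient \<open>4\<close>.\<close>
  define err where "err i = 2 * L2sq M (\<lambda>\<omega>. \<Sum>k\<in>J. ?I k i \<omega> - Y k \<omega>) +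
    4 * (\<Sum>k\<in>J. ennreal (lam k) * L2sq (time_prod t) (\<lambda>z. ?P k i z - ?\<phi> k z))" for i
  let ?R = "4 * (\<Sum>k\<in>J. ennreal (lam k) * L2sq (time_prod t) (?\<phi> k))"
  have "L2sq M (\<lambda>\<omega>. \<Sum>k\<in>J. Y k \<omega>) \<le> err i + ?R" for i
  proof -
    have "L2sq M (\<lambda>\<omega>. \<Sum>k\<in>J. Y k \<omega>) \<le>
        2 * L2sq M (\<lambda>\<omega>. (\<Sum>k\<in>J. Y k \<omega>) - (\<Sum>k\<in>J. ?I k i \<omega>)) + 2 * L2sq M (\<lambda>\<omega>. \<Sum>k\<in>J. ?I k i \<omega>)"
      by (intro L2sq_le borel_measurable_sum Y_meas I_meas)
    also have "L2sq M (\<lambda>\<omega>. (\<Sum>k\<in>J. Y k \<omega>) - (\<Sum>k\<in>J. ?I k i \<omega>)) = L2sq M (\<lambda>\<omega>. \<Sum>k\<in>J. ?I k i \<omega> - Y k \<omega>)"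
      by (subst L2sq_minus_commute) (simp add: sum_subtractf)
    also have "L2sq M (\<lambda>\<omega>. \<Sum>k\<in>J. ?I k i \<omega>) = (\<Sum>k\<in>J. ennreal (lam k) * L2sq (time_prod t) (?P k i))"
      by (intro elem_integral_isometry_sum J E)
    also have "\<dots> \<le> (\<Sum>k\<in>J. ennreal (lam k) *
        (2 * L2sq (time_prod t) (\<lambda>z. ?P k i z - ?\<phi> k z) + 2 * L2sq (time_prod t) (?\<phi> k)))"
      by (intro sum_mono mult_left_mono L2sq_le proc_measurable E \<phi>_meas) auto
    also have "\<dots> = 2 * (\<Sum>k\<in>J. ennreal (lam k) * L2sq (time_prod t) (\<lambda>z. ?P k i z - ?\<phi> k z)) +
        2 * (\<Sum>k\<in>J. ennreal (lam k) * L2sq (time_prod t) (?\<phi> k))"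
      by (simp add: distrib_left sum.distrib sum_distrib_left mult.left_commute)
    finally show ?thesis
      by (simp add: err_def distrib_left add.assoc add_left_mono mult_left_mono flip: mult.assoc)
  qed
  moreover have "(\<lambda>i. err i + ?R) \<longlonglongrightarrow> 0 + ?R"
  proof (intro tendsto_add tendsto_const)
    have "(\<lambda>i. L2sq M (\<lambda>\<omega>. \<Sum>k\<in>J. ?I k i \<omega> - Y k \<omega>)) \<longlonglongrightarrow> 0"
      by (intro L2sq_tendsto_sum J borel_measurable_diff I_meas Y_meas lim')
    moreover have "(\<lambda>i. \<Sum>k\<in>J. ennreal (lam k) * L2sq (time_prod t) (\<lambda>z. ?P k i z - ?\<phi> k z)) \<longlonglongrightarrow>
        (\<Sum>k\<in>J. ennreal (lam k) * 0)"
      by (intro tendsto_sum ennreal_tendsto_cmult lim) auto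
    ultimately have "err \<longlonglongrightarrow> 2 * 0 + 4 * (\<Sum>k\<in>J. ennreal (lam k) * 0)"
      unfolding err_def[abs_def] by (intro tendsto_add ennreal_tendsto_cmult) auto
    then show "err \<longlonglongrightarrow> 0"
      by simp
  qed
  ultimately show ?thesis
    by (intro LIMSEQ_le_const[where X = "\<lambda>i. err i + ?R"]) auto
qed

text \<open>The uniform bound \<open>R\<close> makes the weighted squared norms summable over
  \<open>I\<close>; \<open>ito_sum_bound\<close> on the blocks \<open>{m..<n}\<close> then gives the
  Cauchy property of the series. One more factor-2 estimate, from partial sums to the limit, turns 4
  into 8.\<close>

lemma stoch_integral_bound:
  fixes \<Phi> :: "real \<Rightarrow> 'w \<Rightarrow> 'u \<Rightarrow> 'b::{real_inner, banach, second_countable_topology}"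
  defines "I \<equiv> supp_idx K lam"
  assumes t: "0 \<le> t"
    and pred: "\<And>k. k \<in> I \<Longrightarrow>
      (\<lambda>z. \<Phi> (fst z) (snd z) (e k)) \<in> borel_measurable (predictable M F t)"
    and bound: "\<And>J. finite J \<Longrightarrow> J \<subseteq> I \<Longrightarrow>
      (\<Sum>k\<in>J. ennreal (lam k) * L2sq (time_prod t) (\<lambda>z. \<Phi> (fst z) (snd z) (e k))) \<le> R"
    and R: "R < \<infinity>"
  shows "stoch_integral M F I e \<beta> t \<Phi> \<in> borel_measurable M"
    and "L2sq M (stoch_integral M F I e \<beta> t \<Phi>) \<le> 8 * R"
proof -
  define a where "a k = ennreal (lam k) * L2sq (time_prod t) (\<lambda>z. \<Phi> (fst z) (snd z) (e k))" for k
  define Y where "Y k = ito_integral M F (\<beta> k) t (\<lambda>\<tau> \<omega>. \<Phi> \<tau> \<omega> (e k))" for k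
  define S where "S m \<omega> = (\<Sum>k\<in>I \<inter> {..<m}. Y k \<omega>)" for m :: nat and \<omega>
  have a_fin: "a k < \<infinity>" if "k \<in> I" for k
    using bound[of "{k}"] that R by (simp add: a_def le_less_trans)
  have ito: "is_ito_integral M F (\<beta> k) t (\<lambda>\<tau> \<omega>. \<Phi> \<tau> \<omega> (e k)) (Y k)" if "k \<in> I" for k
    unfolding Y_def
  proof (rule ito_integral_exists[OF _ t pred[OF that]])
    show k: "k \<in> supp_idx K lam"
      using that by (simp add: I_def)
    show "L2sq (time_prod t) (\<lambda>z. \<Phi> (fst z) (snd z) (e k)) < \<infinity>"
      using a_fin[OF that] supp_idx_pos[OF k] by (auto simp: a_def ennreal_mult_less_top)
  qed
  have Y_meas: "Y k \<in> borel_measurable M" if "k \<in> I" for k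
    using ito[OF that] by (simp add: is_ito_integral_def)
  have S_meas: "S m \<in> borel_measurable M" for m
    unfolding S_def[abs_def] by (intro borel_measurable_sum Y_meas) auto
  have Y_bound: "L2sq M (\<lambda>\<omega>. \<Sum>k\<in>J. Y k \<omega>) \<le> 4 * (\<Sum>k\<in>J. a k)" if "finite J" "J \<subseteq> I" for J
    unfolding a_def using that by (intro ito_sum_bound t ito) (auto simp: I_def)
  \<comment> \<open>Real values, extended by \<open>0\<close> outside \<open>I\<close>, make the
    Cauchy criterion for series over the natural numbers applicable.\<close>
  define b where "b k = (if k \<in> I then enn2real (a k) else 0)" for k
  have b: "(\<Sum>k\<in>I \<inter> J. a k) = ennreal (\<Sum>k\<in>J. b k)" if "finite J" for J
  proof -
    have "(\<Sum>k\<in>I \<inter> J. a k) = (\<Sum>k\<in>I \<inter> J. ennreal (b k))"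
      using a_fin by (intro sum.cong) (auto simp: b_def)
    also have "\<dots> = ennreal (\<Sum>k\<in>I \<inter> J. b k)"
      by (intro sum_ennreal) (auto simp: b_def)
    also have "(\<Sum>k\<in>I \<inter> J. b k) = (\<Sum>k\<in>J. b k)"
      using that by (intro sum.mono_neutral_left) (auto simp: b_def)
    finally show ?thesis .
  qed
  have "summable b"
  proof (rule summableI_nonneg_bounded)
    show "0 \<le> b k" for k
      by (simp add: b_def)
    show "(\<Sum>k<m. b k) \<le> enn2real R" for m
    proof -
      have "ennreal (\<Sum>k<m. b k) \<le> R"
        using bound[of "I \<inter> {..<m}"] b[of "{..<m}"] by (simp add: a_def)
      then show ?thesis
        using R enn2real_mono[of "ennreal (\<Sum>k<m. b k)" R] by (simp add: b_def sum_nonneg)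
    qed
  qed
  have "\<exists>X\<in>borel_measurable M. (\<lambda>m. L2sq M (\<lambda>\<omega>. S m \<omega> - X \<omega>)) \<longlonglongrightarrow> 0"
  proof (rule L2_complete[OF S_meas])
    fix \<epsilon> :: real assume \<epsilon>: "0 < \<epsilon>"
    then have "0 < \<epsilon> / 4"
      by simp
    then obtain n0 where n0: "\<And>m n. m \<ge> n0 \<Longrightarrow> norm (\<Sum>k\<in>{m..<n}. b k) < \<epsilon> / 4"
      using \<open>summable b\<close> unfolding summable_Cauchy by blast
    have le: "L2sq M (\<lambda>\<omega>. S n \<omega> - S m \<omega>) \<le> ennreal \<epsilon>" if "n0 \<le> m" "m \<le> n" for m n
    proof -
      have split: "I \<inter> {..<n} = (I \<inter> {..<m}) \<union> (I \<inter> {m..<n})" "(I \<inter> {..<m}) \<inter> (I \<inter> {m..<n}) = {}"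
        using that by auto
      have "S n \<omega> - S m \<omega> = (\<Sum>k\<in>I \<inter> {m..<n}. Y k \<omega>)" for \<omega>
        unfolding S_def split(1) using split(2) by (subst sum.union_disjoint) auto
      then have "L2sq M (\<lambda>\<omega>. S n \<omega> - S m \<omega>) \<le> 4 * ennreal (\<Sum>k\<in>{m..<n}. b k)"
        using Y_bound[of "I \<inter> {m..<n}"] b[of "{m..<n}"] by simp
      also have "\<dots> \<le> 4 * ennreal (\<epsilon> / 4)"
        using n0[OF that(1), of n] by (intro mult_left_mono ennreal_leI) auto
      also have "\<dots> = ennreal \<epsilon>"
        using ennreal_mult[of 4 "\<epsilon> / 4"] \<epsilon> by simp
      finally show ?thesis .
    qed
    show "\<exists>n0. \<forall>i\<ge>n0. \<forall>j\<ge>n0. L2sq M (\<lambda>x. S i x - S j x) \<le> ennreal \<epsilon>"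
    proof (intro exI allI impI)
      fix i j assume "i \<ge> n0" "j \<ge> n0"
      then show "L2sq M (\<lambda>x. S i x - S j x) \<le> ennreal \<epsilon>"
        using le[of j i] le[of i j] L2sq_minus_commute[of M "S i" "S j"] by (cases "j \<le> i") auto
    qed
  qed
  then have "\<exists>X. is_stoch_integral M F I e \<beta> t \<Phi> X"
    by (auto simp: is_stoch_integral_def L2sq_def S_def Y_def)
  then have "is_stoch_integral M F I e \<beta> t \<Phi> (stoch_integral M F I e \<beta> t \<Phi>)"
    unfolding stoch_integral_def by (rule someI_ex)
  then have X: "stoch_integral M F I e \<beta> t \<Phi> \<in> borel_measurable M"
    and lim: "(\<lambda>m. L2sq M (\<lambda>\<omega>. S m \<omega> - stoch_integral M F I e \<beta> t \<Phi> \<omega>)) \<longlonglongrightarrow> 0"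
    by (simp_all add: is_stoch_integral_def L2sq_def S_def Y_def)
  let ?X = "stoch_integral M F I e \<beta> t \<Phi>"
  show "?X \<in> borel_measurable M"
    by (rule X)
  have "L2sq M ?X \<le> 2 * L2sq M (\<lambda>\<omega>. S m \<omega> - ?X \<omega>) + 8 * R" for m
  proof -
    have "L2sq M ?X \<le> 2 * L2sq M (\<lambda>\<omega>. ?X \<omega> - S m \<omega>) + 2 * L2sq M (S m)"
      by (intro L2sq_le X S_meas)
    also have "L2sq M (\<lambda>\<omega>. ?X \<omega> - S m \<omega>) = L2sq M (\<lambda>\<omega>. S m \<omega> - ?X \<omega>)"
      by (rule L2sq_minus_commute)
    also have "L2sq M (S m) \<le> 4 * R"
    proof -
      have "L2sq M (S m) \<le> 4 * (\<Sum>k\<in>I \<inter> {..<m}. a k)"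
        using Y_bound[of "I \<inter> {..<m}"] by (simp add: S_def[abs_def])
      also have "\<dots> \<le> 4 * R"
        using bound[of "I \<inter> {..<m}"] by (intro mult_left_mono) (auto simp: a_def)
      finally show ?thesis .
    qed
    finally show ?thesis
      by (simp add: add_left_mono mult_left_mono flip: mult.assoc)
  qed
  moreover have "(\<lambda>m. 2 * L2sq M (\<lambda>\<omega>. S m \<omega> - ?X \<omega>) + 8 * R) \<longlonglongrightarrow> 2 * 0 + 8 * R"
    by (intro tendsto_add tendsto_const ennreal_tendsto_cmult lim) auto
  ultimately have "L2sq M ?X \<le> 2 * 0 + 8 * R"
    by (intro LIMSEQ_le_const[where X = "\<lambda>m. 2 * L2sq M (\<lambda>\<omega>. S m \<omega> - ?X \<omega>) + 8 * R"]) auto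
  then show "L2sq M ?X \<le> 8 * R"
    by simp
qed

end

section \<open>Stochastic convolutions\<close>

text \<open>Orbits are continuous, hence bounded on the compact interval; uniform boundedness
  converts this into a bound of the operator norms.\<close>

lemma resolvent_bounded:
  fixes S :: "real \<Rightarrow> 'h::banach \<Rightarrow>\<^sub>L 'h"
  assumes "\<And>x. continuous_on {0..} (\<lambda>t. blinfun_apply (S t) x)"
  shows "\<exists>C\<ge>0. \<forall>t\<in>{0..T}. norm (S t) \<le> C"
proof (rule uniform_boundedness)
  fix x
  have "compact ((\<lambda>t. blinfun_apply (S t) x) ` {0..T})"
    by (intro compact_continuous_image continuous_on_subset[OF assms]) auto
  then have "bounded ((\<lambda>t. blinfun_apply (S t) x) ` {0..T})"
    by (rule compact_imp_bounded)
  then show "\<exists>B. \<forall>t\<in>{0..T}. norm (blinfun_apply (S t) x) \<le> B"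
    by (auto simp: bounded_iff)
qed

text \<open>The displacement splits into an operator applied to a small vector, controlled by
  \<open>C\<close>, and a change of time with the vector held fixed, controlled by strong
  continuity. Joint continuity is what makes the convolution integrand measurable.\<close>

lemma continuous_on_strongly_continuous:
  fixes S :: "real \<Rightarrow> 'h::real_normed_vector \<Rightarrow>\<^sub>L 'h"
  assumes S: "\<And>x. continuous_on {0..} (\<lambda>t. blinfun_apply (S t) x)"
    and C: "\<And>\<tau>. \<tau> \<in> {0..t} \<Longrightarrow> norm (S \<tau>) \<le> C"
  shows "continuous_on ({0..t} \<times> UNIV) (\<lambda>p. blinfun_apply (S (t - fst p)) (snd p))"
  unfolding continuous_on_def
proof
  fix p :: "real \<times> 'h" assume p: "p \<in> {0..t} \<times> UNIV"
  let ?A = "{0..t} \<times> (UNIV :: 'h set)"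
  have "continuous_on ?A (\<lambda>q. blinfun_apply (S (t - fst q)) (snd p))"
    by (rule continuous_on_compose2[OF S[of "snd p"]]) (auto intro!: continuous_intros)
  then have "((\<lambda>q. blinfun_apply (S (t - fst q)) (snd p)) \<longlongrightarrow> blinfun_apply (S (t - fst p)) (snd p)) (at p within ?A)"
    using p by (auto simp: continuous_on_def)
  then have time: "((\<lambda>q. norm (blinfun_apply (S (t - fst q)) (snd p) - blinfun_apply (S (t - fst p)) (snd p))) \<longlongrightarrow> 0)
      (at p within ?A)"
    by (rule tendsto_norm_zero[OF LIM_zero])
  have "((\<lambda>q. snd q) \<longlongrightarrow> snd p) (at p within ?A)"
    by (intro tendsto_snd tendsto_ident_at)
  then have "((\<lambda>q. norm (snd q - snd p)) \<longlongrightarrow> 0) (at p within ?A)"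
    by (rule tendsto_norm_zero[OF LIM_zero])
  then have "((\<lambda>q. C * norm (snd q - snd p) + norm (blinfun_apply (S (t - fst q)) (snd p) - blinfun_apply (S (t - fst p)) (snd p)))
      \<longlongrightarrow> C * 0 + 0) (at p within ?A)"
    by (intro tendsto_add tendsto_mult tendsto_const time)
  then have lim: "((\<lambda>q. C * norm (snd q - snd p) + norm (blinfun_apply (S (t - fst q)) (snd p) - blinfun_apply (S (t - fst p)) (snd p)))
      \<longlongrightarrow> 0) (at p within ?A)"
    by simp
  have "\<forall>\<^sub>F q in at p within ?A. norm (blinfun_apply (S (t - fst q)) (snd q) - blinfun_apply (S (t - fst p)) (snd p)) \<le>
      C * norm (snd q - snd p) + norm (blinfun_apply (S (t - fst q)) (snd p) - blinfun_apply (S (t - fst p)) (snd p))"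
    unfolding eventually_at_filter
  proof (intro always_eventually allI impI)
    fix q assume "q \<in> ?A"
    then have "norm (S (t - fst q)) \<le> C"
      by (intro C) auto
    then have "norm (blinfun_apply (S (t - fst q)) (snd q - snd p)) \<le> C * norm (snd q - snd p)"
      by (rule order_trans[OF norm_blinfun mult_right_mono]) simp
    moreover have "norm (blinfun_apply (S (t - fst q)) (snd q) - blinfun_apply (S (t - fst p)) (snd p)) \<le>
        norm (blinfun_apply (S (t - fst q)) (snd q - snd p)) +
        norm (blinfun_apply (S (t - fst q)) (snd p) - blinfun_apply (S (t - fst p)) (snd p))"
      unfolding blinfun.diff_right by (rule order_trans[OF _ norm_triangle_ineq]) simp
    ultimately show "norm (blinfun_apply (S (t - fst q)) (snd q) - blinfun_apply (S (t - fst p)) (snd p)) \<le>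
      C * norm (snd q - snd p) + norm (blinfun_apply (S (t - fst q)) (snd p) - blinfun_apply (S (t - fst p)) (snd p))"
      by linarith
  qed
  then have "((\<lambda>q. blinfun_apply (S (t - fst q)) (snd q) - blinfun_apply (S (t - fst p)) (snd p)) \<longlongrightarrow> 0) (at p within ?A)"
    using lim by (rule Lim_null_comparison)
  then show "((\<lambda>q. blinfun_apply (S (t - fst q)) (snd q)) \<longlongrightarrow> blinfun_apply (S (t - fst p)) (snd p)) (at p within ?A)"
    by (rule LIM_zero_cancel)
qed

section \<open>Predictability of the convolution integrand\<close>

context wiener_family
begin

text \<open>The process is given on \<open>[0, T]\<close>, the integral at time \<open>t\<close>
  asks for predictability on \<open>[0, t]\<close>. The inclusion of the smaller strip is
  measurable, since cutting a rectangle at \<open>t\<close> leaves a rectangle or nothing.\<close>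

lemma measurable_predictable_restrict:
  assumes "f \<in> measurable (predictable M F T) N" "0 \<le> t" "t \<le> T"
  shows "f \<in> measurable (predictable M F t) N"
proof -
  have "(\<lambda>z. z) \<in> measurable (predictable M F t) (predictable M F T)"
    unfolding predictable_eq[of T]
  proof (rule measurable_measure_of)
    show "rects T \<subseteq> Pow ({0..T} \<times> space M)"
      using assms by (intro rects_Pow) simp
    show "(\<lambda>z. z) \<in> space (predictable M F t) \<rightarrow> {0..T} \<times> space M"
      using assms by (auto simp: space_predictable)
    fix A assume "A \<in> rects T"
    then have "A \<inter> ({0..t} \<times> space M) \<in> sets (predictable M F t)"
    proof (cases rule: rects_cases)
      case (1 s u B)
      have B: "B \<subseteq> space M"
        using sets.sets_into_space[OF 1(5)] space_F[OF 1(2)] by simp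
      show ?thesis
      proof (cases "s < t")
        case True
        have "A \<inter> ({0..t} \<times> space M) = {s<..min u t} \<times> B"
          unfolding 1(1) using B 1(2) by auto
        moreover have "{s<..min u t} \<times> B \<in> rects t"
          using 1 True by (intro rectsI) auto
        ultimately show ?thesis
          using assms by (simp add: sets_predictable sigma_sets.Basic)
      next
        case False
        then have "A \<inter> ({0..t} \<times> space M) = {}"
          unfolding 1(1) by auto
        then show ?thesis
          by simp
      qed
    next
      case (2 B)
      have "B \<subseteq> space M"
        using sets.sets_into_space[OF 2(2)] space_F[of 0] by simp
      then have "A \<inter> ({0..t} \<times> space M) = {0} \<times> B"
        unfolding 2(1) using assms by auto
      then show ?thesis
        using assms rects_zeroI[OF 2(2)] by (simp add: sets_predictable sigma_sets.Basic)
    qed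
    then show "(\<lambda>z. z) -` A \<inter> space (predictable M F t) \<in> sets (predictable M F t)"
      using assms by (simp add: space_predictable)
  qed
  from measurable_compose[OF this assms(1)] show ?thesis .
qed

text \<open>A nonempty sublevel set of time is the slice at 0 joined to the strip over
  \<open>(0, min y t]\<close>; the strip is a rectangle only if \<open>0 < min y t\<close>, which
  forces the separate case.\<close>

lemma fst_measurable_predictable:
  assumes "0 \<le> t"
  shows "fst \<in> borel_measurable (predictable M F t)"
proof (rule borel_measurableI_le)
  fix y :: real
  have space: "space M \<in> sets (F 0)"
    using sets.top[of "F 0"] space_F[of 0] by simp
  have zero: "{0} \<times> space M \<in> sets (predictable M F t)"
    using assms rects_zeroI[OF space] by (simp add: sets_predictable sigma_sets.Basic)
  consider "y < 0" | "0 \<le> y" "min y t = 0" | "0 \<le> y" "0 < min y t"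
    using assms by linarith
  then show "{z \<in> space (predictable M F t). fst z \<le> y} \<in> sets (predictable M F t)"
  proof cases
    case 1
    then have "{z \<in> space (predictable M F t). fst z \<le> y} = {}"
      using assms by (auto simp: space_predictable)
    then show ?thesis
      by (simp only: sets.empty_sets)
  next
    case 2
    then have "{z \<in> space (predictable M F t). fst z \<le> y} = {0} \<times> space M"
      using assms by (auto simp: space_predictable min_def split: if_splits)
    then show ?thesis
      using zero by simp
  next
    case 3
    then have "{0<..min y t} \<times> space M \<in> sets (predictable M F t)"
      using assms rectsI[OF _ 3(2) _ space, of t] by (simp add: sets_predictable sigma_sets.Basic)
    then have "{0} \<times> space M \<union> {0<..min y t} \<times> space M \<in> sets (predictable M F t)"
      using zero by simp
    moreover have "{z \<in> space (predictable M F t). fst z \<le> y} = {0} \<times> space M \<union> {0<..min y t} \<times> space M"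
      using assms 3 by (auto simp: space_predictable)
    ultimately show ?thesis
      by simp
  qed
qed

lemma predictable_convolution:
  fixes \<psi> :: "real \<times> 'w \<Rightarrow> 'h::{banach, second_countable_topology}" and S :: "real \<Rightarrow> 'h \<Rightarrow>\<^sub>L 'h"
  assumes t: "0 \<le> t" and S: "\<And>x. continuous_on {0..} (\<lambda>t. blinfun_apply (S t) x)"
    and C: "\<And>\<tau>. \<tau> \<in> {0..t} \<Longrightarrow> norm (S \<tau>) \<le> C"
    and \<psi>: "\<psi> \<in> borel_measurable (predictable M F t)"
  shows "(\<lambda>z. blinfun_apply (S (t - fst z)) (\<psi> z)) \<in> borel_measurable (predictable M F t)"
proof -
  let ?A = "{0..t} \<times> (UNIV :: 'h set)"
  \<comment> \<open>Joint continuity holds on the strip \<open>?A\<close> only; the indicator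
    extends the map to a Borel function on the whole product space.\<close>
  let ?G = "\<lambda>p. indicat_real ?A p *\<^sub>R blinfun_apply (S (t - fst p)) (snd p)"
  have "closed ?A"
    by (intro closed_Times) auto
  then have G: "?G \<in> borel_measurable borel"
    using continuous_on_strongly_continuous[OF S C]
    by (intro borel_measurable_continuous_on_indicator) auto
  have "(\<lambda>z. (fst z, \<psi> z)) \<in> borel_measurable (predictable M F t)"
    using fst_measurable_predictable[OF t] \<psi> by (rule borel_measurable_Pair)
  from measurable_compose[OF this G]
  have "(\<lambda>z. ?G (fst z, \<psi> z)) \<in> borel_measurable (predictable M F t)" .
  then show ?thesis
    by (rule measurable_cong[THEN iffD1, rotated]) (auto simp: space_predictable t)
qed

end

section \<open>The moment bound for the stochastic convolution\<close>

theorem theorem4: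
  fixes M :: "'w measure"
    and F :: "real \<Rightarrow> 'w measure"
    and T :: real
    and Q :: "'u::{real_inner, banach, second_countable_topology} \<Rightarrow>\<^sub>L 'u"
    and K :: "nat set"
    and e :: "nat \<Rightarrow> 'u"
    and lam :: "nat \<Rightarrow> real"
    and \<beta> :: "nat \<Rightarrow> real \<Rightarrow> 'w \<Rightarrow> real"
    and D :: "'h::{real_inner, banach, second_countable_topology} set"
    and A :: "'h \<Rightarrow> 'h"
    and a :: "real \<Rightarrow> real"
    and S :: "real \<Rightarrow> 'h \<Rightarrow>\<^sub>L 'h"
  defines "I \<equiv> supp_idx K lam"
    and "g \<equiv> U0_basis e lam"
  assumes "0 < T"
    and "prob_space M"
    and "normal_filtration M F"
    and "nonneg_selfadjoint Q"
    and "orthonormal_eigenbasis Q K e lam"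
    and "cylindrical_wiener M F K lam \<beta>"
    and "closed_densely_defined D A"
    and "\<forall>t\<ge>0. set_integrable lebesgue {0..t} a"
    and "volterra_resolvent D A a S"
  shows "\<exists>C::real. \<forall>\<Psi> \<in> N2 M F Q I g T.
    (\<Squnion>t\<in>{0..T}. \<integral>\<^sup>+\<omega>. ennreal (norm (stoch_convolution M F I e \<beta> S \<Psi> t \<omega>)) \<partial>M)
      \<le> ennreal (C * N2_norm M I g T \<Psi>)"
proof -
  interpret wiener_family M F K lam \<beta>
    using assms by (simp add: wiener_family_def wiener_family_axioms_def)
  have S_cont: "continuous_on {0..} (\<lambda>t. blinfun_apply (S t) x)" for x
    using \<open>volterra_resolvent D A a S\<close> by (simp add: volterra_resolvent_def)
  obtain C where C: "0 \<le> C" "\<And>t. t \<in> {0..T} \<Longrightarrow> norm (S t) \<le> C"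
    using resolvent_bounded[of S T] S_cont by blast
  show ?thesis
  \<comment> \<open>The second moment will be at most 8 C^2 times the squared norm of
    \<open>\<Psi>\<close>; rounding 8 up to the square 9 gives this constant.\<close>
  proof (intro exI[of _ "3 * C"] ballI SUP_least)
    fix \<Psi> :: "real \<Rightarrow> 'w \<Rightarrow> 'u \<Rightarrow> 'h" and t
    assume \<Psi>: "\<Psi> \<in> N2 M F Q I g T" and "t \<in> {0..T}"
    then have t: "0 \<le> t" "t \<le> T"
      by auto
    define R where "R = (\<integral>\<^sup>+\<omega>. (\<integral>\<^sup>+\<tau>\<in>{0..T}. ennreal ((hs_norm I g (\<Psi> \<tau> \<omega>))\<^sup>2) \<partial>lborel) \<partial>M)"
    have R: "R < \<infinity>"
      using \<Psi> by (simp add: N2_def R_def)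
    have \<Psi>_meas: "(\<lambda>z. \<Psi> (fst z) (snd z)) \<in> measurable (predictable M F T) (L20_borel Q I g)"
      using \<Psi> by (simp add: N2_def case_prod_beta')
    have \<Psi>_L20: "\<Psi> \<tau> \<omega> \<in> L20 Q I g" if "\<tau> \<in> {0..T}" "\<omega> \<in> space M" for \<tau> \<omega>
      using measurable_space[OF \<Psi>_meas, of "(\<tau>, \<omega>)"] that \<open>0 < T\<close>
      by (simp add: space_predictable space_L20_borel)
    have g_meas: "(\<lambda>z. \<Psi> (fst z) (snd z) (g k)) \<in> borel_measurable (predictable M F t)" if "k \<in> I" for k
      using measurable_compose[OF measurable_predictable_restrict[OF \<Psi>_meas t] measurable_L20_eval[OF that]] .
    have lam_pos: "0 < lam k" if "k \<in> I" for k
      using that supp_idx_pos by (simp add: I_def)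
    \<comment> \<open>The stochastic integral evaluates at \<open>e k\<close>, the Hilbert-Schmidt
      norm at \<open>g k\<close>; this scaling links the two and accounts for the weight
      \<open>lam k\<close> of the isometry.\<close>
    have g_e: "\<Psi> \<tau> \<omega> (g k) = sqrt (lam k) *\<^sub>R \<Psi> \<tau> \<omega> (e k)"
      if "k \<in> I" "\<tau> \<in> {0..T}" "\<omega> \<in> space M" for k \<tau> \<omega>
      using L20_scaleR[OF \<Psi>_L20[OF that(2,3)]] lam_pos[OF that(1)] by (simp add: g_def U0_basis_def)
    have e_meas: "(\<lambda>z. \<Psi> (fst z) (snd z) (e k)) \<in> borel_measurable (predictable M F t)" if k: "k \<in> I" for k
    proof -
      have "(\<lambda>z. (1 / sqrt (lam k)) *\<^sub>R \<Psi> (fst z) (snd z) (g k)) \<in> borel_measurable (predictable M F t)"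
        using g_meas[OF k] by (intro borel_measurable_scaleR borel_measurable_const)
      then show ?thesis
        by (rule measurable_cong[THEN iffD1, rotated])
          (use t lam_pos[OF k] g_e[OF k] in \<open>auto simp: space_predictable\<close>)
    qed
    let ?\<Phi> = "\<lambda>\<tau> \<omega> u. blinfun_apply (S (t - \<tau>)) (\<Psi> \<tau> \<omega> u)"
    have C_t: "norm (S \<tau>) \<le> C" if "\<tau> \<in> {0..t}" for \<tau>
      using C(2) t that by auto
    have \<Phi>_meas: "(\<lambda>z. ?\<Phi> (fst z) (snd z) (e k)) \<in> borel_measurable (predictable M F t)" if "k \<in> I" for k
      by (rule predictable_convolution[OF t(1) S_cont C_t e_meas[OF that]])
    have sum_bound: "(\<Sum>k\<in>J. ennreal (lam k) * L2sq (time_prod t) (\<lambda>z. ?\<Phi> (fst z) (snd z) (e k))) \<le>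
        ennreal (C\<^sup>2) * R" if J: "finite J" "J \<subseteq> I" for J
    proof -
      have g_meas': "(\<lambda>z. \<Psi> (fst z) (snd z) (g k)) \<in> borel_measurable (time_prod t)" if "k \<in> J" for k
        using that J t by (intro predictable_time_prod g_meas) auto
      have norm_meas: "(\<lambda>z. ennreal ((norm (\<Psi> (fst z) (snd z) (g k)))\<^sup>2)) \<in> borel_measurable (time_prod t)"
        if "k \<in> J" for k
        using g_meas'[OF that] by simp
      have "ennreal (lam k) * L2sq (time_prod t) (\<lambda>z. ?\<Phi> (fst z) (snd z) (e k)) \<le>
          ennreal (C\<^sup>2) * L2sq (time_prod t) (\<lambda>z. \<Psi> (fst z) (snd z) (g k))" if "k \<in> J" for k
      proof -
        have k: "k \<in> I"
          using that J by auto
        \<comment> \<open>Inside the square the weight becomes \<open>sqrt (lam k)\<close>, which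
          turns \<open>e k\<close> into \<open>g k\<close>.\<close>
        have "ennreal (lam k) * L2sq (time_prod t) (\<lambda>z. ?\<Phi> (fst z) (snd z) (e k)) =
            L2sq (time_prod t) (\<lambda>z. sqrt (lam k) *\<^sub>R ?\<Phi> (fst z) (snd z) (e k))"
          using predictable_time_prod[OF \<Phi>_meas[OF k] t(1)] lam_pos[OF k] by (simp add: L2sq_scaleR)
        also have "\<dots> \<le> L2sq (time_prod t) (\<lambda>z. C *\<^sub>R \<Psi> (fst z) (snd z) (g k))"
          unfolding L2sq_def
        proof (intro nn_integral_mono ennreal_leI power_mono norm_ge_zero)
          fix z assume z: "z \<in> space (time_prod t)"
          have "norm (sqrt (lam k) *\<^sub>R ?\<Phi> (fst z) (snd z) (e k)) =
              norm (blinfun_apply (S (t - fst z)) (\<Psi> (fst z) (snd z) (g k)))"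
            using z t g_e[OF k, of "fst z" "snd z"] by (auto simp: space_time_prod blinfun.scaleR_right)
          also have "\<dots> \<le> norm (S (t - fst z)) * norm (\<Psi> (fst z) (snd z) (g k))"
            by (rule norm_blinfun)
          also have "\<dots> \<le> C * norm (\<Psi> (fst z) (snd z) (g k))"
            using z by (intro mult_right_mono C_t) (auto simp: space_time_prod)
          finally show "norm (sqrt (lam k) *\<^sub>R ?\<Phi> (fst z) (snd z) (e k)) \<le> norm (C *\<^sub>R \<Psi> (fst z) (snd z) (g k))"
            using C(1) by simp
        qed
        also have "\<dots> = ennreal (C\<^sup>2) * L2sq (time_prod t) (\<lambda>z. \<Psi> (fst z) (snd z) (g k))"
          by (rule L2sq_scaleR[OF g_meas'[OF that]])
        finally show ?thesis .
      qed
      then have "(\<Sum>k\<in>J. ennreal (lam k) * L2sq (time_prod t) (\<lambda>z. ?\<Phi> (fst z) (snd z) (e k))) \<le>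
          ennreal (C\<^sup>2) * (\<Sum>k\<in>J. L2sq (time_prod t) (\<lambda>z. \<Psi> (fst z) (snd z) (g k)))"
        unfolding sum_distrib_left by (rule sum_mono)
      also have "(\<Sum>k\<in>J. L2sq (time_prod t) (\<lambda>z. \<Psi> (fst z) (snd z) (g k))) =
          (\<integral>\<^sup>+z. (\<Sum>k\<in>J. ennreal ((norm (\<Psi> (fst z) (snd z) (g k)))\<^sup>2)) \<partial>time_prod t)"
        unfolding L2sq_def
        by (intro nn_integral_sum[symmetric] norm_meas)
      \<comment> \<open>Back to the iterated form, where the finite sum is compared with the
        Hilbert-Schmidt norm pointwise and the time interval grows from \<open>[0, t]\<close> to
        \<open>[0, T]\<close>.\<close>
      also have "\<dots> = (\<integral>\<^sup>+\<omega>. (\<integral>\<^sup>+\<tau>\<in>{0..t}. (\<Sum>k\<in>J. ennreal ((norm (\<Psi> \<tau> \<omega> (g k)))\<^sup>2)) \<partial>lborel) \<partial>M)"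
        by (intro nn_integral_time_prod[symmetric] borel_measurable_sum norm_meas)
      also have "\<dots> \<le> R"
        unfolding R_def
      proof (intro nn_integral_mono)
        fix \<omega> \<tau> assume \<omega>: "\<omega> \<in> space M"
        show "(\<Sum>k\<in>J. ennreal ((norm (\<Psi> \<tau> \<omega> (g k)))\<^sup>2)) * indicator {0..t} \<tau> \<le>
            ennreal ((hs_norm I g (\<Psi> \<tau> \<omega>))\<^sup>2) * indicator {0..T} \<tau>"
        proof (cases "\<tau> \<in> {0..t}")
          case True
          then have "\<tau> \<in> {0..T}"
            using t by simp
          from hs_norm_sum_le[of "\<Psi> \<tau> \<omega>" g I J, OF L20_summable[OF \<Psi>_L20[OF this \<omega>]] J]
          show ?thesis
            using True t by (simp add: sum_ennreal ennreal_leI)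
        qed simp
      qed
      finally show ?thesis
        by (simp add: mult_left_mono)
    qed
    have CR: "ennreal (C\<^sup>2) * R < \<infinity>"
      using R by (simp add: ennreal_mult_less_top)
    let ?X = "stoch_convolution M F I e \<beta> S \<Psi> t"
    have X: "?X \<in> borel_measurable M" "L2sq M ?X \<le> 8 * (ennreal (C\<^sup>2) * R)"
      unfolding stoch_convolution_def I_def
      using stoch_integral_bound[where \<Phi> = ?\<Phi> and e = e, OF t(1) \<Phi>_meas[unfolded I_def] sum_bound[unfolded I_def] CR] by auto
    have "(\<integral>\<^sup>+\<omega>. ennreal (norm (?X \<omega>)) * 1 \<partial>M)\<^sup>2 \<le>
        (\<integral>\<^sup>+\<omega>. (ennreal (norm (?X \<omega>)))\<^sup>2 \<partial>M) * (\<integral>\<^sup>+\<omega>. 1\<^sup>2 \<partial>M)"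
      using X(1) by (intro Cauchy_Schwarz_nn_integral) auto
    also have "\<dots> = L2sq M ?X"
      by (simp add: L2sq_def ennreal_power emeasure_space_1)
    also have "\<dots> \<le> 8 * (ennreal (C\<^sup>2) * R)"
      by (rule X(2))
    also have "\<dots> \<le> 9 * (ennreal (C\<^sup>2) * R)"
      by (intro mult_right_mono) auto
    also have "\<dots> = (ennreal (3 * C * N2_norm M I g T \<Psi>))\<^sup>2"
    proof -
      have "R = ennreal ((N2_norm M I g T \<Psi>)\<^sup>2)"
        using R by (simp add: N2_norm_def flip: R_def)
      moreover have "0 \<le> N2_norm M I g T \<Psi>"
        by (simp add: N2_norm_def)
      ultimately show ?thesis
        using C(1) by (simp add: ennreal_power power_mult_distrib ennreal_mult mult.assoc)
    qed
    finally show "(\<integral>\<^sup>+\<omega>. ennreal (norm (?X \<omega>)) \<partial>M) \<le> ennreal (3 * C * N2_norm M I g T \<Psi>)"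
      by (rule ennreal_power2_le_imp_le[OF ord_eq_le_trans[rotated]]) simp
  qed
qed

end
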